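(* For every integer $k\ge 1$ there exist constants $\alpha_1>0$ and $\beta_1>0$ depending only on $k$ such that for all integers $n\ge 2$, $$\beta_1 n^{-1/2} \;\leq\; \left(\frac{\mathrm{Vol}\, \widetilde{C}}{\mathrm{Vol}\, B_M}\right)^{1/D_M} \;\leq\; \alpha_1 n^{-1/2},$$ where $\widetilde{C}=\widetilde{C}_{n,2k}$ is the translated section of the cone of nonnegative forms of degree $2k$ in $n$ variables, and $B_M$, $D_M$ are the $L^2$ unit ball and the dimension of the space $M_{n,2k}$ of forms of integral zero on the sphere.
   Context: $P_{n,2k}$ is the real vector space of real homogeneous polynomials (forms) of degree $2k$ in $n$ variables. $S^{n-1}$ is the unit sphere in $\mathbb{R}^n$ and $\sigma$ is the rotation invariant probability measure on it. $P_{n,2k}$ carries the inner product $\langle f,g\rangle=\int_{S^{n-1}} fg\,d\sigma$. $M=M_{n,2k}=\{f\in P_{n,2k} : \int_{S^{n-1}} f\,d\sigma=0\}$, $D_M=\dim M_{n,2k}$, and $B_M$ is the unit ball of $M_{n,2k}$ in the inner product $\langle\,,\rangle$; $\mathrm{Vol}$ is Lebesgue measure on $M_{n,2k}$ for this inner product. Let $r^{2k}=(x_1^2+\dots+x_n^2)^k$. The cone of nonnegative forms is $C=\{f\in P_{n,2k} : f(x)\ge 0 \text{ for all } x\in\mathbb{R}^n\}$, and $\widetilde{C}=\{f\in M_{n,2k} : f+r^{2k}\in C\}$. *)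

theory Defs
  imports "HOL-Probability.Probability" "HOL-Library.Function_Algebras"
begin

section \<open>Euclidean space of variable dimension\<close>

text \<open>
  The dimension is quantified inside the theorem, so \<open>\<real>\<^sup>n\<close> is the space
  of functions from \<open>{..<n}\<close> to the reals (extensional outside \<open>{..<n}\<close>), carrying
  the product of one-dimensional Lebesgue measures. The Euclidean norm of \<open>x\<close>
  is the library's \<open>L2_set x {..<n}\<close>.
\<close>

definition Rn :: "nat \<Rightarrow> (nat \<Rightarrow> real) measure" where
  "Rn n = (\<Pi>\<^sub>M i\<in>{..<n}. lborel)"

definition unit_ball :: "nat \<Rightarrow> (nat \<Rightarrow> real) set" where
  "unit_ball n = {x \<in> space (Rn n). L2_set x {..<n} \<le> 1}"

definition linear_map :: "nat \<Rightarrow> (nat \<Rightarrow> nat \<Rightarrow> real) \<Rightarrow> (nat \<Rightarrow> real) \<Rightarrow> nat \<Rightarrow> real" where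
  "linear_map n U x = (\<lambda>i\<in>{..<n}. \<Sum>j<n. U i j * x j)"

definition orthogonal_coeffs :: "nat \<Rightarrow> (nat \<Rightarrow> nat \<Rightarrow> real) \<Rightarrow> bool" where
  "orthogonal_coeffs n U \<longleftrightarrow>
     (\<forall>i<n. \<forall>j<n. (\<Sum>k<n. U k i * U k j) = (if i = j then 1 else 0)) \<and>
     (\<forall>i<n. \<forall>j<n. (\<Sum>k<n. U i k * U j k) = (if i = j then 1 else 0))"

lemma space_Rn: "space (Rn n) = PiE {..<n} (\<lambda>_. UNIV)"
  by (simp add: Rn_def space_PiM)

lemma sets_Rn: "sets (Rn n) = sets (\<Pi>\<^sub>M i\<in>{..<n}. borel)"
  unfolding Rn_def by (intro sets_PiM_cong) auto

lemma sets_Rn_lborel[measurable_cong]: "sets (Rn n) = sets (\<Pi>\<^sub>M i\<in>{..<n}. lborel)"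
  by (simp add: Rn_def)

interpretation Rn_psf: product_sigma_finite "\<lambda>_::nat. lborel :: real measure" ..

interpretation Rn_sigma: sigma_finite_measure "Rn n" for n
  unfolding Rn_def by (rule Rn_psf.sigma_finite) simp

lemma emeasure_Rn_PiE:
  "(\<And>i. i < n \<Longrightarrow> A i \<in> sets borel) \<Longrightarrow> emeasure (Rn n) (PiE {..<n} A) = (\<Prod>i<n. emeasure lborel (A i))"
  unfolding Rn_def by (subst Rn_psf.emeasure_PiM) auto

lemma measurable_Rn_component[measurable]: "i < n \<Longrightarrow> (\<lambda>x. x i) \<in> borel_measurable (Rn n)"
  unfolding Rn_def by measurable

lemma measurable_into_Rn:
  assumes "\<And>i. i < n \<Longrightarrow> (\<lambda>x. f x i) \<in> borel_measurable M"
  shows "(\<lambda>x. \<lambda>i\<in>{..<n}. f x i) \<in> measurable M (Rn n)"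
  unfolding Rn_def using assms by (intro measurable_restrict) auto

lemma measurable_L2_set[measurable]: "(\<lambda>x. L2_set x {..<n}) \<in> borel_measurable (Rn n)"
  unfolding L2_set_def by measurable

lemma measurable_linear_map[measurable]: "linear_map n U \<in> measurable (Rn n) (Rn n)"
  unfolding linear_map_def[abs_def] by (intro measurable_into_Rn) measurable

lemma unit_ball_sets[measurable]: "unit_ball n \<in> sets (Rn n)"
  unfolding unit_ball_def by measurable

lemma distr_Rn_coordinatewise:
  assumes g: "\<And>i. i < n \<Longrightarrow> distr lborel borel (g i) = lborel"
    and m: "\<And>i. i < n \<Longrightarrow> g i \<in> borel_measurable borel"
  shows "distr (Rn n) (Rn n) (\<lambda>x. \<lambda>i\<in>{..<n}. g i (x i)) = Rn n"
    and "(\<lambda>x. \<lambda>i\<in>{..<n}. g i (x i)) \<in> measurable (Rn n) (Rn n)"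
proof -
  show meas: "(\<lambda>x. \<lambda>i\<in>{..<n}. g i (x i)) \<in> measurable (Rn n) (Rn n)"
  proof (intro measurable_into_Rn)
    fix i assume "i < n"
    then show "(\<lambda>x. g i (x i)) \<in> borel_measurable (Rn n)"
      using measurable_compose[OF measurable_Rn_component m] by blast
  qed
  have "distr (Rn n) (Rn n) (\<lambda>x. \<lambda>i\<in>{..<n}. g i (x i)) = (\<Pi>\<^sub>M i\<in>{..<n}. lborel)"
  proof (rule Rn_psf.PiM_eqI)
    fix A :: "nat \<Rightarrow> real set"
    assume "\<And>i. i \<in> {..<n} \<Longrightarrow> A i \<in> sets lborel"
    then have A: "\<And>i. i < n \<Longrightarrow> A i \<in> sets borel" by simp
    have "emeasure (distr (Rn n) (Rn n) (\<lambda>x. \<lambda>i\<in>{..<n}. g i (x i))) (PiE {..<n} A)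
        = emeasure (Rn n) ((\<lambda>x. \<lambda>i\<in>{..<n}. g i (x i)) -` PiE {..<n} A \<inter> space (Rn n))"
      by (rule emeasure_distr[OF meas]) (auto simp: Rn_def intro!: sets_PiM_I_finite A)
    also have "(\<lambda>x. \<lambda>i\<in>{..<n}. g i (x i)) -` PiE {..<n} A \<inter> space (Rn n) = PiE {..<n} (\<lambda>i. g i -` A i)"
      by (auto simp: space_Rn PiE_iff)
    also have "emeasure (Rn n) \<dots> = (\<Prod>i<n. emeasure lborel (g i -` A i))"
      using measurable_sets[OF m A] by (intro emeasure_Rn_PiE) auto
    also have "\<dots> = (\<Prod>i<n. emeasure lborel (A i))"
    proof (rule prod.cong[OF refl])
      fix i assume "i \<in> {..<n}"
      then have "emeasure (distr lborel borel (g i)) (A i) = emeasure lborel (g i -` A i)"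
        using m A by (subst emeasure_distr) auto
      then show "emeasure lborel (g i -` A i) = emeasure lborel (A i)"
        using g \<open>i \<in> {..<n}\<close> by simp
    qed
    finally show "emeasure (distr (Rn n) (Rn n) (\<lambda>x. \<lambda>i\<in>{..<n}. g i (x i))) (PiE {..<n} A)
      = (\<Prod>i<n. emeasure lborel (A i))" .
  qed (auto simp: Rn_def)
  then show "distr (Rn n) (Rn n) (\<lambda>x. \<lambda>i\<in>{..<n}. g i (x i)) = Rn n"
    by (simp add: Rn_def)
qed

lemma distr_Rn_affine:
  assumes "c = 1 \<or> c = -1"
  shows "distr (Rn n) (Rn n) (\<lambda>x. \<lambda>i\<in>{..<n}. a i + c * x i) = Rn n"
proof (rule distr_Rn_coordinatewise(1))
  fix i
  have "density (distr lborel borel (\<lambda>x. a i + c * x)) (\<lambda>_. ennreal \<bar>c\<bar>) = lborel"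
    by (rule lborel_real_affine[symmetric]) (use assms in auto)
  moreover have "\<bar>c\<bar> = 1" using assms by auto
  ultimately show "distr lborel borel (\<lambda>x. a i + c * x) = lborel"
    by (simp add: density_1)
qed measurable

lemma nn_integral_Rn_affine:
  assumes "c = 1 \<or> c = -1" and [measurable]: "f \<in> borel_measurable (Rn n)"
  shows "(\<integral>\<^sup>+x. f (\<lambda>i\<in>{..<n}. a i + c * x i) \<partial>Rn n) = (\<integral>\<^sup>+x. f x \<partial>Rn n)"
proof -
  have "(\<lambda>x. \<lambda>i\<in>{..<n}. a i + c * x i) \<in> measurable (Rn n) (Rn n)"
    by (intro measurable_into_Rn) measurable
  then have "(\<integral>\<^sup>+x. f x \<partial>distr (Rn n) (Rn n) (\<lambda>x. \<lambda>i\<in>{..<n}. a i + c * x i))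
      = (\<integral>\<^sup>+x. f (\<lambda>i\<in>{..<n}. a i + c * x i) \<partial>Rn n)"
    by (rule nn_integral_distr) simp
  then show ?thesis
    by (simp add: distr_Rn_affine[OF assms(1)])
qed

lemma unit_ball_nonnull: "emeasure (Rn n) (unit_ball n) > 0"
proof (cases "n = 0")
  case True
  then show ?thesis
    using emeasure_Rn_PiE[of 0 "\<lambda>_. UNIV"] by (simp add: unit_ball_def space_Rn)
next
  case False
  have "PiE {..<n} (\<lambda>_. {0..1 / real n}) \<subseteq> unit_ball n"
  proof
    fix x :: "nat \<Rightarrow> real"
    assume x: "x \<in> PiE {..<n} (\<lambda>_. {0..1 / real n})"
    then have b: "0 \<le> x i \<and> x i \<le> 1 / real n" if "i < n" for i
      using that by (auto simp: PiE_iff)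
    have "L2_set x {..<n} \<le> (\<Sum>i<n. \<bar>x i\<bar>)"
      by (rule L2_set_le_sum_abs)
    also have "\<dots> \<le> (\<Sum>i<n. 1 / real n)"
      using b by (intro sum_mono) auto
    also have "\<dots> = 1" using False by simp
    finally show "x \<in> unit_ball n"
      using x by (auto simp: unit_ball_def space_Rn PiE_iff)
  qed
  then have "emeasure (Rn n) (PiE {..<n} (\<lambda>_. {0..1 / real n})) \<le> emeasure (Rn n) (unit_ball n)"
    by (intro emeasure_mono) auto
  moreover have "emeasure (Rn n) (PiE {..<n} (\<lambda>_. {0..1 / real n})) = (\<Prod>i<n. ennreal (1 / real n))"
    by (subst emeasure_Rn_PiE) auto
  moreover have "(\<Prod>i<n. ennreal (1 / real n)) > 0"
    using False by (subst prod_ennreal) auto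
  ultimately show ?thesis by order
qed

lemma unit_ball_finite: "emeasure (Rn n) (unit_ball n) < \<infinity>"
proof -
  have "unit_ball n \<subseteq> PiE {..<n} (\<lambda>_. {-1..1})"
  proof
    fix x assume x: "x \<in> unit_ball n"
    have "\<bar>x i\<bar> \<le> 1" if "i < n" for i
    proof -
      have "\<bar>x i\<bar> \<le> L2_set (\<lambda>i. \<bar>x i\<bar>) {..<n}"
        using that member_le_L2_set[of "{..<n}" i "\<lambda>i. \<bar>x i\<bar>"] by simp
      also have "\<dots> = L2_set x {..<n}" by (simp add: L2_set_def)
      finally show ?thesis using x by (simp add: unit_ball_def)
    qed
    then show "x \<in> PiE {..<n} (\<lambda>_. {-1..1})"
      using x by (auto simp: unit_ball_def space_Rn PiE_iff abs_le_iff)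
  qed
  then have "emeasure (Rn n) (unit_ball n) \<le> emeasure (Rn n) (PiE {..<n} (\<lambda>_. {-1..1}))"
    by (intro emeasure_mono) (auto simp: Rn_def intro!: sets_PiM_I_finite)
  also have "\<dots> = (\<Prod>i<n. ennreal 2)"
    by (subst emeasure_Rn_PiE) auto
  also have "\<dots> < \<infinity>" by (simp add: power_less_top_ennreal)
  finally show ?thesis .
qed

lemma linear_map_space: "linear_map n U x \<in> space (Rn n)"
  by (auto simp: linear_map_def space_Rn)

lemma orthogonal_coeffs_inverse:
  assumes "orthogonal_coeffs n U" "x \<in> space (Rn n)"
  shows "linear_map n U (linear_map n (\<lambda>i j. U j i) x) = x"
proof (rule extensionalityI[of _ "{..<n}"])
  fix i assume i: "i \<in> {..<n}"
  have "linear_map n U (linear_map n (\<lambda>i j. U j i) x) i = (\<Sum>j<n. \<Sum>k<n. U i j * (U k j * x k))"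
    using i by (simp add: linear_map_def sum_distrib_left)
  also have "\<dots> = (\<Sum>k<n. (\<Sum>j<n. U i j * U k j) * x k)"
    by (subst sum.swap) (simp add: sum_distrib_right mult.assoc)
  also have "\<dots> = (\<Sum>k<n. (if i = k then 1 else 0) * x k)"
    using assms(1) i by (intro sum.cong) (auto simp: orthogonal_coeffs_def)
  also have "\<dots> = x i" using i by (simp add: if_distrib[of "\<lambda>z. z * _"] cong: if_cong)
  finally show "linear_map n U (linear_map n (\<lambda>i j. U j i) x) i = x i" .
qed (use assms(2) in \<open>simp_all add: linear_map_def space_Rn PiE_iff\<close>)

lemma orthogonal_coeffs_norm:
  assumes "orthogonal_coeffs n U"
  shows "L2_set (linear_map n U x) {..<n} = L2_set x {..<n}"
proof -
  have "(\<Sum>i<n. (linear_map n U x i)\<^sup>2) = (\<Sum>i<n. \<Sum>j<n. \<Sum>k<n. (U i j * x j) * (U i k * x k))"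
    by (simp add: linear_map_def power2_eq_square sum_product)
  also have "\<dots> = (\<Sum>j<n. \<Sum>i<n. \<Sum>k<n. (U i j * x j) * (U i k * x k))"
    by (rule sum.swap)
  also have "\<dots> = (\<Sum>j<n. \<Sum>k<n. \<Sum>i<n. (U i j * x j) * (U i k * x k))"
    by (intro sum.cong refl sum.swap)
  also have "\<dots> = (\<Sum>j<n. \<Sum>k<n. (\<Sum>i<n. U i j * U i k) * (x j * x k))"
    by (simp add: sum_distrib_left sum_distrib_right mult_ac)
  also have "\<dots> = (\<Sum>j<n. \<Sum>k<n. (if j = k then 1 else 0) * (x j * x k))"
    using assms by (intro sum.cong) (auto simp: orthogonal_coeffs_def)
  also have "\<dots> = (\<Sum>j<n. (x j)\<^sup>2)"
    by (simp add: if_distrib[of "\<lambda>z. z * _"] power2_eq_square cong: if_cong)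
  finally show ?thesis by (simp add: L2_set_def)
qed

lemma linear_map_add:
  "linear_map n U (\<lambda>i\<in>{..<n}. w i + 1 * x i) = (\<lambda>i\<in>{..<n}. linear_map n U w i + 1 * linear_map n U x i)"
  by (auto simp: linear_map_def sum.distrib algebra_simps)

text \<open>
  Lebesgue measure on \<open>\<real>\<^sup>n\<close> is invariant under orthogonal maps: uniqueness of
  translation invariant measures up to a factor, normalised on the unit ball.
\<close>

lemma distr_Rn_orthogonal:
  assumes U: "orthogonal_coeffs n U"
  shows "distr (Rn n) (Rn n) (linear_map n U) = Rn n"
proof (rule measure_eqI)
  fix A assume "A \<in> sets (distr (Rn n) (Rn n) (linear_map n U))"
  then have A[measurable]: "A \<in> sets (Rn n)" by simp
  define T where "T = linear_map n U"
  define \<mu> where "\<mu> C = emeasure (Rn n) (T -` C \<inter> space (Rn n))" for C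
  let ?B = "unit_ball n"
  let ?add = "\<lambda>c x y. \<lambda>i\<in>{..<n}. x i + c * y i :: real"
  have T[measurable]: "T \<in> measurable (Rn n) (Rn n)" by (simp add: T_def)
  interpret P: pair_sigma_finite "Rn n" "Rn n" ..
  have add_meas: "(\<lambda>z. ?add c (f (fst z) (snd z)) (g (fst z) (snd z))) \<in> measurable (Rn n \<Otimes>\<^sub>M Rn n) (Rn n)"
    if f: "(\<lambda>z. f (fst z) (snd z)) \<in> measurable (Rn n \<Otimes>\<^sub>M Rn n) (Rn n)"
    and g: "(\<lambda>z. g (fst z) (snd z)) \<in> measurable (Rn n \<Otimes>\<^sub>M Rn n) (Rn n)" for f g c
  proof (intro measurable_into_Rn)
    fix i assume "i < n"
    show "(\<lambda>z. f (fst z) (snd z) i + c * g (fst z) (snd z) i) \<in> borel_measurable (Rn n \<Otimes>\<^sub>M Rn n)"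
      using measurable_compose[OF f measurable_Rn_component[OF \<open>i < n\<close>]]
        measurable_compose[OF g measurable_Rn_component[OF \<open>i < n\<close>]] by measurable
  qed
  have M1[measurable]: "(\<lambda>z. ?add c (T (fst z)) (snd z)) \<in> measurable (Rn n \<Otimes>\<^sub>M Rn n) (Rn n)" for c
    by (rule add_meas) measurable
  have M1'[measurable]: "(\<lambda>y. ?add c x y) \<in> measurable (Rn n) (Rn n)" for c x
    by (intro measurable_into_Rn) measurable
  have M2[measurable]: "(\<lambda>x. ?add c (T x) y) \<in> measurable (Rn n) (Rn n)" for c y
  proof (intro measurable_into_Rn)
    fix i assume "i < n"
    show "(\<lambda>x. T x i + c * y i) \<in> borel_measurable (Rn n)"
      using measurable_compose[OF T measurable_Rn_component[OF \<open>i < n\<close>]] by measurable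
  qed
  have ind: "\<mu> C = (\<integral>\<^sup>+x. indicator C (T x) \<partial>Rn n)" if [measurable]: "C \<in> sets (Rn n)" for C
  proof -
    have "(\<integral>\<^sup>+x. indicator C (T x) \<partial>Rn n) = (\<integral>\<^sup>+x. indicator (T -` C \<inter> space (Rn n)) x \<partial>Rn n)"
      by (intro nn_integral_cong) (auto simp: indicator_def)
    then show ?thesis unfolding \<mu>_def by simp
  qed
  have "\<mu> ?B * emeasure (Rn n) A
      = (\<integral>\<^sup>+x. indicator ?B (T x) * (\<integral>\<^sup>+y. indicator A y \<partial>Rn n) \<partial>Rn n)"
    by (simp add: ind nn_integral_multc)
  also have "\<dots> = (\<integral>\<^sup>+x. indicator ?B (T x) * (\<integral>\<^sup>+y. indicator A (?add (-1) (T x) y) \<partial>Rn n) \<partial>Rn n)"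
    by (subst nn_integral_Rn_affine) auto
  also have "\<dots> = (\<integral>\<^sup>+x. \<integral>\<^sup>+y. indicator ?B (T x) * indicator A (?add (-1) (T x) y) \<partial>Rn n \<partial>Rn n)"
    by (simp add: nn_integral_cmult)
  also have "\<dots> = (\<integral>\<^sup>+y. \<integral>\<^sup>+x. indicator ?B (T x) * indicator A (?add (-1) (T x) y) \<partial>Rn n \<partial>Rn n)"
    by (subst P.Fubini') (auto simp: case_prod_beta)
  also have "\<dots> = (\<integral>\<^sup>+y. \<integral>\<^sup>+x. indicator ?B (?add 1 (T x) y) * indicator A (T x) \<partial>Rn n \<partial>Rn n)"
  proof (rule nn_integral_cong)
    fix y assume y: "y \<in> space (Rn n)"
    define w where "w = linear_map n (\<lambda>i j. U j i) y"
    have Tw: "T (\<lambda>i\<in>{..<n}. w i + 1 * x i) = ?add 1 (T x) y" for x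
      unfolding T_def linear_map_add w_def orthogonal_coeffs_inverse[OF U y] by auto
    have cancel: "?add (-1) (?add 1 (T x) y) y = T x" for x
      by (auto simp: T_def linear_map_def)
    have "(\<integral>\<^sup>+x. indicator ?B (T x) * indicator A (?add (-1) (T x) y) \<partial>Rn n)
      = (\<integral>\<^sup>+x. indicator ?B (T (\<lambda>i\<in>{..<n}. w i + 1 * x i))
          * indicator A (?add (-1) (T (\<lambda>i\<in>{..<n}. w i + 1 * x i)) y) \<partial>Rn n)"
      by (rule nn_integral_Rn_affine[symmetric]) auto
    then show "(\<integral>\<^sup>+x. indicator ?B (T x) * indicator A (?add (-1) (T x) y) \<partial>Rn n)
      = (\<integral>\<^sup>+x. indicator ?B (?add 1 (T x) y) * indicator A (T x) \<partial>Rn n)"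
      unfolding Tw cancel .
  qed
  also have "\<dots> = (\<integral>\<^sup>+x. \<integral>\<^sup>+y. indicator ?B (?add 1 (T x) y) * indicator A (T x) \<partial>Rn n \<partial>Rn n)"
    by (subst P.Fubini') (auto simp: case_prod_beta)
  also have "\<dots> = (\<integral>\<^sup>+x. (\<integral>\<^sup>+y. indicator ?B (?add 1 (T x) y) \<partial>Rn n) * indicator A (T x) \<partial>Rn n)"
    by (simp add: nn_integral_multc)
  also have "\<dots> = (\<integral>\<^sup>+x. (\<integral>\<^sup>+y. indicator ?B y \<partial>Rn n) * indicator A (T x) \<partial>Rn n)"
    by (subst nn_integral_Rn_affine) auto
  also have "\<dots> = emeasure (Rn n) ?B * \<mu> A"
    by (simp add: ind nn_integral_cmult)
  finally have eq: "\<mu> ?B * emeasure (Rn n) A = emeasure (Rn n) ?B * \<mu> A" .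
  have "T -` ?B \<inter> space (Rn n) = ?B"
    using orthogonal_coeffs_norm[OF U] by (auto simp: unit_ball_def T_def linear_map_space)
  then have "emeasure (Rn n) ?B * emeasure (Rn n) A = emeasure (Rn n) ?B * \<mu> A"
    using eq by (simp add: \<mu>_def)
  then have "emeasure (Rn n) A = \<mu> A"
    using unit_ball_nonnull[of n] unit_ball_finite[of n]
    by (subst (asm) ennreal_mult_cancel_left) auto
  then show "emeasure (distr (Rn n) (Rn n) (linear_map n U)) A = emeasure (Rn n) A"
    by (simp add: emeasure_distr \<mu>_def T_def)
qed simp


section \<open>The rotation invariant probability measure on the sphere\<close>

text \<open>
  \<open>\<sigma>\<close> is realised as the image of the uniform measure on the unit ball under
  \<open>x \<mapsto> x / |x|\<close>. It is a measure on \<open>\<real>\<^sup>n\<close> concentrated on the unit sphere; the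
  lemmas below confirm that it is the rotation invariant probability measure.
\<close>

definition radial_projection :: "nat \<Rightarrow> (nat \<Rightarrow> real) \<Rightarrow> nat \<Rightarrow> real" where
  "radial_projection n x = (\<lambda>i\<in>{..<n}. x i / L2_set x {..<n})"

definition sphere_measure :: "nat \<Rightarrow> (nat \<Rightarrow> real) measure" where
  "sphere_measure n = distr (uniform_measure (Rn n) (unit_ball n)) (Rn n) (radial_projection n)"

lemma measurable_radial_projection[measurable]: "radial_projection n \<in> measurable (Rn n) (Rn n)"
  unfolding radial_projection_def[abs_def] by (intro measurable_into_Rn) measurable

lemma sets_sphere_measure[simp, measurable_cong]: "sets (sphere_measure n) = sets (Rn n)"
  by (simp add: sphere_measure_def)

lemma space_sphere_measure[simp]: "space (sphere_measure n) = space (Rn n)"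
  by (simp add: sphere_measure_def)

lemma prob_space_ball: "prob_space (uniform_measure (Rn n) (unit_ball n))"
  using unit_ball_nonnull[of n] unit_ball_finite[of n]
  by (intro prob_space_uniform_measure) auto

lemma prob_space_sphere_measure: "prob_space (sphere_measure n)"
  unfolding sphere_measure_def
  by (intro prob_space.prob_space_distr prob_space_ball) simp

lemma AE_sphere_measure:
  assumes "n \<ge> 1"
  shows "AE x in sphere_measure n. L2_set x {..<n} = 1"
proof -
  let ?z = "PiE {..<n} (\<lambda>_. {0}) :: (nat \<Rightarrow> real) set"
  have "?z \<in> sets (Rn n)"
    unfolding Rn_def by (intro sets_PiM_I_finite) auto
  moreover have "emeasure (Rn n) ?z = 0"
    using assms by (subst emeasure_Rn_PiE) auto
  ultimately have "?z \<in> null_sets (Rn n)"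
    by (rule null_setsI[rotated])
  then have "AE x in Rn n. x \<notin> ?z" by (rule AE_not_in)
  then have "AE x in Rn n. L2_set (radial_projection n x) {..<n} = 1"
  proof (rule AE_mp, intro AE_I2 impI)
    fix x assume "x \<in> space (Rn n)" "x \<notin> ?z"
    then have "L2_set x {..<n} \<noteq> 0"
      unfolding space_Rn PiE_iff by (auto simp: L2_set_eq_0_iff)
    moreover have "L2_set (radial_projection n x) {..<n} = L2_set (\<lambda>i. inverse (L2_set x {..<n}) * x i) {..<n}"
      by (intro L2_set_cong) (auto simp: radial_projection_def field_simps)
    ultimately show "L2_set (radial_projection n x) {..<n} = 1"
      by (simp add: L2_set_right_distrib[symmetric])
  qed
  then have "AE x in uniform_measure (Rn n) (unit_ball n). L2_set (radial_projection n x) {..<n} = 1"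
    by (intro AE_uniform_measureI) auto
  then show ?thesis
    unfolding sphere_measure_def by (subst AE_distr_iff) auto
qed

lemma sphere_measure_rotation_invariant:
  assumes U: "orthogonal_coeffs n U"
  shows "distr (sphere_measure n) (Rn n) (linear_map n U) = sphere_measure n"
proof -
  let ?T = "linear_map n U" and ?N = "uniform_measure (Rn n) (unit_ball n)"
  have commute: "?T (radial_projection n x) = radial_projection n (?T x)" for x
  proof (rule extensionalityI[of _ "{..<n}"])
    fix i assume "i \<in> {..<n}"
    then show "?T (radial_projection n x) i = radial_projection n (?T x) i"
      unfolding radial_projection_def orthogonal_coeffs_norm[OF U]
      by (simp add: linear_map_def sum_divide_distrib)
  qed (auto simp: linear_map_def radial_projection_def)
  have inv: "distr ?N (Rn n) ?T = ?N"
  proof (rule measure_eqI)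
    fix A assume "A \<in> sets (distr ?N (Rn n) ?T)"
    then have A[measurable]: "A \<in> sets (Rn n)" by simp
    have *: "unit_ball n \<inter> (?T -` A \<inter> space (Rn n)) = ?T -` (unit_ball n \<inter> A) \<inter> space (Rn n)"
      using orthogonal_coeffs_norm[OF U] by (auto simp: unit_ball_def linear_map_space)
    have "emeasure (distr ?N (Rn n) ?T) A = emeasure ?N (?T -` A \<inter> space (Rn n))"
      by (subst emeasure_distr) auto
    also have "\<dots> = emeasure (Rn n) (?T -` (unit_ball n \<inter> A) \<inter> space (Rn n)) / emeasure (Rn n) (unit_ball n)"
      by (subst emeasure_uniform_measure) (auto simp: * )
    also have "emeasure (Rn n) (?T -` (unit_ball n \<inter> A) \<inter> space (Rn n)) = emeasure (Rn n) (unit_ball n \<inter> A)"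
      using emeasure_distr[of ?T "Rn n" "Rn n" "unit_ball n \<inter> A"] by (simp add: distr_Rn_orthogonal[OF U])
    also have "\<dots> / emeasure (Rn n) (unit_ball n) = emeasure ?N A"
      by (subst emeasure_uniform_measure) auto
    finally show "emeasure (distr ?N (Rn n) ?T) A = emeasure ?N A" .
  qed simp
  have "distr (sphere_measure n) (Rn n) ?T = distr ?N (Rn n) (?T \<circ> radial_projection n)"
    unfolding sphere_measure_def by (rule distr_distr) auto
  also have "?T \<circ> radial_projection n = radial_projection n \<circ> ?T"
    by (auto simp: commute)
  also have "distr ?N (Rn n) (radial_projection n \<circ> ?T) = distr (distr ?N (Rn n) ?T) (Rn n) (radial_projection n)"
    by (rule distr_distr[symmetric]) auto
  also have "\<dots> = sphere_measure n"
    by (simp add: inv sphere_measure_def)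
  finally show ?thesis .
qed


section \<open>Forms\<close>

text \<open>
  A form in \<open>n\<close> variables is identified with its polynomial function, which reads only the
  coordinates below \<open>n\<close>; over the reals this identification is an isomorphism.
\<close>

type_synonym form = "(nat \<Rightarrow> real) \<Rightarrow> real"

definition scale_form :: "real \<Rightarrow> form \<Rightarrow> form" where
  "scale_form c f = (\<lambda>x. c * f x)"

global_interpretation form: vector_space scale_form
  by unfold_locales (auto simp: scale_form_def fun_eq_iff algebra_simps)

definition forms :: "nat \<Rightarrow> nat \<Rightarrow> form set" where
  "forms n d = form.span {(\<lambda>x. \<Prod>i<n. x i ^ a i) | a. (\<Sum>i<n. a i) = d}"

definition form_inner :: "nat \<Rightarrow> form \<Rightarrow> form \<Rightarrow> real" where
  "form_inner n f g = (\<integral>x. f x * g x \<partial>sphere_measure n)"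

definition mean_zero_forms :: "nat \<Rightarrow> nat \<Rightarrow> form set" where
  "mean_zero_forms n d = {f \<in> forms n d. (\<integral>x. f x \<partial>sphere_measure n) = 0}"

definition nonneg_forms :: "nat \<Rightarrow> nat \<Rightarrow> form set" where
  "nonneg_forms n d = {f \<in> forms n d. \<forall>x\<in>space (Rn n). f x \<ge> 0}"

definition radial_form :: "nat \<Rightarrow> nat \<Rightarrow> form" where
  "radial_form n k = (\<lambda>x. (\<Sum>i<n. (x i)\<^sup>2) ^ k)"

definition nonneg_section :: "nat \<Rightarrow> nat \<Rightarrow> form set" where
  "nonneg_section n k =
     {f \<in> mean_zero_forms n (2 * k). f + radial_form n k \<in> nonneg_forms n (2 * k)}"

definition form_ball :: "nat \<Rightarrow> form set \<Rightarrow> form set" where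
  "form_ball n V = {f \<in> V. form_inner n f f \<le> 1}"


section \<open>Volume on a space of forms\<close>

definition orthonormal_basis :: "nat \<Rightarrow> form set \<Rightarrow> (nat \<Rightarrow> form) \<Rightarrow> bool" where
  "orthonormal_basis n V b \<longleftrightarrow>
     form.span (b ` {..<form.dim V}) = V \<and>
     (\<forall>i<form.dim V. \<forall>j<form.dim V. form_inner n (b i) (b j) = (if i = j then 1 else 0))"

definition coordinate_volume :: "form set \<Rightarrow> (nat \<Rightarrow> form) \<Rightarrow> form set \<Rightarrow> real" where
  "coordinate_volume V b A =
     measure (Rn (form.dim V))
       {c \<in> space (Rn (form.dim V)). (\<Sum>i<form.dim V. scale_form (c i) (b i)) \<in> A}"

text \<open>
  Lebesgue measure for the inner product is Lebesgue measure of coordinates in an orthonormal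
  basis. The choice of basis is immaterial, see \<open>form_volume_eq\<close> below.
\<close>

definition form_volume :: "nat \<Rightarrow> form set \<Rightarrow> form set \<Rightarrow> real" where
  "form_volume n V A = coordinate_volume V (SOME b. orthonormal_basis n V b) A"

lemma measurable_form:
  assumes "f \<in> forms n d"
  shows "f \<in> borel_measurable (Rn n)"
  using assms unfolding forms_def
proof (induction rule: form.span_induct_alt)
  case base
  then show ?case by (simp add: zero_fun_def)
next
  case (step c g h)
  then show ?case by (auto simp: scale_form_def plus_fun_def)
qed

lemma bounded_form:
  assumes "f \<in> forms n d"
  shows "\<exists>B. \<forall>x. L2_set x {..<n} = 1 \<longrightarrow> \<bar>f x\<bar> \<le> B"
  using assms unfolding forms_def
proof (induction rule: form.span_induct_alt)
  case base
  then show ?case by (auto simp: zero_fun_def)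
next
  case (step c g h)
  obtain a where g: "g = (\<lambda>x. \<Prod>i<n. x i ^ a i)" using step by auto
  obtain B where B: "\<And>x. L2_set x {..<n} = 1 \<Longrightarrow> \<bar>h x\<bar> \<le> B" using step by auto
  have "\<bar>(scale_form c g + h) x\<bar> \<le> \<bar>c\<bar> + B" if x: "L2_set x {..<n} = 1" for x
  proof -
    have "\<bar>x i\<bar> \<le> 1" if "i < n" for i
      using that x member_le_L2_set[of "{..<n}" i "\<lambda>i. \<bar>x i\<bar>"] by (simp add: L2_set_def)
    then have "\<bar>g x\<bar> \<le> 1"
      unfolding g abs_prod by (intro prod_le_1) (auto simp: power_abs power_le_one)
    then have "\<bar>c * g x\<bar> \<le> \<bar>c\<bar>"
      by (simp add: abs_mult mult_left_le)
    then show ?thesis using B[OF x] by (simp add: scale_form_def)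
  qed
  then show ?case by blast
qed

lemma integrable_form_product:
  assumes "n \<ge> 1" "f \<in> forms n d" "g \<in> forms n d"
  shows "integrable (sphere_measure n) (\<lambda>x. f x * g x)"
proof -
  interpret prob_space "sphere_measure n" by (rule prob_space_sphere_measure)
  obtain B where B: "\<And>x. L2_set x {..<n} = 1 \<Longrightarrow> \<bar>f x\<bar> \<le> B" using bounded_form assms by blast
  obtain C where C: "\<And>x. L2_set x {..<n} = 1 \<Longrightarrow> \<bar>g x\<bar> \<le> C" using bounded_form assms by blast
  note [measurable] = assms(2,3)[THEN measurable_form]
  show ?thesis
  proof (rule integrable_const_bound)
    show "AE x in sphere_measure n. norm (f x * g x) \<le> B * C"
      using AE_sphere_measure[OF assms(1)]
    proof (rule AE_mp, intro AE_I2 impI)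
      fix x assume x: "L2_set x {..<n} = 1"
      show "norm (f x * g x) \<le> B * C"
        using mult_mono[OF B[OF x] C[OF x]] order_trans[OF abs_ge_zero B[OF x]] by (simp add: abs_mult)
    qed
  qed measurable
qed

lemma form_inner_commute: "form_inner n f g = form_inner n g f"
  by (simp add: form_inner_def mult.commute)

lemma sum_form_apply: "(\<Sum>i\<in>I. scale_form (c i) (b i)) x = (\<Sum>i\<in>I. c i * b i x)"
  by (induction I rule: infinite_finite_induct) (auto simp: scale_form_def)

lemma form_inner_sum_left:
  assumes "n \<ge> 1" "\<And>i. i \<in> I \<Longrightarrow> b i \<in> forms n d" "g \<in> forms n d"
  shows "form_inner n (\<Sum>i\<in>I. scale_form (c i) (b i)) g = (\<Sum>i\<in>I. c i * form_inner n (b i) g)"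
proof -
  have "form_inner n (\<Sum>i\<in>I. scale_form (c i) (b i)) g
      = (\<integral>x. (\<Sum>i\<in>I. c i * (b i x * g x)) \<partial>sphere_measure n)"
    by (simp add: form_inner_def sum_form_apply sum_distrib_right mult.assoc)
  also have "\<dots> = (\<Sum>i\<in>I. (\<integral>x. c i * (b i x * g x) \<partial>sphere_measure n))"
    by (intro Bochner_Integration.integral_sum integrable_mult_right integrable_form_product[OF assms(1), where d = d] assms)
  finally show ?thesis by (simp add: form_inner_def)
qed

lemma span_coordinates:
  assumes "f \<in> form.span (b ` {..<D::nat})"
  shows "\<exists>c. f = (\<Sum>i<D. scale_form (c i) (b i))"
  using assms
proof (induction rule: form.span_induct_alt)
  case base
  have "(0::form) = (\<Sum>i<D. scale_form 0 (b i))"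
    unfolding form.scale_zero_left by simp
  then show ?case by (rule exI[of _ "\<lambda>_. 0"])
next
  case (step r g h)
  then obtain j c where j: "j < D" "g = b j" and h: "h = (\<Sum>i<D. scale_form (c i) (b i))" by auto
  have "scale_form r g + h = (\<Sum>i<D. scale_form ((c(j := c j + r)) i) (b i))"
  proof
    fix x
    have "(\<Sum>i<D. (c(j := c j + r)) i * b i x) = (\<Sum>i<D. c i * b i x + (if i = j then r * b j x else 0))"
      by (intro sum.cong) (auto simp: algebra_simps)
    also have "\<dots> = (\<Sum>i<D. c i * b i x) + r * b j x"
      using j(1) by (simp add: sum.distrib)
    finally show "(scale_form r g + h) x = (\<Sum>i<D. scale_form ((c(j := c j + r)) i) (b i)) x"
      unfolding plus_fun_apply h sum_form_apply by (simp add: scale_form_def j)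
  qed
  then show ?case by blast
qed

lemma coordinate_volume_independent:
  assumes n: "n \<ge> 1" and V: "V \<subseteq> forms n d"
    and b: "orthonormal_basis n V b" and b': "orthonormal_basis n V b'"
  shows "coordinate_volume V b A = coordinate_volume V b' A"
proof -
  let ?D = "form.dim V"
  define U where "U j i = form_inner n (b i) (b' j)" for j i
  have exp: "e i = (\<Sum>j<?D. scale_form (form_inner n (e i) (e' j)) (e' j))"
    if i: "i < ?D" and e: "orthonormal_basis n V e" and e': "orthonormal_basis n V e'" for e e' i
  proof -
    have mem: "e' j \<in> forms n d" if "j < ?D" for j
      using that e' V form.span_superset[of "e' ` {..<?D}"] by (auto simp: orthonormal_basis_def)
    have "e i \<in> form.span (e' ` {..<?D})"
      using i e e' form.span_superset[of "e ` {..<?D}"] by (auto simp: orthonormal_basis_def)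
    then obtain c where c: "e i = (\<Sum>j<?D. scale_form (c j) (e' j))"
      using span_coordinates by blast
    have "form_inner n (e i) (e' j) = c j" if j: "j < ?D" for j
    proof -
      have "form_inner n (e i) (e' j) = (\<Sum>l<?D. c l * form_inner n (e' l) (e' j))"
        unfolding c by (intro form_inner_sum_left[OF n]) (auto intro: mem j)
      also have "\<dots> = (\<Sum>l<?D. c l * (if l = j then 1 else 0))"
        using e' j by (intro sum.cong) (auto simp: orthonormal_basis_def)
      also have "\<dots> = (\<Sum>l<?D. if l = j then c l else 0)"
        by (intro sum.cong) auto
      finally show ?thesis using j by simp
    qed
    then show ?thesis unfolding c by (intro sum.cong) (auto simp: c[symmetric])
  qed
  have gram: "(\<Sum>j<?D. form_inner n (e i) (e' j) * form_inner n (e l) (e' j)) = (if i = l then 1 else 0)"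
    if i: "i < ?D" and l: "l < ?D" and e: "orthonormal_basis n V e" and e': "orthonormal_basis n V e'" for e e' i l
  proof -
    have mem: "e' j \<in> forms n d" "e j \<in> forms n d" if "j < ?D" for j
      using that e e' V form.span_superset[of "e' ` {..<?D}"] form.span_superset[of "e ` {..<?D}"]
      by (auto simp: orthonormal_basis_def)
    have "form_inner n (e i) (e l)
        = form_inner n (\<Sum>j<?D. scale_form (form_inner n (e i) (e' j)) (e' j)) (e l)"
      using exp[OF i e e'] by simp
    also have "\<dots> = (\<Sum>j<?D. form_inner n (e i) (e' j) * form_inner n (e' j) (e l))"
      by (intro form_inner_sum_left[OF n]) (auto intro: mem l)
    finally show ?thesis
      using e i l by (simp add: orthonormal_basis_def form_inner_commute[of n "e l"])
  qed
  have U: "orthogonal_coeffs ?D U"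
    unfolding orthogonal_coeffs_def U_def
    using gram[OF _ _ b b'] gram[OF _ _ b' b] by (simp add: form_inner_commute[of n "b' _"])
  let ?S = "\<lambda>e. {c \<in> space (Rn ?D). (\<Sum>i<?D. scale_form (c i) (e i)) \<in> A}"
  have coord: "(\<Sum>i<?D. scale_form (c i) (b i)) = (\<Sum>j<?D. scale_form (linear_map ?D U c j) (b' j))" for c
  proof
    fix x
    have "(\<Sum>i<?D. c i * b i x) = (\<Sum>i<?D. c i * (\<Sum>j<?D. U j i * b' j x))"
    proof (rule sum.cong[OF refl])
      fix i assume "i \<in> {..<?D}"
      then have "b i x = (\<Sum>j<?D. scale_form (U j i) (b' j)) x"
        using exp[OF _ b b'] by (simp add: U_def)
      then show "c i * b i x = c i * (\<Sum>j<?D. U j i * b' j x)"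
        by (simp add: sum_form_apply)
    qed
    also have "\<dots> = (\<Sum>i<?D. \<Sum>j<?D. U j i * c i * b' j x)"
      by (simp add: sum_distrib_left mult_ac)
    also have "\<dots> = (\<Sum>j<?D. linear_map ?D U c j * b' j x)"
      by (subst sum.swap) (simp add: linear_map_def sum_distrib_right)
    finally show "(\<Sum>i<?D. scale_form (c i) (b i)) x = (\<Sum>j<?D. scale_form (linear_map ?D U c j) (b' j)) x"
      by (simp add: sum_form_apply)
  qed
  have S1: "?S b = linear_map ?D U -` ?S b' \<inter> space (Rn ?D)"
    by (auto simp: coord linear_map_space)
  have Ut: "orthogonal_coeffs ?D (\<lambda>i j. U j i)"
    using U by (auto simp: orthogonal_coeffs_def)
  have S2: "?S b' = linear_map ?D (\<lambda>i j. U j i) -` ?S b \<inter> space (Rn ?D)"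
    by (auto simp: coord linear_map_space orthogonal_coeffs_inverse[OF U])
  show ?thesis
  proof (cases "?S b' \<in> sets (Rn ?D)")
    case True
    then have "measure (distr (Rn ?D) (Rn ?D) (linear_map ?D U)) (?S b') = measure (Rn ?D) (?S b)"
      by (subst S1, intro measure_distr) auto
    then show ?thesis
      by (simp add: coordinate_volume_def distr_Rn_orthogonal[OF U])
  next
    case False
    moreover have "?S b \<notin> sets (Rn ?D)"
    proof
      assume "?S b \<in> sets (Rn ?D)"
      from measurable_sets[OF measurable_linear_map this, of "\<lambda>i j. U j i"] show False
        unfolding S2[symmetric] using False by (rule notE[rotated])
    qed
    ultimately show ?thesis
      by (simp add: coordinate_volume_def measure_notin_sets)
  qed
qed

lemma form_volume_eq:
  assumes "n \<ge> 1" "V \<subseteq> forms n d" "orthonormal_basis n V b"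
  shows "form_volume n V A = coordinate_volume V b A"
  unfolding form_volume_def
  using coordinate_volume_independent[OF assms(1,2) someI[of "orthonormal_basis n V", OF assms(3)] assms(3)] .

end

theory Submission
  imports Defs
begin

text \<open>
  Write \<open>K\<close> for the section and \<open>B\<close> for the \<open>L\<^sup>2\<close> ball of \<open>M\<close>, and let \<open>D = dim M\<close>.

  Lower bound: for a standard Gaussian \<open>f\<close> in \<open>M\<close> each value \<open>f v\<close> on the sphere is Gaussian of variance \<open>D\<close>,
  so the \<open>L\<^sup>2\<^sup>n\<close> norm of \<open>f\<close> is typically of order \<open>sqrt (n D)\<close>. By Barvinok's inequality it dominates the
  sup norm up to a constant, hence \<open>K\<close> blown up by a factor of order \<open>sqrt (n D)\<close> has Gaussian measure at least
  \<open>1/2\<close>. Bounding the Gaussian density from above on this set, and from below on the ball of radius \<open>sqrt D\<close>, gives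
  the volume ratio.

  Upper bound: \<open>K \<times> K\<close> fibres over the midpoints \<open>u\<close> with fibres \<open>{w. u + w \<in> K, u - w \<in> K}\<close>, so some fibre has
  volume at least \<open>4\<^sup>-\<^sup>D vol K\<close>. By Prekopa-Leindler the \<open>u\<close> with this property form a midpoint convex set,
  which is rotation invariant; an almost norm-minimal element of it is nearly constant on the sphere, hence at most
  \<open>1\<close>, and its fibre lies in twice the sup norm ball of \<open>M\<close>. A form of mean zero bounded by \<open>1\<close> on the sphere
  has gradient bounded by a constant there, so the Gaussian Poincare inequality bounds its \<open>L\<^sup>2\<close> norm by a
  constant times \<open>n\<^sup>-\<^sup>1\<^sup>/\<^sup>2\<close>.
\<close>

section \<open>Forms\<close>

text \<open>The order n^(-1/2) comes from exponents proportional to n. Forms of degree 2kn span a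
  space of dimension at most 2^((2k+1)n), so comparing the sup norm with the norm of exponent 2n
  costs only a constant after an n-th root; the 2n-th moment of a Gaussian of variance D is at most
  of order (nD)^n, and its factor n is what separates the radius sqrt (nD) from the typical Gaussian
  norm sqrt D. In the upper bound the obstacle is that membership in the section bounds a form only
  from below, while the gradient estimate needs a bound on its absolute value; hence the search for
  a centre bounded by 1 from above. An average over the orthogonal group would be the natural
  centre; minimising the norm over a convex invariant set replaces it, so no Haar measure appears.
  The only rotations to be constructed are reflections carrying one point of the sphere to another.
  Polar coordinates are avoided too: an invariant functional on forms is a multiple of the spherical
  mean, which transfers integrals between the Gaussian and the sphere. The gradient constant is free
  of n because it is read off from a polynomial of bounded degree on a line.\<close>

lemma forms_subspace: "form.subspace (forms n d)"
  by (simp add: forms_def)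

lemma forms_add: "f \<in> forms n d \<Longrightarrow> g \<in> forms n d \<Longrightarrow> (\<lambda>x. f x + g x) \<in> forms n d"
  using form.subspace_add[OF forms_subspace, of f n d g] by (simp add: plus_fun_def)

lemma forms_cmult: "f \<in> forms n d \<Longrightarrow> (\<lambda>x. c * f x) \<in> forms n d"
  using form.subspace_scale[OF forms_subspace, of f n d c] by (simp add: scale_form_def)

lemma forms_zero: "(\<lambda>x. 0) \<in> forms n d"
  using form.subspace_0[OF forms_subspace, of n d] by (simp add: zero_fun_def)

lemma forms_sum: "(\<And>i. i \<in> I \<Longrightarrow> f i \<in> forms n d) \<Longrightarrow> (\<lambda>x. \<Sum>i\<in>I. f i x) \<in> forms n d"
  by (induction I rule: infinite_finite_induct) (auto intro: forms_zero forms_add)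

lemma forms_monomial: "(\<Sum>i<n. a i) = d \<Longrightarrow> (\<lambda>x. \<Prod>i<n. x i ^ a i) \<in> forms n d"
  unfolding forms_def by (intro form.span_base) auto

lemma forms_induct [consumes 1, case_names zero step]:
  assumes "f \<in> forms n d"
    and "P (\<lambda>x. 0)"
    and "\<And>c a h. (\<Sum>i<n. a i) = d \<Longrightarrow> h \<in> forms n d \<Longrightarrow> P h \<Longrightarrow> P (\<lambda>x. c * (\<Prod>i<n. x i ^ a i) + h x)"
  shows "P f"
proof -
  have "f \<in> forms n d \<and> P f"
    using assms(1) unfolding forms_def
  proof (induction rule: form.span_induct_alt)
    case base
    show ?case using assms(2) form.span_zero by (simp add: zero_fun_def)
  next
    case (step c g h)
    then obtain a where a: "(\<Sum>i<n. a i) = d" "g = (\<lambda>x. \<Prod>i<n. x i ^ a i)" by auto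
    have eq: "scale_form c g + h = (\<lambda>x. c * (\<Prod>i<n. x i ^ a i) + h x)"
      by (simp add: scale_form_def plus_fun_def a)
    have "P (scale_form c g + h)"
      unfolding eq using assms(3)[OF a(1), of h c] step(2) by (simp add: forms_def)
    moreover have "scale_form c g + h \<in> form.span {(\<lambda>x. \<Prod>i<n. x i ^ a i) | a. (\<Sum>i<n. a i) = d}"
      by (intro form.span_add form.span_scale) (use step in \<open>auto intro: form.span_base\<close>)
    ultimately show ?case by blast
  qed
  then show ?thesis ..
qed

lemma forms_mult:
  assumes "f \<in> forms n d" "g \<in> forms n e"
  shows "(\<lambda>x. f x * g x) \<in> forms n (d + e)"
  using assms(1)
proof (induction rule: forms_induct)
  case zero
  show ?case by (simp add: forms_zero)
next
  case (step c a h)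
  have "(\<lambda>x. (\<Prod>i<n. x i ^ a i) * g x) \<in> forms n (d + e)"
    using assms(2)
  proof (induction rule: forms_induct)
    case zero
    show ?case by (simp add: forms_zero)
  next
    case (step c' a' h')
    have "(\<lambda>x. (\<Prod>i<n. x i ^ (a i + a' i))) \<in> forms n (d + e)"
      by (rule forms_monomial) (use step \<open>sum a {..<n} = d\<close> in \<open>simp add: sum.distrib\<close>)
    from forms_add[OF forms_cmult[OF this, of c'] step(3)] show ?case
      by (simp add: power_add prod.distrib algebra_simps)
  qed
  from forms_add[OF forms_cmult[OF this, of c] step(3)] show ?case
    by (simp add: algebra_simps)
qed

lemma forms_one: "(\<lambda>x. 1) \<in> forms n 0"
  using forms_monomial[of "\<lambda>_. 0" n 0] by simp

lemma forms_coord: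
  assumes "i < n" shows "(\<lambda>x. x i) \<in> forms n 1"
proof -
  have "(\<lambda>x. \<Prod>j<n. x j ^ (if j = i then 1 else 0)) \<in> forms n 1"
    by (rule forms_monomial) (use assms in simp)
  moreover have "(\<Prod>j<n. x j ^ (if j = i then 1 else 0)) = x i" for x :: "nat \<Rightarrow> real"
    using assms by (simp add: if_distrib[of "power _"] cong: if_cong)
  ultimately show ?thesis by simp
qed

lemma forms_power: "f \<in> forms n d \<Longrightarrow> (\<lambda>x. f x ^ m) \<in> forms n (d * m)"
proof (induction m)
  case (Suc m)
  from forms_mult[OF Suc(2) Suc(1)[OF Suc(2)]] show ?case by simp
qed (simp add: forms_one)

lemma forms_prod:
  assumes "finite I" "\<And>i. i \<in> I \<Longrightarrow> f i \<in> forms n (d i)"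
  shows "(\<lambda>x. \<Prod>i\<in>I. f i x) \<in> forms n (\<Sum>i\<in>I. d i)"
  using assms
proof (induction I)
  case (insert i I)
  have "(\<lambda>x. f i x * (\<Prod>i\<in>I. f i x)) \<in> forms n (d i + (\<Sum>i\<in>I. d i))"
    by (intro forms_mult insert) (use insert in auto)
  then show ?case using insert by simp
qed (simp add: forms_one)

lemma forms_linear_map:
  assumes "f \<in> forms n d"
  shows "(\<lambda>x. f (linear_map n U x)) \<in> forms n d"
  using assms
proof (induction rule: forms_induct)
  case zero
  show ?case by (simp add: forms_zero)
next
  case (step c a h)
  have "(\<lambda>x. \<Sum>j<n. U i j * x j) \<in> forms n 1" for i
    by (intro forms_sum forms_cmult forms_coord) auto
  then have "(\<lambda>x. (\<Sum>j<n. U i j * x j) ^ a i) \<in> forms n (a i)" for i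
    using forms_power[of "\<lambda>x. \<Sum>j<n. U i j * x j" n 1 "a i"] by simp
  then have "(\<lambda>x. \<Prod>i<n. (\<Sum>j<n. U i j * x j) ^ a i) \<in> forms n (\<Sum>i<n. a i)"
    by (intro forms_prod) auto
  from forms_add[OF forms_cmult[OF this[unfolded step(1)], of c] step(3)] show ?case
    by (simp add: linear_map_def)
qed

lemma forms_cong:
  assumes "f \<in> forms n d" "\<And>i. i < n \<Longrightarrow> x i = y i"
  shows "f x = f y"
  using assms(1)
  by (induction rule: forms_induct) (use assms(2) in \<open>auto intro!: prod.cong\<close>)

lemma forms_homogeneous:
  assumes "f \<in> forms n d" "\<And>i. i < n \<Longrightarrow> y i = t * x i"
  shows "f y = t ^ d * f x"
  using assms(1)
proof (induction rule: forms_induct)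
  case (step c a h)
  have "(\<Prod>i<n. y i ^ a i) = (\<Prod>i<n. t ^ a i * x i ^ a i)"
    using assms(2) by (intro prod.cong) (auto simp: power_mult_distrib)
  also have "\<dots> = t ^ d * (\<Prod>i<n. x i ^ a i)"
    using step(1) by (simp add: prod.distrib flip: power_sum)
  finally show ?case using step by (simp add: algebra_simps)
qed simp

lemma forms_continuous:
  assumes "f \<in> forms n d"
  shows "continuous_on UNIV f"
  using assms
proof (induction rule: forms_induct)
  case (step c a h)
  then show ?case by (intro continuous_intros continuous_on_product_coordinates) auto
qed simp

lemma radial_form_in_forms: "radial_form n k \<in> forms n (2 * k)"
proof -
  have "(\<lambda>x. x i ^ 2) \<in> forms n 2" if "i < n" for i
    using forms_power[OF forms_coord[OF that], of 2] by simp
  then have "(\<lambda>x. \<Sum>i<n. (x i)\<^sup>2) \<in> forms n 2"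
    by (intro forms_sum) auto
  from forms_power[OF this] show ?thesis by (simp add: radial_form_def)
qed

lemma radial_form_eq: "radial_form n k x = (L2_set x {..<n}) ^ (2 * k)"
  by (simp add: radial_form_def L2_set_def power_mult sum_nonneg)

section \<open>Integration of forms over the sphere and definiteness of the inner product\<close>

lemma integrable_form:
  assumes "n \<ge> 1" "f \<in> forms n d"
  shows "integrable (sphere_measure n) f"
proof -
  interpret prob_space "sphere_measure n" by (rule prob_space_sphere_measure)
  obtain B where B: "\<And>x. L2_set x {..<n} = 1 \<Longrightarrow> \<bar>f x\<bar> \<le> B" using bounded_form assms by blast
  note [measurable] = measurable_form[OF assms(2)]
  show ?thesis
  proof (rule integrable_const_bound)
    show "AE x in sphere_measure n. norm (f x) \<le> B"
      using AE_sphere_measure[OF assms(1)] by eventually_elim (use B in auto)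
  qed measurable
qed

lemma form_bound:
  assumes f: "f \<in> forms n d" and B: "\<And>v. L2_set v {..<n} = 1 \<Longrightarrow> f v \<le> B" and d: "d \<ge> 1"
  shows "f x \<le> B * L2_set x {..<n} ^ d"
proof (cases "L2_set x {..<n} = 0")
  case True
  then have "x i = 0" if "i < n" for i using that by (simp add: L2_set_eq_0_iff)
  \<comment> \<open>Here x agrees with 0 times itself, so homogeneity with factor 0 applies; as d
    \<ge> 1 the value is 0.\<close>
  then have "f x = 0 ^ d * f x" by (intro forms_homogeneous[OF f]) auto
  then show ?thesis using d True by (simp add: power_0_left split: if_splits)
next
  case False
  define v where "v = (\<lambda>i. inverse (L2_set x {..<n}) * x i)"
  have "L2_set v {..<n} = 1"
    unfolding v_def using False by (simp add: L2_set_right_distrib[symmetric])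
  moreover have "f x = L2_set x {..<n} ^ d * f v"
    by (rule forms_homogeneous[OF f]) (use False in \<open>simp add: v_def\<close>)
  ultimately show ?thesis
    using mult_right_mono[OF B[of v], of "L2_set x {..<n} ^ d"] by (simp add: mult.commute)
qed

lemma form_bound_abs:
  assumes f: "f \<in> forms n d" and B: "\<And>v. L2_set v {..<n} = 1 \<Longrightarrow> \<bar>f v\<bar> \<le> B" and d: "d \<ge> 1"
  shows "\<bar>f x\<bar> \<le> B * L2_set x {..<n} ^ d"
proof -
  have "f x \<le> B * L2_set x {..<n} ^ d"
    by (rule form_bound[OF f _ d]) (use B in \<open>auto simp: abs_le_iff\<close>)
  moreover have "(\<lambda>x. -1 * f x) x \<le> B * L2_set x {..<n} ^ d"
    by (rule form_bound[OF forms_cmult[OF f] _ d]) (use B in \<open>auto simp: abs_le_iff\<close>)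
  ultimately show ?thesis by (simp add: abs_le_iff)
qed

text \<open>Turns openness in the product topology into an open box. Cut to the coordinates below n,
  such a box has positive measure in \<open>Rn n\<close> and contains rational points; these are its
  two uses.\<close>

lemma open_fun_contains_PiE:
  fixes S :: "('a \<Rightarrow> 'b::topological_space) set"
  assumes "open S" "x \<in> S"
  shows "\<exists>X. x \<in> PiE UNIV X \<and> (\<forall>i. open (X i)) \<and> PiE UNIV X \<subseteq> S"
  using product_topology_open_contains_basis[of "\<lambda>_. euclidean" UNIV S x] assms
  unfolding open_fun_def by (metis open_openin)

text \<open>Positive definiteness. The sphere measure is an image of the uniform measure on the
  ball, so by homogeneity f vanishes almost everywhere on the ball. A nonzero value could be scaled
  into the interior, and continuity would spread it over an open box of positive measure.\<close>

lemma form_zero_if_inner_zero: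
  assumes n: "n \<ge> 1" and f: "f \<in> forms n d" and z: "form_inner n f f = 0"
  shows "f x = 0"
proof (rule ccontr)
  assume "f x \<noteq> 0"
  note [measurable] = measurable_form[OF f]
  interpret prob_space "sphere_measure n" by (rule prob_space_sphere_measure)
  have "AE x in sphere_measure n. f x * f x = 0"
    using z integrable_form_product[OF n f f] unfolding form_inner_def
    by (subst (asm) integral_nonneg_eq_0_iff_AE) auto
  then have "AE x in sphere_measure n. f x = 0" by simp
  then have "AE x in uniform_measure (Rn n) (unit_ball n). f (radial_projection n x) = 0"
    unfolding sphere_measure_def by (subst (asm) AE_distr_iff) auto
  then have ae: "AE x in Rn n. x \<in> unit_ball n \<longrightarrow> f (radial_projection n x) = 0"
    using unit_ball_finite[of n] unit_ball_nonnull[of n]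
    by (subst (asm) AE_uniform_measure) auto
  have ae: "AE x in Rn n. \<not> (x \<in> unit_ball n \<and> f x \<noteq> 0)"
    using ae
  proof eventually_elim
    case (elim x)
    have "f x = L2_set x {..<n} ^ d * f (radial_projection n x)"
      if "L2_set x {..<n} \<noteq> 0"
      by (rule forms_homogeneous[OF f]) (use that in \<open>simp add: radial_projection_def\<close>)
    \<comment> \<open>At the origin division by zero makes the radial projection the origin again,
      so f takes the same value at both and homogeneity with factor 1 applies.\<close>
    moreover have "f x = 0" if z: "L2_set x {..<n} = 0" and a: "x \<in> unit_ball n"
    proof -
      from z have "x i = 0" if "i < n" for i using that by (simp add: L2_set_eq_0_iff)
      then have "f x = 1 ^ d * f (radial_projection n x)"
        by (intro forms_homogeneous[OF f]) (auto simp: radial_projection_def)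
      then show ?thesis using elim a by simp
    qed
    ultimately show ?case using elim by (cases "L2_set x {..<n} = 0") auto
  qed
  \<comment> \<open>Scaling by s brings x to norm at most 1/2, strictly inside the ball, also when x
    is 0 below n.\<close>
  define s where "s = 1 / (2 * (L2_set x {..<n} + 1))"
  have s: "s > 0" by (simp add: s_def L2_set_nonneg add_nonneg_pos)
  define y where "y = (\<lambda>i. s * x i)"
  have "f y = s ^ d * f x"
    by (rule forms_homogeneous[OF f]) (simp add: y_def)
  then have fy: "f y \<noteq> 0" using \<open>f x \<noteq> 0\<close> s by simp
  have ny: "L2_set y {..<n} \<le> 1/2"
  proof -
    have "L2_set y {..<n} = s * L2_set x {..<n}"
      unfolding y_def using s by (simp add: L2_set_right_distrib[symmetric])
    also have "\<dots> \<le> 1/2"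
    proof -
      have "2 + 2 * L2_set x {..<n} > 0" by (simp add: L2_set_nonneg add_pos_nonneg)
      then show ?thesis unfolding s_def by (simp add: field_simps)
    qed
    finally show ?thesis .
  qed
  let ?S = "f -` (- {0}) \<inter> (\<lambda>x. L2_set x {..<n}) -` {..<1}"
  have "continuous_on UNIV (\<lambda>x::nat \<Rightarrow> real. L2_set x {..<n})"
    unfolding L2_set_def by (intro continuous_intros continuous_on_product_coordinates)
  then have "open ?S"
    using forms_continuous[OF f] by (intro open_Int open_vimage) auto
  moreover have "y \<in> ?S" using fy ny by simp
  ultimately obtain X where X: "y \<in> PiE UNIV X" "\<And>i. open (X i)" "PiE UNIV X \<subseteq> ?S"
    using open_fun_contains_PiE by metis
  have pos: "emeasure lborel (X i) \<noteq> 0" for i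
  proof -
    have "y i \<in> X i" using X(1) by auto
    then obtain e where e: "e > 0" "cball (y i) e \<subseteq> X i"
      using X(2)[of i] open_contains_cball by blast
    have "0 < ennreal (2 * e)" using e by simp
    also have "\<dots> = emeasure lborel (cball (y i) e)"
      using e by (simp add: cball_eq_atLeastAtMost)
    also have "\<dots> \<le> emeasure lborel (X i)"
      using e X(2)[of i] by (intro emeasure_mono) auto
    finally show ?thesis by simp
  qed
  let ?Q = "PiE {..<n} X"
  have Q: "z \<in> unit_ball n \<and> f z \<noteq> 0" if z: "z \<in> ?Q" for z
  proof -
    \<comment> \<open>Points of \<open>Rn n\<close> are undefined from n on; filling in y there
      gives a point of the full box at which f and the norm are the same.\<close>
    let ?z = "\<lambda>i. if i < n then z i else y i"
    have "?z i \<in> X i" for i using z X(1) by (cases "i < n") (auto simp: PiE_iff)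
    then have "?z \<in> PiE UNIV X" by (intro PiE_I) auto
    with X(3) have "?z \<in> ?S" by (rule subsetD)
    moreover have "f ?z = f z" by (rule forms_cong[OF f]) auto
    moreover have "L2_set ?z {..<n} = L2_set z {..<n}" by (intro L2_set_cong) auto
    ultimately show ?thesis using z by (auto simp: unit_ball_def space_Rn PiE_iff)
  qed
  have "{z \<in> space (Rn n). \<not> \<not> (z \<in> unit_ball n \<and> f z \<noteq> 0)} \<in> null_sets (Rn n)"
    by (rule AE_E[OF ae], rule null_setsI) (auto intro: emeasure_eq_0 sets.sets_Collect)
  moreover have "?Q \<subseteq> {z \<in> space (Rn n). \<not> \<not> (z \<in> unit_ball n \<and> f z \<noteq> 0)}"
    using Q by (auto simp: unit_ball_def)
  moreover have "?Q \<in> sets (Rn n)"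
    unfolding Rn_def using X(2) by (intro sets_PiM_I_finite) auto
  ultimately have "emeasure (Rn n) ?Q = 0"
    using emeasure_eq_0 null_sets_subset by (meson null_setsD1)
  moreover have "emeasure (Rn n) ?Q = (\<Prod>i<n. emeasure lborel (X i))"
    by (rule emeasure_Rn_PiE) (use X(2) in auto)
  ultimately show False using pos by (auto simp: prod_zero_iff)
qed


section \<open>Orthonormal bases and rotation invariance\<close>

text \<open>The monomials are counted as lists of n exponents with sum d. The crude power of 2 is
  enough, since it is used for d = 2kn and then an n-th root is taken.\<close>

lemma forms_finite_span: "\<exists>B. finite B \<and> card B \<le> 2 ^ (n + d) \<and> forms n d = form.span B"
proof -
  let ?L = "{l :: nat list. length l = n \<and> sum_list l = d}"
  let ?m = "\<lambda>l::nat list. (\<lambda>x. \<Prod>i<n. x i ^ (l ! i)) :: form"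
  have "?L \<subseteq> {l. set l \<subseteq> {..d} \<and> length l = n}"
    by (auto intro: member_le_sum_list)
  then have fin: "finite ?L"
    by (rule finite_subset) (intro finite_lists_length_eq, simp)
  have "card (?m ` ?L) \<le> card ?L" by (rule card_image_le[OF fin])
  also have "\<dots> = (d + n - 1) choose d" by (rule card_length_sum_list)
  also have "\<dots> \<le> 2 ^ (d + n - 1)" by (rule binomial_le_pow2)
  also have "\<dots> \<le> 2 ^ (n + d)" by (intro power_increasing) auto
  finally have card: "card (?m ` ?L) \<le> 2 ^ (n + d)" .
  have "{(\<lambda>x. \<Prod>i<n. x i ^ a i) | a. (\<Sum>i<n. a i) = d} = ?m ` ?L"
  proof (intro equalityI subsetI)
    fix g :: form assume "g \<in> {(\<lambda>x. \<Prod>i<n. x i ^ a i) | a. (\<Sum>i<n. a i) = d}"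
    then obtain a where a: "g = (\<lambda>x. \<Prod>i<n. x i ^ a i)" "(\<Sum>i<n. a i) = d" by auto
    have "sum_list (map a [0..<n]) = d"
      using a(2) by (simp add: interv_sum_list_conv_sum_set_nat atLeast0LessThan)
    then show "g \<in> ?m ` ?L"
      by (intro image_eqI[of _ _ "map a [0..<n]"]) (simp_all add: a)
  next
    fix g :: form assume "g \<in> ?m ` ?L"
    then obtain l where l: "g = ?m l" "length l = n" "sum_list l = d" by auto
    then have "(\<Sum>i<n. l ! i) = d" by (simp add: sum_list_sum_nth atLeast0LessThan)
    then show "g \<in> {(\<lambda>x. \<Prod>i<n. x i ^ a i) | a. (\<Sum>i<n. a i) = d}"
      using l by auto
  qed
  then show ?thesis using fin card unfolding forms_def by (intro exI[of _ "?m ` ?L"]) auto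
qed

lemma form_inner_add_left:
  assumes "n \<ge> 1" "f \<in> forms n d" "g \<in> forms n d" "h \<in> forms n d"
  shows "form_inner n (f + g) h = form_inner n f h + form_inner n g h"
  unfolding form_inner_def
  using integrable_form_product[OF assms(1,2,4)] integrable_form_product[OF assms(1,3,4)]
  by (simp add: algebra_simps)

lemma form_inner_scale_left: "form_inner n (scale_form c f) g = c * form_inner n f g"
  by (simp add: form_inner_def scale_form_def mult.assoc)

lemma form_inner_scale_right: "form_inner n f (scale_form c g) = c * form_inner n f g"
  by (simp add: form_inner_scale_left form_inner_commute[of n f])

lemma form_inner_nonneg: "form_inner n f f \<ge> 0"
  unfolding form_inner_def by simp

text \<open>The length m is free, whereas \<open>orthonormal_basis\<close> fixes it to the
  dimension; this lets Gram-Schmidt extend a family one form at a time.\<close>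

definition orthonormal_family :: "nat \<Rightarrow> nat \<Rightarrow> (nat \<Rightarrow> form) \<Rightarrow> bool" where
  "orthonormal_family n m b \<longleftrightarrow> (\<forall>i<m. \<forall>j<m. form_inner n (b i) (b j) = (if i = j then 1 else 0))"

lemma orthonormal_family_coeff:
  assumes "n \<ge> 1" "\<And>i. i < m \<Longrightarrow> b i \<in> forms n d" "orthonormal_family n m b" "j < m"
  shows "form_inner n (\<Sum>i<m. scale_form (c i) (b i)) (b j) = c j"
proof -
  have "form_inner n (\<Sum>i<m. scale_form (c i) (b i)) (b j) = (\<Sum>i<m. c i * form_inner n (b i) (b j))"
    by (intro form_inner_sum_left) (use assms in auto)
  also have "\<dots> = (\<Sum>i<m. if i = j then c i else 0)"
    using assms by (intro sum.cong) (auto simp: orthonormal_family_def)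
  finally show ?thesis using assms by simp
qed

lemma form_inner_sum_sum:
  assumes "n \<ge> 1" "\<And>i. i < m \<Longrightarrow> b i \<in> forms n d" "orthonormal_family n m b"
  shows "form_inner n (\<Sum>i<m. scale_form (c i) (b i)) (\<Sum>i<m. scale_form (e i) (b i)) = (\<Sum>i<m. c i * e i)"
proof -
  have "(\<Sum>i<m. scale_form (e i) (b i)) \<in> forms n d"
    using assms by (intro form.subspace_sum[OF forms_subspace] form.subspace_scale[OF forms_subspace]) auto
  then have "form_inner n (\<Sum>i<m. scale_form (c i) (b i)) (\<Sum>i<m. scale_form (e i) (b i))
      = (\<Sum>i<m. c i * form_inner n (b i) (\<Sum>i<m. scale_form (e i) (b i)))"
    by (intro form_inner_sum_left) (use assms in auto)
  also have "\<dots> = (\<Sum>i<m. c i * e i)"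
    using orthonormal_family_coeff[OF assms(1,2,3)]
    by (intro sum.cong refl) (simp add: form_inner_commute[of n "b _"])
  finally show ?thesis .
qed

lemma orthonormal_family_inj:
  assumes "orthonormal_family n m b"
  shows "inj_on b {..<m}"
proof (rule inj_onI)
  fix i j assume "i \<in> {..<m}" "j \<in> {..<m}" "b i = b j"
  then show "i = j"
    using assms unfolding orthonormal_family_def by (metis lessThan_iff zero_neq_one)
qed

lemma orthonormal_family_independent:
  assumes "n \<ge> 1" "\<And>i. i < m \<Longrightarrow> b i \<in> forms n d" "orthonormal_family n m b"
  shows "form.independent (b ` {..<m})"
proof -
  have "u v = 0" if u: "(\<Sum>v\<in>b ` {..<m}. scale_form (u v) v) = 0" and v: "v \<in> b ` {..<m}" for u v
  proof -
    obtain j where j: "j < m" "v = b j" using v by auto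
    have "(\<Sum>i<m. scale_form (u (b i)) (b i)) = 0"
      using u by (subst (asm) sum.reindex[OF orthonormal_family_inj[OF assms(3)]]) (simp add: comp_def)
    then have "u (b j) = form_inner n 0 (b j)"
      using orthonormal_family_coeff[OF assms j(1), of "\<lambda>i. u (b i)"] by simp
    then show ?thesis by (simp add: j form_inner_def)
  qed
  then show ?thesis by (subst form.dependent_finite) auto
qed

text \<open>A Gram-Schmidt step: subtract from f its projection on the span and normalise.
  Definiteness of the inner product guarantees that the remainder has nonzero norm.\<close>

lemma orthonormal_family_extend:
  assumes n: "n \<ge> 1" and V: "form.subspace V" "V \<subseteq> forms n d"
    and b: "\<And>i. i < m \<Longrightarrow> b i \<in> V" "orthonormal_family n m b"
    and f: "f \<in> V" "f \<notin> form.span (b ` {..<m})"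
  shows "\<exists>e\<in>V. orthonormal_family n (Suc m) (b(m := e))"
proof -
  define p where "p = (\<Sum>i<m. scale_form (form_inner n f (b i)) (b i))"
  define g where "g = f + scale_form (-1) p"
  have pV: "p \<in> V" unfolding p_def
    by (intro form.subspace_sum[OF V(1)] form.subspace_scale[OF V(1)]) (use b in auto)
  have gV: "g \<in> V" unfolding g_def
    by (intro form.subspace_add[OF V(1)] form.subspace_scale[OF V(1)] f pV)
  have gb: "form_inner n g (b j) = 0" if j: "j < m" for j
  proof -
    have "form_inner n g (b j) = form_inner n f (b j) + form_inner n (scale_form (-1) p) (b j)"
      unfolding g_def by (rule form_inner_add_left[OF n, where d = d])
        (use V f b j form.subspace_scale[OF V(1) pV] in blast)+
    also have "form_inner n p (b j) = form_inner n f (b j)"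
      unfolding p_def by (rule orthonormal_family_coeff[OF n _ b(2) j]) (use b V in auto)
    then have "form_inner n (scale_form (-1) p) (b j) = - form_inner n f (b j)"
      unfolding form_inner_scale_left by simp
    finally show ?thesis by simp
  qed
  have "form_inner n g g \<noteq> 0"
  proof
    assume "form_inner n g g = 0"
    then have "g = 0"
      using form_zero_if_inner_zero[OF n, of g d] gV V by (auto simp: fun_eq_iff)
    then have "f = p" by (auto simp: g_def scale_form_def fun_eq_iff)
    moreover have "p \<in> form.span (b ` {..<m})"
      unfolding p_def by (intro form.span_sum form.span_scale form.span_base) auto
    ultimately show False using f by simp
  qed
  then have pos: "form_inner n g g > 0" using form_inner_nonneg[of n g] by simp
  define e where "e = scale_form (1 / sqrt (form_inner n g g)) g"
  have "form_inner n e e = 1"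
    using pos by (simp add: e_def form_inner_scale_left form_inner_scale_right)
  moreover have "form_inner n e (b j) = 0" "form_inner n (b j) e = 0" if "j < m" for j
    using gb[OF that] by (simp_all add: e_def form_inner_scale_left form_inner_scale_right form_inner_commute[of n "b j"])
  ultimately have "orthonormal_family n (Suc m) (b(m := e))"
    using b(2) unfolding orthonormal_family_def less_Suc_eq by auto
  moreover have "e \<in> V" unfolding e_def by (intro form.subspace_scale[OF V(1)] gV)
  ultimately show ?thesis by blast
qed

lemma dim_forms_le:
  assumes "V \<subseteq> forms n d"
  shows "form.dim V \<le> 2 ^ (n + d)"
proof -
  obtain B where "finite B" "card B \<le> 2 ^ (n + d)" "forms n d = form.span B"
    using forms_finite_span by blast
  then show ?thesis using form.dim_le_card[of V B] assms by auto
qed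

text \<open>Take an orthonormal family in V of greatest length; independence bounds the length by
  the size of a finite spanning set of \<open>forms n d\<close>. If it did not span V it could be
  extended.\<close>

lemma orthonormal_basis_exists:
  assumes n: "n \<ge> 1" and V: "form.subspace V" "V \<subseteq> forms n d"
  shows "\<exists>b. orthonormal_basis n V b"
proof -
  obtain B where B: "finite B" "forms n d = form.span B" using forms_finite_span by blast
  define P where "P m \<longleftrightarrow> (\<exists>b. (\<forall>i<m. b i \<in> V) \<and> orthonormal_family n m b)" for m
  have bound: "m \<le> card B" if Pm: "P m" for m
  proof -
    obtain b where b: "\<forall>i<m. b i \<in> V" "orthonormal_family n m b" using Pm P_def by auto
    then have "form.independent (b ` {..<m})"
      using V by (intro orthonormal_family_independent[OF n]) auto
    then have "card (b ` {..<m}) \<le> card B"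
      using form.independent_span_bound[OF B(1)] b(1) V(2) B(2) by auto
    then show ?thesis by (simp add: card_image[OF orthonormal_family_inj[OF b(2)]])
  qed
  have "P 0" by (auto simp: P_def orthonormal_family_def)
  then have m: "P (Greatest P)" and max: "\<And>m. P m \<Longrightarrow> m \<le> Greatest P"
    using GreatestI_nat[of P] Greatest_le_nat[of P] bound by blast+
  obtain b where b: "\<forall>i<Greatest P. b i \<in> V" "orthonormal_family n (Greatest P) b"
    using m P_def by auto
  have sub: "V \<subseteq> form.span (b ` {..<Greatest P})"
  proof (rule ccontr)
    assume "\<not> V \<subseteq> form.span (b ` {..<Greatest P})"
    then obtain f where f: "f \<in> V" "f \<notin> form.span (b ` {..<Greatest P})" by auto
    obtain e where e: "e \<in> V" "orthonormal_family n (Suc (Greatest P)) (b(Greatest P := e))"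
      using orthonormal_family_extend[OF n V _ b(2) f] b(1) by auto
    have "P (Suc (Greatest P))"
      unfolding P_def[of "Suc (Greatest P)"] using b e
      by (intro exI[of _ "b(Greatest P := e)"]) (simp add: less_Suc_eq)
    from max[OF this] show False by simp
  qed
  have ind: "form.independent (b ` {..<Greatest P})"
    using V b by (intro orthonormal_family_independent[OF n]) auto
  have "card (b ` {..<Greatest P}) = form.dim V"
    by (rule form.basis_card_eq_dim[OF _ sub ind]) (use b in auto)
  then have dim: "form.dim V = Greatest P"
    by (simp add: card_image[OF orthonormal_family_inj[OF b(2)]])
  have "form.span (b ` {..<Greatest P}) = V"
    using sub form.span_minimal[OF _ V(1), of "b ` {..<Greatest P}"] b by auto
  then show ?thesis using b(2)
    unfolding orthonormal_basis_def dim orthonormal_family_def by blast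
qed

lemma orthonormal_basis_family: "orthonormal_basis n V b \<Longrightarrow> orthonormal_family n (form.dim V) b"
  by (simp add: orthonormal_basis_def orthonormal_family_def)

lemma orthonormal_basis_mem: "orthonormal_basis n V b \<Longrightarrow> i < form.dim V \<Longrightarrow> b i \<in> V"
  using form.span_superset[of "b ` {..<form.dim V}"] by (auto simp: orthonormal_basis_def)

lemma orthonormal_basis_expand:
  assumes n: "n \<ge> 1" and V: "V \<subseteq> forms n d" and b: "orthonormal_basis n V b" and f: "f \<in> V"
  shows "f = (\<Sum>i<form.dim V. scale_form (form_inner n f (b i)) (b i))"
proof -
  have "f \<in> form.span (b ` {..<form.dim V})"
    using f b by (auto simp: orthonormal_basis_def)
  then obtain c where c: "f = (\<Sum>i<form.dim V. scale_form (c i) (b i))"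
    using span_coordinates by blast
  have "form_inner n f (b i) = c i" if "i < form.dim V" for i
    unfolding c
    by (rule orthonormal_family_coeff[OF n _ orthonormal_basis_family[OF b] that])
      (use orthonormal_basis_mem[OF b] V in auto)
  then have "(\<Sum>i<form.dim V. scale_form (form_inner n f (b i)) (b i)) = (\<Sum>i<form.dim V. scale_form (c i) (b i))"
    by (intro sum.cong) auto
  then show ?thesis using c by simp
qed

section \<open>The orthogonal group acting on forms, and the reproducing kernel\<close>

lemma orthogonal_coeffs_transpose: "orthogonal_coeffs n U \<Longrightarrow> orthogonal_coeffs n (\<lambda>i j. U j i)"
  by (auto simp: orthogonal_coeffs_def)

lemma form_inner_rotate:
  assumes U: "orthogonal_coeffs n U" and f: "f \<in> forms n d" and g: "g \<in> forms n d"
  shows "form_inner n (\<lambda>x. f (linear_map n U x)) (\<lambda>x. g (linear_map n U x)) = form_inner n f g"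
proof -
  note [measurable] = measurable_form[OF f] measurable_form[OF g]
  have "form_inner n f g = (\<integral>x. f x * g x \<partial>distr (sphere_measure n) (Rn n) (linear_map n U))"
    by (simp add: form_inner_def sphere_measure_rotation_invariant[OF U])
  also have "\<dots> = form_inner n (\<lambda>x. f (linear_map n U x)) (\<lambda>x. g (linear_map n U x))"
    unfolding form_inner_def by (rule integral_distr) auto
  finally show ?thesis by simp
qed

lemma integral_form_rotate:
  assumes U: "orthogonal_coeffs n U" and f: "f \<in> forms n d"
  shows "(\<integral>x. f (linear_map n U x) \<partial>sphere_measure n) = (\<integral>x. f x \<partial>sphere_measure n)"
proof -
  note [measurable] = measurable_form[OF f]
  have "(\<integral>x. f x \<partial>sphere_measure n) = (\<integral>x. f x \<partial>distr (sphere_measure n) (Rn n) (linear_map n U))"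
    by (simp add: sphere_measure_rotation_invariant[OF U])
  also have "\<dots> = (\<integral>x. f (linear_map n U x) \<partial>sphere_measure n)"
    by (rule integral_distr) auto
  finally show ?thesis by simp
qed

text \<open>The Householder reflection along v - w exchanges two unit vectors. It provides
  transitivity of the orthogonal group on the sphere; agreement is claimed below n only, where forms
  look.\<close>

lemma reflection_exists:
  assumes v: "L2_set v {..<n} = 1" and w: "L2_set w {..<n} = 1"
  shows "\<exists>U. orthogonal_coeffs n U \<and> (\<forall>i<n. linear_map n U v i = w i)"
proof (cases "\<forall>i<n. v i = w i")
  case True
  let ?U = "\<lambda>i j::nat. if i = j then 1 else 0 :: real"
  have "orthogonal_coeffs n ?U" by (auto simp: orthogonal_coeffs_def if_distrib[of "\<lambda>z. z * _"] cong: if_cong)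
  moreover have "linear_map n ?U v i = w i" if "i < n" for i
    using True that by (simp add: linear_map_def if_distrib[of "\<lambda>z. z * _"] cong: if_cong)
  ultimately show ?thesis by blast
next
  case False
  define a where "a i = v i - w i" for i
  define s where "s = (\<Sum>i<n. (a i)\<^sup>2)"
  have "s \<noteq> 0" using False by (subst s_def, subst sum_nonneg_eq_0_iff) (auto simp: a_def)
  have vv: "(\<Sum>i<n. (v i)\<^sup>2) = 1" and ww: "(\<Sum>i<n. (w i)\<^sup>2) = 1"
    using v w by (simp_all add: L2_set_def)
  have s: "s = 2 - 2 * (\<Sum>i<n. v i * w i)"
    using vv ww unfolding s_def a_def
    by (simp add: power2_diff sum.distrib sum_subtractf sum_distrib_left mult.assoc)
  have av: "(\<Sum>i<n. a i * v i) = s / 2"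
    using vv unfolding s a_def by (simp add: algebra_simps sum_subtractf power2_eq_square)
  define U where "U i j = (if i = j then 1 else 0) - 2 * a i * a j / s" for i j
  have sym: "U i j = U j i" for i j by (simp add: U_def)
  have UU: "(\<Sum>k<n. U i k * U j k) = (if i = j then 1 else 0)" if "i < n" "j < n" for i j
  proof -
    have "(\<Sum>k<n. U i k * U j k) = (\<Sum>k<n. (if i = k then (if j = k then 1 else 0) else 0)
        - (if i = k then 2 * a j * a k / s else 0) - (if j = k then 2 * a i * a k / s else 0)
        + (4 * a i * a j / s\<^sup>2) * (a k)\<^sup>2)"
      by (intro sum.cong refl) (auto simp: U_def algebra_simps power2_eq_square)
    also have "\<dots> = (if i = j then 1 else 0) - 2 * a j * a i / s - 2 * a i * a j / s + (4 * a i * a j / s\<^sup>2) * s"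
      using that unfolding sum.distrib sum_subtractf sum_distrib_left[symmetric] s_def[symmetric]
      by simp
    finally show ?thesis using \<open>s \<noteq> 0\<close> by (simp add: power2_eq_square)
  qed
  have "orthogonal_coeffs n U"
    unfolding orthogonal_coeffs_def using UU by (metis (no_types, lifting) sym sum.cong)
  moreover have "linear_map n U v i = w i" if i: "i < n" for i
  proof -
    have "linear_map n U v i = (\<Sum>j<n. U i j * v j)" using i by (simp add: linear_map_def)
    also have "\<dots> = (\<Sum>j<n. (if i = j then v j else 0) - (2 * a i / s) * (a j * v j))"
      by (intro sum.cong refl) (auto simp: U_def algebra_simps)
    also have "\<dots> = v i - (2 * a i / s) * (s / 2)"
      unfolding sum_subtractf sum_distrib_left[symmetric] av using i by simp
    finally show ?thesis using \<open>s \<noteq> 0\<close> by (simp add: a_def field_simps)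
  qed
  ultimately show ?thesis by blast
qed

text \<open>The sum of squares is the reproducing kernel K of V on the diagonal. The representer f
  of evaluation at Uv has squared norm K(Uv); its rotation g lies in V, has the same norm and
  satisfies g(v) = K(Uv). Cauchy-Schwarz gives K(Uv)^2 \<le> K(Uv) K(v).\<close>

lemma sum_squares_basis_rotation_le:
  assumes n: "n \<ge> 1" and V: "V \<subseteq> forms n d" and b: "orthonormal_basis n V b"
    and inv: "\<And>U f. orthogonal_coeffs n U \<Longrightarrow> f \<in> V \<Longrightarrow> (\<lambda>x. f (linear_map n U x)) \<in> V"
    and U: "orthogonal_coeffs n U"
  shows "(\<Sum>i<form.dim V. (b i (linear_map n U v))\<^sup>2) \<le> (\<Sum>i<form.dim V. (b i v)\<^sup>2)"
proof -
  let ?D = "form.dim V" and ?U = "linear_map n U"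
  define K where "K v = (\<Sum>i<?D. (b i v)\<^sup>2)" for v
  have bV: "b i \<in> V" "b i \<in> forms n d" if "i < ?D" for i
    using orthonormal_basis_mem[OF b that] V by auto
  \<comment> \<open>The representer of evaluation at Uv: its inner product with any form in V is the
    value of that form there.\<close>
  define f where "f = (\<Sum>i<?D. scale_form (b i (?U v)) (b i))"
  have fV: "f \<in> V"
    using b form.subspace_span[of "b ` {..<?D}"] bV
    unfolding f_def orthonormal_basis_def
    by (intro form.subspace_sum[of V] form.subspace_scale[of V]) auto
  have ff: "form_inner n f f = K (?U v)"
    unfolding f_def by (subst form_inner_sum_sum[OF n bV(2) orthonormal_basis_family[OF b]])
      (auto simp: K_def power2_eq_square)
  define g where "g = (\<lambda>x. f (?U x))"
  have gV: "g \<in> V" unfolding g_def by (rule inv[OF U fV])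
  define a where "a i = form_inner n g (b i)" for i
  have g: "g = (\<Sum>i<?D. scale_form (a i) (b i))"
    unfolding a_def by (rule orthonormal_basis_expand[OF n V b gV])
  have "(\<Sum>i<?D. (a i)\<^sup>2) = form_inner n g g"
    unfolding g by (subst form_inner_sum_sum[OF n bV(2) orthonormal_basis_family[OF b]])
      (auto simp: power2_eq_square)
  also have "\<dots> = K (?U v)"
    unfolding g_def using form_inner_rotate[OF U, of f d f] fV V ff by auto
  finally have aa: "(\<Sum>i<?D. (a i)\<^sup>2) = K (?U v)" .
  have "K (?U v) = g v"
    unfolding g_def f_def sum_form_apply by (simp add: K_def power2_eq_square)
  also have "\<dots> = (\<Sum>i<?D. a i * b i v)" unfolding g sum_form_apply ..
  finally have "K (?U v) ^ 2 \<le> K (?U v) * K v"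
    using Cauchy_Schwarz_ineq_sum[of a "\<lambda>i. b i v" "{..<?D}"] unfolding aa K_def by simp
  moreover have "K v \<ge> 0" "K (?U v) \<ge> 0" by (auto simp: K_def sum_nonneg)
  ultimately have "K (?U v) \<le> K v"
    by (cases "K (?U v) = 0") (auto simp: power2_eq_square)
  then show ?thesis by (simp add: K_def)
qed

text \<open>Reflections carry each point of the sphere to every other, so the one-sided inequality
  makes the kernel constant on the sphere. The constant is its mean, the sum of the squared norms of
  the basis.\<close>

lemma sum_squares_basis_eq_dim:
  assumes n: "n \<ge> 1" and V: "V \<subseteq> forms n d" and b: "orthonormal_basis n V b"
    and inv: "\<And>U f. orthogonal_coeffs n U \<Longrightarrow> f \<in> V \<Longrightarrow> (\<lambda>x. f (linear_map n U x)) \<in> V"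
    and v: "L2_set v {..<n} = 1"
  shows "(\<Sum>i<form.dim V. (b i v)\<^sup>2) = form.dim V"
proof -
  let ?D = "form.dim V"
  define K where "K v = (\<Sum>i<?D. (b i v)\<^sup>2)" for v
  have bV: "b i \<in> forms n d" if "i < ?D" for i
    using orthonormal_basis_mem[OF b that] V by auto
  have le: "K x \<le> K y" if xy: "L2_set x {..<n} = 1" "L2_set y {..<n} = 1" for x y
  proof -
    obtain U where U: "orthogonal_coeffs n U" "\<forall>i<n. linear_map n U y i = x i"
      using reflection_exists[OF xy(2,1)] by blast
    have "b i (linear_map n U y) = b i x" if "i < ?D" for i
      by (rule forms_cong[OF bV[OF that]]) (use U in auto)
    then show ?thesis
      using sum_squares_basis_rotation_le[OF n V b inv U(1), of y] by (simp add: K_def)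
  qed
  interpret prob_space "sphere_measure n" by (rule prob_space_sphere_measure)
  have Kf: "K \<in> forms n (d * 2)"
    unfolding K_def using bV by (intro forms_sum forms_power) auto
  note [measurable] = measurable_form[OF Kf]
  have "(\<integral>x. K x \<partial>sphere_measure n) = (\<integral>x. K v \<partial>sphere_measure n)"
  proof (rule integral_cong_AE)
    show "AE x in sphere_measure n. K x = K v"
      using AE_sphere_measure[OF n] by eventually_elim (use v in \<open>auto intro: antisym le\<close>)
  qed auto
  moreover have "(\<integral>x. K x \<partial>sphere_measure n) = (\<Sum>i<?D. form_inner n (b i) (b i))"
    unfolding K_def form_inner_def power2_eq_square
    by (rule Bochner_Integration.integral_sum) (use integrable_form_product[OF n bV bV] in auto)
  moreover have "\<dots> = ?D" using b by (simp add: orthonormal_basis_def)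
  moreover have "prob (space (Rn n)) = 1" using prob_space by simp
  ultimately show ?thesis by (simp add: K_def)
qed

text \<open>Cauchy-Schwarz against the kernel, whose diagonal is the dimension. This passage from
  the L2 norm to the sup norm is used for forms of mean zero and for all forms of degree
  2kn.\<close>

lemma form_square_le_dim:
  assumes n: "n \<ge> 1" and V: "form.subspace V" "V \<subseteq> forms n d"
    and inv: "\<And>U f. orthogonal_coeffs n U \<Longrightarrow> f \<in> V \<Longrightarrow> (\<lambda>x. f (linear_map n U x)) \<in> V"
    and v: "L2_set v {..<n} = 1" and f: "f \<in> V"
  shows "(f v)\<^sup>2 \<le> form.dim V * form_inner n f f"
proof -
  obtain b where b: "orthonormal_basis n V b" using orthonormal_basis_exists[OF n V] by blast
  have bV: "b i \<in> forms n d" if "i < form.dim V" for i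
    using orthonormal_basis_mem[OF b that] V by auto
  define a where "a i = form_inner n f (b i)" for i
  have f: "f = (\<Sum>i<form.dim V. scale_form (a i) (b i))"
    unfolding a_def by (rule orthonormal_basis_expand[OF n V(2) b f])
  have "f v = (\<Sum>i<form.dim V. a i * b i v)" by (subst f) (rule sum_form_apply)
  moreover have "form_inner n f f = (\<Sum>i<form.dim V. (a i)\<^sup>2)"
    unfolding f by (subst form_inner_sum_sum[OF n bV orthonormal_basis_family[OF b]])
      (auto simp: power2_eq_square)
  ultimately show ?thesis
    using Cauchy_Schwarz_ineq_sum[of a "\<lambda>i. b i v" "{..<form.dim V}"]
      sum_squares_basis_eq_dim[OF n V(2) b inv v] by (simp add: mult.commute)
qed

text \<open>By Riesz, L is the inner product with a form q in \<open>forms n d\<close>. Invariance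
  of L makes q invariant, hence constant on the sphere by transitivity, and L is that constant times
  the spherical mean.\<close>

lemma rotation_invariant_functional:
  assumes n: "n \<ge> 1"
    and add: "\<And>f g. f \<in> forms n d \<Longrightarrow> g \<in> forms n d \<Longrightarrow> L (\<lambda>x. f x + g x) = L f + L g"
    and cmult: "\<And>c f. f \<in> forms n d \<Longrightarrow> L (\<lambda>x. c * f x) = c * L f"
    and inv: "\<And>U f. orthogonal_coeffs n U \<Longrightarrow> f \<in> forms n d \<Longrightarrow> L (\<lambda>x. f (linear_map n U x)) = L f"
  shows "\<exists>c::real. \<forall>f\<in>forms n d. L f = c * (\<integral>x. f x \<partial>sphere_measure n)"
proof -
  let ?D = "form.dim (forms n d)"
  obtain b where b: "orthonormal_basis n (forms n d) b"
    using orthonormal_basis_exists[OF n forms_subspace] by blast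
  have bF: "b i \<in> forms n d" if "i < ?D" for i using orthonormal_basis_mem[OF b that] .
  have Lsum: "L (\<lambda>x. \<Sum>i\<in>I. c i * g i x) = (\<Sum>i\<in>I. c i * L (g i))"
    if "finite I" "\<And>i. i \<in> I \<Longrightarrow> g i \<in> forms n d" for I c and g :: "nat \<Rightarrow> form"
    using that
  proof (induction I)
    case empty
    show ?case using cmult[OF forms_zero, of 0] by simp
  next
    case (insert i I)
    then have "L (\<lambda>x. c i * g i x + (\<Sum>i\<in>I. c i * g i x)) = L (\<lambda>x. c i * g i x) + L (\<lambda>x. \<Sum>i\<in>I. c i * g i x)"
      by (intro add forms_cmult forms_sum) auto
    then show ?case using insert cmult[of "g i" "c i"] by simp
  qed
  define q where "q = (\<Sum>i<?D. scale_form (L (b i)) (b i))"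
  have qF: "q \<in> forms n d" unfolding q_def
    by (intro form.subspace_sum[OF forms_subspace] form.subspace_scale[OF forms_subspace] bF) auto
  have L: "L f = form_inner n f q" if f: "f \<in> forms n d" for f
  proof -
    define a where "a i = form_inner n f (b i)" for i
    have fe: "f = (\<Sum>i<?D. scale_form (a i) (b i))"
      unfolding a_def by (rule orthonormal_basis_expand[OF n order_refl b f])
    have "L f = L (\<lambda>x. \<Sum>i<?D. a i * b i x)"
      by (rule arg_cong[of _ _ L], subst fe) (auto simp: sum_form_apply)
    also have "\<dots> = (\<Sum>i<?D. a i * L (b i))" by (rule Lsum) (use bF in auto)
    also have "\<dots> = form_inner n f q"
      unfolding fe q_def by (subst form_inner_sum_sum[OF n bF orthonormal_basis_family[OF b]]) auto
    finally show ?thesis .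
  qed
  have qU: "(\<lambda>x. q (linear_map n U x)) = q" if U: "orthogonal_coeffs n U" for U
  proof -
    let ?q = "\<lambda>x. q (linear_map n U x)" and ?T = "linear_map n (\<lambda>i j. U j i)"
    have Ut: "orthogonal_coeffs n (\<lambda>i j. U j i)" by (rule orthogonal_coeffs_transpose[OF U])
    have "form_inner n ?q (b j) = form_inner n q (b j)" if j: "j < ?D" for j
    proof -
      \<comment> \<open>The transpose inverts U only on points of \<open>Rn n\<close>; restricting x
        changes neither the image under U nor the value of a form.\<close>
      have "b j (?T (linear_map n U x)) = b j x" for x
      proof -
        have *: "linear_map n U (restrict x {..<n}) = linear_map n U x"
          by (auto simp: linear_map_def)
        have "?T (linear_map n U (restrict x {..<n})) = restrict x {..<n}"
          using orthogonal_coeffs_inverse[OF Ut, of "restrict x {..<n}"] by (simp add: space_Rn)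
        then show ?thesis
          unfolding * by (intro forms_cong[OF bF[OF j]]) auto
      qed
      then have "form_inner n ?q (b j) = form_inner n ?q (\<lambda>x. b j (?T (linear_map n U x)))"
        by simp
      also have "\<dots> = form_inner n q (\<lambda>x. b j (?T x))"
        using form_inner_rotate[OF U qF forms_linear_map[OF bF[OF j], of "\<lambda>i j. U j i"]] by simp
      also have "\<dots> = L (\<lambda>x. b j (?T x))"
        using L[OF forms_linear_map[OF bF[OF j]]] by (simp add: form_inner_commute)
      also have "\<dots> = form_inner n q (b j)"
        using inv[OF Ut bF[OF j]] L[OF bF[OF j]] by (simp add: form_inner_commute)
      finally show ?thesis .
    qed
    then have "(\<Sum>i<?D. scale_form (form_inner n ?q (b i)) (b i)) = (\<Sum>i<?D. scale_form (form_inner n q (b i)) (b i))"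
      by (intro sum.cong) auto
    then show ?thesis
      using orthonormal_basis_expand[OF n order_refl b qF]
        orthonormal_basis_expand[OF n order_refl b forms_linear_map[OF qF, of U]] by simp
  qed
  define v where "v = (\<lambda>i::nat. if i = 0 then 1 else 0 :: real)"
  have v: "L2_set v {..<n} = 1"
    using n by (simp add: v_def L2_set_def if_distrib[of "\<lambda>x. x\<^sup>2"] cong: if_cong)
  have const: "q w = q v" if w: "L2_set w {..<n} = 1" for w
  proof -
    obtain U where U: "orthogonal_coeffs n U" "\<forall>i<n. linear_map n U v i = w i"
      using reflection_exists[OF v w] by blast
    have "q w = q (linear_map n U v)" by (rule forms_cong[OF qF]) (use U in auto)
    also have "\<dots> = q v" using qU[OF U(1)] by (rule fun_cong)
    finally show ?thesis .
  qed
  have "L f = q v * (\<integral>x. f x \<partial>sphere_measure n)" if f: "f \<in> forms n d" for f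
  proof -
    note [measurable] = measurable_form[OF f] measurable_form[OF qF]
    have "L f = (\<integral>x. f x * q v \<partial>sphere_measure n)"
      unfolding L[OF f] form_inner_def
    proof (rule integral_cong_AE)
      show "AE x in sphere_measure n. f x * q x = f x * q v"
        using AE_sphere_measure[OF n] by eventually_elim (use const in auto)
    qed auto
    then show ?thesis by simp
  qed
  then show ?thesis by blast
qed


section \<open>The Prekopa-Leindler inequality\<close>

text \<open>With a near the supremum of A and b near the infimum of B, the sets (A + b)/2 and (a +
  B)/2 both lie in C and have half the measures of A and B. The first lies to the left of the second
  up to an overlap of length at most (Sup A - a + b - Inf B)/2 \<le> e/2.\<close>

lemma brunn_minkowski_bounded:
  fixes A B C :: "real set"
  assumes [measurable]: "A \<in> sets borel" "B \<in> sets borel" "C \<in> sets borel"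
    and ne: "A \<noteq> {}" "B \<noteq> {}" and bd: "bdd_above A" "bdd_below B"
    and mid: "\<And>x y. x \<in> A \<Longrightarrow> y \<in> B \<Longrightarrow> (x + y) / 2 \<in> C"
  shows "emeasure lborel A + emeasure lborel B \<le> 2 * emeasure lborel C"
proof (rule ennreal_le_epsilon)
  fix e :: real assume e: "e > 0"
  obtain a where a: "a \<in> A" "Sup A - e / 2 < a"
    using less_cSup_iff[OF ne(1) bd(1), of "Sup A - e / 2"] e by auto
  obtain b where b: "b \<in> B" "b < Inf B + e / 2"
    using cInf_less_iff[OF ne(2) bd(2), of "Inf B + e / 2"] e by auto
  define P where "P = {z. 2 * z - b \<in> A}"
  define Q where "Q = {z. 2 * z - a \<in> B}"
  have [measurable]: "P \<in> sets borel" "Q \<in> sets borel" unfolding P_def Q_def by measurable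
  have half: "emeasure lborel X = 2 * emeasure lborel {z. 2 * z - t \<in> X}"
    if [measurable]: "X \<in> sets borel" for X and t :: real
  proof -
    have "emeasure lborel X = (\<integral>\<^sup>+x. indicator X x \<partial>lborel)" by simp
    also have "\<dots> = 2 * (\<integral>\<^sup>+x. indicator X (- t + 2 * x) \<partial>lborel)"
      by (subst nn_integral_real_affine[where c = 2 and t = "-t"]) auto
    also have "(\<integral>\<^sup>+x. indicator X (- t + 2 * x) \<partial>lborel) = (\<integral>\<^sup>+x. indicator {z. 2 * z - t \<in> X} x \<partial>lborel)"
      by (intro nn_integral_cong) (auto simp: indicator_def)
    also have "\<dots> = emeasure lborel {z. 2 * z - t \<in> X}" by simp
    finally show ?thesis .
  qed
  have "P \<union> Q \<subseteq> C"
  proof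
    fix z assume "z \<in> P \<union> Q"
    then consider "2 * z - b \<in> A" | "2 * z - a \<in> B" by (auto simp: P_def Q_def)
    then show "z \<in> C"
      by cases (use mid[OF _ b(1), of "2 * z - b"] mid[OF a(1), of "2 * z - a"] in simp_all)
  qed
  then have "emeasure lborel (P \<union> Q) \<le> emeasure lborel C" by (intro emeasure_mono) auto
  moreover have "emeasure lborel (P \<inter> Q) \<le> ennreal (e / 2)"
  proof -
    have "P \<inter> Q \<subseteq> {(a + Inf B) / 2 .. (Sup A + b) / 2}"
      using cSup_upper[OF _ bd(1)] cInf_lower[OF _ bd(2)] by (fastforce simp: P_def Q_def)
    then have "emeasure lborel (P \<inter> Q) \<le> emeasure lborel {(a + Inf B) / 2 .. (Sup A + b) / 2}"
      by (intro emeasure_mono) auto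
    also have "\<dots> \<le> ennreal (e / 2)"
      using a b e by (simp add: emeasure_lborel_Icc_eq ennreal_leI field_simps)
    finally show ?thesis .
  qed
  ultimately have "emeasure lborel P + emeasure lborel Q \<le> emeasure lborel C + ennreal (e / 2)"
    by (subst emeasure_Un_Int[of P lborel Q]) (auto intro: add_mono)
  then have "2 * (emeasure lborel P + emeasure lborel Q) \<le> 2 * (emeasure lborel C + ennreal (e / 2))"
    by (intro mult_left_mono) auto
  moreover have "2 * ennreal (e / 2) = ennreal e"
    using e by (simp add: ennreal_mult'[symmetric] flip: ennreal_numeral)
  ultimately show "emeasure lborel A + emeasure lborel B \<le> 2 * emeasure lborel C + ennreal e"
    using half[of A b] half[of B a] unfolding P_def Q_def by (simp add: distrib_left)
qed

text \<open>Cutting to [-m, m] reduces to bounded sets. From some m on both cut sets are nonempty,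
  and their measures converge to those of A and B.\<close>

lemma brunn_minkowski_real:
  fixes A B C :: "real set"
  assumes [measurable]: "A \<in> sets borel" "B \<in> sets borel" "C \<in> sets borel"
    and ne: "A \<noteq> {}" "B \<noteq> {}"
    and mid: "\<And>x y. x \<in> A \<Longrightarrow> y \<in> B \<Longrightarrow> (x + y) / 2 \<in> C"
  shows "emeasure lborel A + emeasure lborel B \<le> 2 * emeasure lborel C"
proof (rule LIMSEQ_le_const2)
  let ?t = "\<lambda>X m::nat. X \<inter> {- real m .. real m}"
  have lim: "(\<lambda>m. emeasure lborel (?t X m)) \<longlonglongrightarrow> emeasure lborel X" if [measurable]: "X \<in> sets borel" for X
  proof -
    have "\<exists>m. x \<in> {- real m .. real m}" for x
    proof -
      obtain m where "\<bar>x\<bar> \<le> real m" using real_arch_simple by blast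
      then have "x \<in> {- real m .. real m}" by auto
      then show ?thesis by blast
    qed
    then have "(\<Union>m. ?t X m) = X" by fastforce
    moreover have "incseq (?t X)" by (intro incseq_SucI) auto
    moreover have "range (?t X) \<subseteq> sets lborel" by auto
    ultimately show ?thesis
      using Lim_emeasure_incseq[of "?t X" lborel] by metis
  qed
  show "(\<lambda>m. emeasure lborel (?t A m) + emeasure lborel (?t B m)) \<longlonglongrightarrow> emeasure lborel A + emeasure lborel B"
    by (intro tendsto_add lim) auto
  obtain a b where ab: "a \<in> A" "b \<in> B" using ne by auto
  obtain N where N: "max \<bar>a\<bar> \<bar>b\<bar> \<le> real N" using real_arch_simple by blast
  show "\<exists>N. \<forall>m\<ge>N. emeasure lborel (?t A m) + emeasure lborel (?t B m) \<le> 2 * emeasure lborel C"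
  proof (intro exI allI impI)
    fix m assume "m \<ge> N"
    then have "\<bar>a\<bar> \<le> real m" "\<bar>b\<bar> \<le> real m" using N by auto
    then have "a \<in> ?t A m" "b \<in> ?t B m" using ab by auto
    then show "emeasure lborel (?t A m) + emeasure lborel (?t B m) \<le> 2 * emeasure lborel C"
      by (intro brunn_minkowski_bounded) (use mid in auto)
  qed
qed

text \<open>The levels are fractions s of a height a, with s in [0, 1), so that functions of
  different heights can be compared at the same s. The minimum appears because only levels below a
  are counted.\<close>

lemma layer_cake_min:
  fixes f :: "real \<Rightarrow> ennreal"
  assumes [measurable]: "f \<in> borel_measurable borel" and a: "a > 0"
  shows "(\<integral>\<^sup>+x. min (f x) (ennreal a) \<partial>lborel)
    = ennreal a * (\<integral>\<^sup>+s. indicator {0..<1} s * emeasure lborel {x. ennreal (s * a) < f x} \<partial>lborel)"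
proof -
  interpret lborel_pair: pair_sigma_finite lborel "lborel :: real measure" ..
  let ?I = "\<lambda>s x. indicator {0..<1::real} s * indicator {x. ennreal (s * a) < f x} x :: ennreal"
  have pt: "min (f x) (ennreal a) = ennreal a * (\<integral>\<^sup>+s. ?I s x \<partial>lborel)" for x
  proof -
    \<comment> \<open>The length of the set of s in [0, 1) with s a < f x; the infinite value is
      treated apart because \<open>enn2real\<close> sends it to 0.\<close>
    define m where "m = (if f x = top then 1 else min 1 (enn2real (f x) / a))"
    have m: "m \<ge> 0" using a by (auto simp: m_def)
    have iff: "ennreal (s * a) < f x \<longleftrightarrow> s < m" if s: "0 \<le> s" "s < 1" for s
    proof (cases "f x")
      case top
      then show ?thesis using s by (simp add: m_def)
    next
      case (real r)
      then show ?thesis using s a by (simp add: m_def ennreal_less_iff pos_less_divide_eq)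
    qed
    have "?I s x = indicator {0..<m} s" for s
      using iff[of s] by (auto simp: indicator_def m_def)
    then have "(\<integral>\<^sup>+s. ?I s x \<partial>lborel) = ennreal m" using m by simp
    moreover have "min (f x) (ennreal a) = ennreal a * ennreal m"
    proof (cases "f x")
      case (real r)
      then have "ennreal a * ennreal m = ennreal (a * min 1 (r / a))"
        using a by (simp add: m_def ennreal_mult)
      also have "a * min 1 (r / a) = min r a" using a by (auto simp: min_def field_simps)
      finally show ?thesis using real a by (auto simp: min_def)
    qed (simp add: m_def)
    ultimately show ?thesis by simp
  qed
  have [measurable]: "(\<lambda>(s, x). ?I s x) \<in> borel_measurable (lborel \<Otimes>\<^sub>M lborel)"
    "(\<lambda>(x, s). ?I s x) \<in> borel_measurable (lborel \<Otimes>\<^sub>M lborel)"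
    by measurable
  have "(\<integral>\<^sup>+x. min (f x) (ennreal a) \<partial>lborel) = ennreal a * (\<integral>\<^sup>+x. (\<integral>\<^sup>+s. ?I s x \<partial>lborel) \<partial>lborel)"
    unfolding pt by (rule nn_integral_cmult) measurable
  also have "(\<integral>\<^sup>+x. (\<integral>\<^sup>+s. ?I s x \<partial>lborel) \<partial>lborel) = (\<integral>\<^sup>+s. (\<integral>\<^sup>+x. ?I s x \<partial>lborel) \<partial>lborel)"
    by (rule lborel_pair.Fubini') measurable
  also have "\<dots> = (\<integral>\<^sup>+s. indicator {0..<1} s * emeasure lborel {x. ennreal (s * a) < f x} \<partial>lborel)"
    by (intro nn_integral_cong) (simp add: nn_integral_cmult)
  finally show ?thesis .
qed

lemma ennreal_four_mult_le: "4 * (x * y) \<le> (x + y)\<^sup>2" for x y :: ennreal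
proof (cases x; cases y)
  fix r s assume rs: "x = ennreal r" "0 \<le> r" "y = ennreal s" "0 \<le> s"
  have "4 * (x * y) = ennreal (4 * (r * s))"
    using rs by (simp add: ennreal_mult)
  also have "\<dots> \<le> ennreal ((r + s)\<^sup>2)"
    using sum_squares_bound[of r s] by (intro ennreal_leI) (simp add: power2_sum)
  also have "\<dots> = (x + y)\<^sup>2" using rs by (simp add: power2_eq_square ennreal_mult)
  finally show ?thesis .
qed (auto simp: power2_eq_square ennreal_top_mult ennreal_mult_top)

text \<open>Levels are measured relative to the suprema a of f and b of g, and to c = sqrt (ab) for
  h. Then for every s < 1 both superlevel sets are nonempty and their midpoints lie in the level set
  of h at s c, so the one-dimensional Brunn-Minkowski inequality applies. Integrating over s gives
  an arithmetic mean, which dominates the geometric one.\<close>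

lemma prekopa_leindler_bounded:
  fixes f g h :: "real \<Rightarrow> ennreal"
  assumes [measurable]: "f \<in> borel_measurable borel" "g \<in> borel_measurable borel" "h \<in> borel_measurable borel"
    and f: "(SUP x. f x) < top" and g: "(SUP x. g x) < top"
    and mid: "\<And>x y. f x * g y \<le> (h ((x + y) / 2))\<^sup>2"
  shows "(\<integral>\<^sup>+x. f x \<partial>lborel) * (\<integral>\<^sup>+x. g x \<partial>lborel) \<le> (\<integral>\<^sup>+x. h x \<partial>lborel)\<^sup>2"
proof (cases "(SUP x. f x) = 0 \<or> (SUP x. g x) = 0")
  case True
  then have "(\<forall>x. f x = 0) \<or> (\<forall>x. g x = 0)" by (metis SUP_upper UNIV_I le_zero_eq)
  then show ?thesis by auto
next
  case False
  obtain a where a: "(SUP x. f x) = ennreal a" "a > 0" using False f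
    by (cases "SUP x. f x") (auto simp: less_le)
  obtain b where b: "(SUP x. g x) = ennreal b" "b > 0" using False g
    by (cases "SUP x. g x") (auto simp: less_le)
  define c where "c = sqrt (a * b)"
  have c: "c > 0" "c * c = a * b" using a b by (auto simp: c_def)
  define I where "I u t = (\<integral>\<^sup>+s. indicator {0..<1} s * emeasure lborel {x. ennreal (s * t) < u x} \<partial>lborel)"
    for u :: "real \<Rightarrow> ennreal" and t
  have fa: "f x \<le> ennreal a" for x using SUP_upper[of x UNIV f] a by simp
  have gb: "g x \<le> ennreal b" for x using SUP_upper[of x UNIV g] b by simp
  have level: "emeasure lborel {x. ennreal (s * a) < f x} + emeasure lborel {x. ennreal (s * b) < g x}
      \<le> 2 * emeasure lborel {x. ennreal (s * c) < h x}" if s: "0 \<le> s" "s < 1" for s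
  proof (rule brunn_minkowski_real)
    have "ennreal (s * a) < (SUP x. f x)" unfolding a using s a by (intro ennreal_lessI) auto
    then show "{x. ennreal (s * a) < f x} \<noteq> {}" by (auto simp: less_SUP_iff)
    have "ennreal (s * b) < (SUP x. g x)" unfolding b using s b by (intro ennreal_lessI) auto
    then show "{x. ennreal (s * b) < g x} \<noteq> {}" by (auto simp: less_SUP_iff)
    fix x y assume x: "x \<in> {x. ennreal (s * a) < f x}" and y: "y \<in> {x. ennreal (s * b) < g x}"
    obtain p where p: "f x = ennreal p" "0 \<le> p" using fa[of x] by (cases "f x") (auto simp: top_unique)
    obtain q where q: "g y = ennreal q" "0 \<le> q" using gb[of y] by (cases "g y") (auto simp: top_unique)
    have "s * a < p" "s * b < q"
      using x y s a b by (simp_all add: p q ennreal_less_iff)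
    then have pq: "(s * c) * (s * c) < p * q"
      proof -
      have "(s * c) * (s * c) = (s * a) * (s * b)" using c(2) by (metis mult.assoc mult.left_commute)
      also have "\<dots> < p * q"
        using \<open>s * a < p\<close> \<open>s * b < q\<close> s a b p q by (intro mult_strict_mono') auto
      finally show ?thesis .
    qed
    show "(x + y) / 2 \<in> {x. ennreal (s * c) < h x}"
    proof (cases "h ((x + y) / 2)")
      case (real r)
      have "ennreal (p * q) \<le> ennreal (r * r)"
        using mid[of x y] real by (simp add: p q ennreal_mult power2_eq_square)
      then have "p * q \<le> r * r" using real by (subst (asm) ennreal_le_iff) auto
      with pq have "s * c < r" using real by (smt (verit) mult_mono)
      then show ?thesis using s c real by (simp add: ennreal_less_iff)
    qed simp
  qed measurable
  have "I f a + I g b = (\<integral>\<^sup>+s. indicator {0..<1} s * (emeasure lborel {x. ennreal (s * a) < f x}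
      + emeasure lborel {x. ennreal (s * b) < g x}) \<partial>lborel)"
    unfolding I_def distrib_left by (rule nn_integral_add[symmetric]) measurable
  also have "\<dots> \<le> (\<integral>\<^sup>+s. 2 * (indicator {0..<1} s * emeasure lborel {x. ennreal (s * c) < h x}) \<partial>lborel)"
    by (intro nn_integral_mono) (use level in \<open>auto simp: indicator_def\<close>)
  also have "\<dots> = 2 * I h c" unfolding I_def by (rule nn_integral_cmult) measurable
  finally have I: "I f a + I g b \<le> 2 * I h c" .
  have If: "(\<integral>\<^sup>+x. f x \<partial>lborel) = ennreal a * I f a"
    using layer_cake_min[of f a] a fa by (simp add: I_def min_absorb1)
  have Ig: "(\<integral>\<^sup>+x. g x \<partial>lborel) = ennreal b * I g b"
    using layer_cake_min[of g b] b gb by (simp add: I_def min_absorb1)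
  have "ennreal c * I h c = (\<integral>\<^sup>+x. min (h x) (ennreal c) \<partial>lborel)"
    using layer_cake_min[of h c] c by (simp add: I_def)
  also have "\<dots> \<le> (\<integral>\<^sup>+x. h x \<partial>lborel)" by (intro nn_integral_mono) auto
  finally have Ih: "ennreal c * I h c \<le> (\<integral>\<^sup>+x. h x \<partial>lborel)" .
  have "4 * (I f a * I g b) \<le> (2 * I h c)\<^sup>2"
    using ennreal_four_mult_le[of "I f a" "I g b"] power_mono[OF I, of 2] by simp
  also have "\<dots> = 4 * (I h c)\<^sup>2" by (simp add: power_mult_distrib)
  finally have "I f a * I g b \<le> (I h c)\<^sup>2"
    by (subst (asm) ennreal_mult_le_mult_iff) auto
  have "(\<integral>\<^sup>+x. f x \<partial>lborel) * (\<integral>\<^sup>+x. g x \<partial>lborel) = ennreal (a * b) * (I f a * I g b)"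
    using a b by (simp add: If Ig ennreal_mult mult_ac)
  also have "\<dots> \<le> ennreal (c * c) * (I h c)\<^sup>2"
    unfolding c by (intro mult_left_mono) (use \<open>I f a * I g b \<le> _\<close> in auto)
  also have "\<dots> = (ennreal c * I h c)\<^sup>2"
    using c(1) by (subst ennreal_mult) (auto simp: power2_eq_square mult_ac)
  also have "\<dots> \<le> (\<integral>\<^sup>+x. h x \<partial>lborel)\<^sup>2" by (intro power_mono Ih) auto
  finally show ?thesis .
qed

text \<open>Truncating f and g at finite heights keeps the hypothesis with the same h, and the
  truncated integrals increase to the full ones.\<close>

lemma prekopa_leindler_real:
  fixes f g h :: "real \<Rightarrow> ennreal"
  assumes [measurable]: "f \<in> borel_measurable borel" "g \<in> borel_measurable borel" "h \<in> borel_measurable borel"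
    and mid: "\<And>x y. f x * g y \<le> (h ((x + y) / 2))\<^sup>2"
  shows "(\<integral>\<^sup>+x. f x \<partial>lborel) * (\<integral>\<^sup>+x. g x \<partial>lborel) \<le> (\<integral>\<^sup>+x. h x \<partial>lborel)\<^sup>2"
proof -
  let ?t = "\<lambda>u (m::nat) x. min (u x) (ennreal (real m)) :: ennreal"
  have SUP: "(\<integral>\<^sup>+x. u x \<partial>lborel) = (SUP m. \<integral>\<^sup>+x. ?t u m x \<partial>lborel)"
    if [measurable]: "u \<in> borel_measurable borel" for u :: "real \<Rightarrow> ennreal"
  proof -
    have "u x = (SUP m. ?t u m x)" for x
    proof (cases "u x")
      case (real r)
      obtain N where "r \<le> real N" using real_arch_simple by blast
      then have "u x = ?t u N x" using real by (simp add: min_absorb1 ennreal_leI)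
      then show ?thesis
        by (intro antisym SUP_least) (auto intro: SUP_upper2[of N])
    next
      case top
      then show ?thesis by (simp add: ennreal_SUP_of_nat_eq_top ennreal_of_nat_eq_real_of_nat[symmetric])
    qed
    then have "(\<integral>\<^sup>+x. u x \<partial>lborel) = (\<integral>\<^sup>+x. (SUP m. ?t u m x) \<partial>lborel)" by simp
    also have "\<dots> = (SUP m. \<integral>\<^sup>+x. ?t u m x \<partial>lborel)"
      by (rule nn_integral_monotone_convergence_SUP) (auto simp: incseq_def le_fun_def min.coboundedI2 ennreal_leI)
    finally show ?thesis .
  qed
  have bd: "(SUP x. ?t u m x) < top" for u :: "real \<Rightarrow> ennreal" and m
    by (rule le_less_trans[of _ "ennreal (real m)"]) (auto intro: SUP_least)
  have trunc: "(\<integral>\<^sup>+x. ?t f m x \<partial>lborel) * (\<integral>\<^sup>+x. ?t g j x \<partial>lborel) \<le> (\<integral>\<^sup>+x. h x \<partial>lborel)\<^sup>2" for m j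
  proof (rule prekopa_leindler_bounded[OF _ _ _ bd bd])
    fix x y
    have "?t f m x * ?t g j y \<le> f x * g y" by (intro mult_mono) auto
    also note mid
    finally show "?t f m x * ?t g j y \<le> (h ((x + y) / 2))\<^sup>2" .
  qed measurable
  have "(\<integral>\<^sup>+x. f x \<partial>lborel) * (\<integral>\<^sup>+x. ?t g j x \<partial>lborel) \<le> (\<integral>\<^sup>+x. h x \<partial>lborel)\<^sup>2" for j
    unfolding SUP[of f, simplified] by (subst SUP_mult_right_ennreal) (auto intro!: SUP_least trunc)
  then show ?thesis
    unfolding SUP[of g, simplified] by (subst SUP_mult_left_ennreal) (auto intro!: SUP_least)
qed

section \<open>Prekopa-Leindler and Brunn-Minkowski in several variables\<close>

definition midpoint_fun :: "nat \<Rightarrow> (nat \<Rightarrow> real) \<Rightarrow> (nat \<Rightarrow> real) \<Rightarrow> nat \<Rightarrow> real" where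
  "midpoint_fun n x y = (\<lambda>i\<in>{..<n}. (x i + y i) / 2)"

lemma nn_integral_Rn_Suc:
  assumes "f \<in> borel_measurable (Rn (Suc n))"
  shows "(\<integral>\<^sup>+x. f x \<partial>Rn (Suc n)) = (\<integral>\<^sup>+t. (\<integral>\<^sup>+x. f (x(n := t)) \<partial>Rn n) \<partial>lborel)"
  using Rn_psf.product_nn_integral_insert_rev[of "{..<n}" n f] assms
  by (simp add: Rn_def lessThan_Suc)

lemma measurable_Rn_Suc:
  assumes "u \<in> borel_measurable (Rn (Suc n))"
  shows "(\<lambda>(x, t). u (x(n := t))) \<in> borel_measurable (Rn n \<Otimes>\<^sub>M lborel)"
proof -
  have "(\<lambda>(x, t). x(n := t)) \<in> measurable (Rn n \<Otimes>\<^sub>M lborel) (Rn (Suc n))"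
    unfolding Rn_def lessThan_Suc by measurable
  from measurable_compose[OF this assms] show ?thesis by (simp only: split_beta')
qed

lemma measurable_Rn_Suc_section:
  assumes "u \<in> borel_measurable (Rn (Suc n))"
  shows "(\<lambda>x. u (x(n := t))) \<in> borel_measurable (Rn n)"
  using measurable_compose[OF measurable_Pair2' measurable_Rn_Suc[OF assms], of t] by simp

lemma measurable_Rn_Suc_integral:
  fixes u :: "(nat \<Rightarrow> real) \<Rightarrow> ennreal"
  assumes "u \<in> borel_measurable (Rn (Suc n))"
  shows "(\<lambda>t. \<integral>\<^sup>+x. u (x(n := t)) \<partial>Rn n) \<in> borel_measurable borel"
  using Rn_sigma.borel_measurable_nn_integral[of "\<lambda>t x. u (x(n := t))" lborel n]
    measurable_pair_swap[OF measurable_Rn_Suc[OF assms]] by (simp add: case_prod_beta)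

lemma nn_integral_Rn_0: "(\<integral>\<^sup>+x. u x \<partial>Rn 0) = u (\<lambda>_. undefined)"
  unfolding Rn_def by (simp add: PiM_empty nn_integral_count_space_finite)

text \<open>Induction on the dimension: with the last coordinates s and t fixed, the induction
  hypothesis for the slices is exactly the hypothesis of the one-dimensional inequality for the
  marginals.\<close>

lemma prekopa_leindler:
  assumes "f \<in> borel_measurable (Rn n)" "g \<in> borel_measurable (Rn n)" "h \<in> borel_measurable (Rn n)"
    and "\<And>x y. x \<in> space (Rn n) \<Longrightarrow> y \<in> space (Rn n) \<Longrightarrow> f x * g y \<le> (h (midpoint_fun n x y))\<^sup>2"
  shows "(\<integral>\<^sup>+x. f x \<partial>Rn n) * (\<integral>\<^sup>+x. g x \<partial>Rn n) \<le> (\<integral>\<^sup>+x. h x \<partial>Rn n)\<^sup>2"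
  using assms
proof (induction n arbitrary: f g h)
  case 0
  have "midpoint_fun 0 (\<lambda>_. undefined) (\<lambda>_. undefined) = (\<lambda>_. undefined)"
    by (simp add: midpoint_fun_def fun_eq_iff)
  then show ?case
    using 0(4)[of "\<lambda>_. undefined" "\<lambda>_. undefined"] by (simp add: space_Rn nn_integral_Rn_0)
next
  case (Suc n)
  let ?P = "\<lambda>u t. \<integral>\<^sup>+x. u (x(n := t)) \<partial>Rn n"
  show ?case
    unfolding nn_integral_Rn_Suc[OF Suc.prems(1)] nn_integral_Rn_Suc[OF Suc.prems(2)] nn_integral_Rn_Suc[OF Suc.prems(3)]
  proof (rule prekopa_leindler_real)
    fix s t :: real
    show "?P f s * ?P g t \<le> (?P h ((s + t) / 2))\<^sup>2"
    proof (rule Suc.IH)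
      fix x y assume "x \<in> space (Rn n)" "y \<in> space (Rn n)"
      then have "f (x(n := s)) * g (y(n := t)) \<le> (h (midpoint_fun (Suc n) (x(n := s)) (y(n := t))))\<^sup>2"
        by (intro Suc.prems) (auto simp: space_Rn PiE_iff extensional_def)
      moreover have "midpoint_fun (Suc n) (x(n := s)) (y(n := t)) = (midpoint_fun n x y)(n := (s + t) / 2)"
        by (auto simp: midpoint_fun_def fun_eq_iff)
      ultimately show "f (x(n := s)) * g (y(n := t)) \<le> (h ((midpoint_fun n x y)(n := (s + t) / 2)))\<^sup>2"
        by simp
    qed (rule measurable_Rn_Suc_section, rule Suc.prems)+
  qed (rule measurable_Rn_Suc_integral, rule Suc.prems)+
qed

text \<open>The multiplicative form, obtained from indicators, needs no roots depending on n and
  preserves lower bounds on measures.\<close>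

lemma brunn_minkowski_mult:
  assumes [measurable]: "A \<in> sets (Rn n)" "B \<in> sets (Rn n)" "C \<in> sets (Rn n)"
    and mid: "\<And>x y. x \<in> A \<Longrightarrow> y \<in> B \<Longrightarrow> midpoint_fun n x y \<in> C"
  shows "emeasure (Rn n) A * emeasure (Rn n) B \<le> (emeasure (Rn n) C)\<^sup>2"
proof -
  have "(\<integral>\<^sup>+x. indicator A x \<partial>Rn n) * (\<integral>\<^sup>+x. indicator B x \<partial>Rn n) \<le> (\<integral>\<^sup>+x. indicator C x \<partial>Rn n)\<^sup>2"
    by (rule prekopa_leindler) (use mid in \<open>auto simp: indicator_def\<close>)
  then show ?thesis by simp
qed


section \<open>The Gaussian measure\<close>

definition gauss :: "nat \<Rightarrow> (nat \<Rightarrow> real) measure" where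
  "gauss n = density (Rn n) (\<lambda>x. ennreal (\<Prod>i<n. std_normal_density (x i)))"

lemma gauss_density_eq:
  "(\<Prod>i<n. std_normal_density (x i)) = (1 / sqrt (2 * pi)) ^ n * exp (- (\<Sum>i<n. (x i)\<^sup>2) / 2)"
  by (simp add: std_normal_density_def prod_dividef exp_sum[symmetric] sum_negf sum_divide_distrib power_divide)

lemma sets_gauss[simp, measurable_cong]: "sets (gauss n) = sets (Rn n)"
  by (simp add: gauss_def)

lemma space_gauss[simp]: "space (gauss n) = space (Rn n)"
  by (simp add: gauss_def)

lemma measurable_gauss_density[measurable]:
  "(\<lambda>x. \<Prod>i<n. std_normal_density (x i)) \<in> borel_measurable (Rn n)"
  by measurable

lemma gauss_density_nonneg: "0 \<le> (\<Prod>i<n. std_normal_density (x i))"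
  by (intro prod_nonneg) auto

lemma nn_integral_gauss_prod:
  assumes [measurable]: "\<And>i. i < n \<Longrightarrow> f i \<in> borel_measurable borel"
  shows "(\<integral>\<^sup>+x. (\<Prod>i<n. f i (x i)) \<partial>gauss n)
    = (\<Prod>i<n. \<integral>\<^sup>+t. ennreal (std_normal_density t) * f i t \<partial>lborel)"
proof -
  have [measurable]: "(\<lambda>x. \<Prod>i<n. f i (x i)) \<in> borel_measurable (Rn n)"
    using assms by (intro borel_measurable_prod_ennreal) (auto intro: measurable_compose[OF measurable_Rn_component])
  have "(\<integral>\<^sup>+x. (\<Prod>i<n. f i (x i)) \<partial>gauss n)
      = (\<integral>\<^sup>+x. ennreal (\<Prod>i<n. std_normal_density (x i)) * (\<Prod>i<n. f i (x i)) \<partial>Rn n)"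
    unfolding gauss_def by (subst nn_integral_density) auto
  also have "\<dots> = (\<integral>\<^sup>+x. (\<Prod>i<n. ennreal (std_normal_density (x i)) * f i (x i)) \<partial>Rn n)"
    by (simp add: prod_ennreal[symmetric] prod.distrib)
  also have "\<dots> = (\<Prod>i<n. \<integral>\<^sup>+t. ennreal (std_normal_density t) * f i t \<partial>lborel)"
    unfolding Rn_def by (rule Rn_psf.product_nn_integral_prod) auto
  finally show ?thesis .
qed

lemma nn_integral_normal_density: "(\<integral>\<^sup>+t. ennreal (normal_density \<mu> 1 t) \<partial>lborel) = 1"
  using integral_normal_density[of 1 \<mu>] by (subst nn_integral_eq_integral) auto

lemma prob_space_gauss: "prob_space (gauss n)"
proof
  have "emeasure (gauss n) (space (gauss n)) = (\<integral>\<^sup>+x. (\<Prod>i<n. 1) \<partial>gauss n)" by simp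
  also have "\<dots> = 1"
    by (subst nn_integral_gauss_prod) (simp_all add: nn_integral_normal_density)
  finally show "emeasure (gauss n) (space (gauss n)) = 1" .
qed

interpretation gauss: prob_space "gauss n" for n by (rule prob_space_gauss)

lemma gauss_exp_moment:
  "(\<integral>\<^sup>+x. ennreal (exp (\<Sum>i<n. a i * x i)) \<partial>gauss n) = ennreal (exp ((\<Sum>i<n. (a i)\<^sup>2) / 2))"
proof -
  have one: "(\<integral>\<^sup>+t. ennreal (std_normal_density t) * ennreal (exp (c * t)) \<partial>lborel) = ennreal (exp (c\<^sup>2 / 2))" for c
  proof -
    have "std_normal_density t * exp (c * t) = exp (c\<^sup>2 / 2) * normal_density c 1 t" for t
      by (simp add: normal_density_def exp_add[symmetric] power2_diff field_simps)
    then have "(\<integral>\<^sup>+t. ennreal (std_normal_density t) * ennreal (exp (c * t)) \<partial>lborel)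
      = (\<integral>\<^sup>+t. ennreal (exp (c\<^sup>2 / 2)) * ennreal (normal_density c 1 t) \<partial>lborel)"
      by (simp add: ennreal_mult'[symmetric])
    also have "\<dots> = ennreal (exp (c\<^sup>2 / 2))"
      by (simp add: nn_integral_cmult nn_integral_normal_density)
    finally show ?thesis .
  qed
  have "(\<integral>\<^sup>+x. ennreal (exp (\<Sum>i<n. a i * x i)) \<partial>gauss n) = (\<integral>\<^sup>+x. (\<Prod>i<n. ennreal (exp (a i * x i))) \<partial>gauss n)"
    by (simp add: exp_sum prod_ennreal)
  also have "\<dots> = (\<Prod>i<n. ennreal (exp ((a i)\<^sup>2 / 2)))"
    by (subst nn_integral_gauss_prod) (auto simp: one)
  also have "\<dots> = ennreal (exp ((\<Sum>i<n. (a i)\<^sup>2) / 2))"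
    by (simp add: prod_ennreal exp_sum[symmetric] sum_divide_distrib)
  finally show ?thesis .
qed

lemma power_le_fact_exp:
  fixes x :: real assumes "x \<ge> 0" shows "x ^ m \<le> fact m * exp x"
proof -
  have "(\<Sum>i\<in>{m}. x ^ i /\<^sub>R fact i) \<le> exp x"
    unfolding exp_def by (rule sum_le_suminf) (use assms summable_exp_generic[of x] in auto)
  then show ?thesis by (simp add: field_simps)
qed

text \<open>An even power is dominated by exponentials, y^(2p) \<le> (2p)! l^(-2p) (exp (l y) + exp
  (- l y)), whose Gaussian integrals are explicit. This bound has the right order in p and spares
  the exact moments.\<close>

lemma gauss_even_moment_le:
  assumes p: "p \<ge> 1"
  shows "(\<integral>\<^sup>+x. ennreal ((\<Sum>i<n. a i * x i) ^ (2 * p)) \<partial>gauss n)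
    \<le> ennreal (2 * fact (2 * p) * (exp 1 / (2 * real p)) ^ p * (\<Sum>i<n. (a i)\<^sup>2) ^ p)"
proof (cases "(\<Sum>i<n. (a i)\<^sup>2) = 0")
  case True
  then have "a i = 0" if "i < n" for i using that by (subst (asm) sum_nonneg_eq_0_iff) auto
  then show ?thesis using p by (simp add: power_0_left)
next
  case False
  define s where "s = (\<Sum>i<n. (a i)\<^sup>2)"
  have s: "s > 0" using False unfolding s_def by (simp add: less_le sum_nonneg)
  \<comment> \<open>The minimiser of exp (l^2 s/2) l^(-2p); it turns the exponential moment into exp
    p.\<close>
  define l where "l = sqrt (2 * real p / s)"
  have l: "l > 0" "l\<^sup>2 = 2 * real p / s" using s p by (simp_all add: l_def)
  define C where "C = fact (2 * p) / l ^ (2 * p)"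
  have lp: "l ^ (2 * p) = (2 * real p / s) ^ p" by (simp add: power_mult l(2))
  have C: "C \<ge> 0" using l by (simp add: C_def)
  have pt: "y ^ (2 * p) \<le> C * (exp (l * y) + exp (- l * y))" for y :: real
  proof -
    have "(l * y) ^ (2 * p) = \<bar>l * y\<bar> ^ (2 * p)" by (simp add: power_even_abs)
    also have "\<dots> \<le> fact (2 * p) * exp \<bar>l * y\<bar>" by (rule power_le_fact_exp) simp
    also have "exp \<bar>l * y\<bar> \<le> exp (l * y) + exp (- l * y)" by (auto simp: abs_if add_increasing add_increasing2)
    finally have "(l * y) ^ (2 * p) \<le> fact (2 * p) * (exp (l * y) + exp (- l * y))" by simp
    then show ?thesis using l by (simp add: C_def power_mult_distrib field_simps)
  qed
  have mgf: "(\<integral>\<^sup>+x. ennreal (exp (c * (\<Sum>i<n. a i * x i))) \<partial>gauss n) = ennreal (exp (real p))" if "c\<^sup>2 = l\<^sup>2" for c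
  proof -
    have "(\<integral>\<^sup>+x. ennreal (exp (c * (\<Sum>i<n. a i * x i))) \<partial>gauss n) = ennreal (exp ((\<Sum>i<n. (c * a i)\<^sup>2) / 2))"
      using gauss_exp_moment[of n "\<lambda>i. c * a i"] by (simp add: sum_distrib_left mult.assoc)
    also have "(\<Sum>i<n. (c * a i)\<^sup>2) = l\<^sup>2 * s"
      by (simp add: power_mult_distrib s_def sum_distrib_left that)
    finally show ?thesis using l s by simp
  qed
  have "(\<integral>\<^sup>+x. ennreal ((\<Sum>i<n. a i * x i) ^ (2 * p)) \<partial>gauss n)
      \<le> (\<integral>\<^sup>+x. ennreal C * (ennreal (exp (l * (\<Sum>i<n. a i * x i))) + ennreal (exp (- l * (\<Sum>i<n. a i * x i)))) \<partial>gauss n)"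
    by (intro nn_integral_mono) (use pt C in \<open>simp add: ennreal_mult'[symmetric] ennreal_plus[symmetric] ennreal_leI del: ennreal_plus\<close>)
  also have "\<dots> = ennreal C * (ennreal (exp (real p)) + ennreal (exp (real p)))"
    using mgf[of l] mgf[of "-l"] by (simp add: nn_integral_cmult nn_integral_add)
  also have "\<dots> = ennreal (C * (2 * exp (real p)))"
    using C by (simp add: ennreal_mult' flip: ennreal_plus)
  also have "C * (2 * exp (real p)) = 2 * fact (2 * p) * (exp 1 / (2 * real p)) ^ p * s ^ p"
    unfolding C_def lp using s p by (simp add: power_divide power_mult_distrib exp_of_nat_mult[symmetric] field_simps)
  finally show ?thesis by (simp add: s_def)
qed

section \<open>Gaussian integrals of forms compared with spherical ones\<close>

lemma integrable_gauss_form: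
  assumes "f \<in> forms n d"
  shows "integrable (gauss n) f"
  using assms
proof (induction rule: forms_induct)
  case (step c a h)
  have "integrable (gauss n) (\<lambda>x. \<Prod>i<n. x i ^ a i)"
  proof -
    have "integrable (Rn n) (\<lambda>x. \<Prod>i<n. std_normal_density (x i) * x i ^ a i)"
      unfolding Rn_def by (rule Rn_psf.product_integrable_prod) (auto intro: integrable_std_normal_moment)
    then show ?thesis
      unfolding gauss_def
      by (subst integrable_density) (auto simp: gauss_density_nonneg prod.distrib)
  qed
  then show ?case using step by auto
qed simp

text \<open>A map preserving both the base measure and the density preserves the measure. It serves
  for orthogonal maps of \<open>Rn n\<close> and for rotations of pairs alike.\<close>

lemma distr_density_invariant:
  assumes T[measurable]: "T \<in> measurable M M" and distr: "distr M M T = M"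
    and r[measurable]: "r \<in> borel_measurable M" and inv: "\<And>x. x \<in> space M \<Longrightarrow> r (T x) = r x"
  shows "distr (density M r) M T = density M r"
proof (rule measure_eqI)
  fix A assume "A \<in> sets (distr (density M r) M T)"
  then have A[measurable]: "A \<in> sets M" by simp
  have "emeasure (distr (density M r) M T) A = (\<integral>\<^sup>+x. r x * indicator (T -` A \<inter> space M) x \<partial>M)"
    using measurable_sets[OF T A] by (subst emeasure_distr) (auto simp: emeasure_density)
  also have "\<dots> = (\<integral>\<^sup>+x. r (T x) * indicator A (T x) \<partial>M)"
    by (intro nn_integral_cong) (auto simp: indicator_def inv)
  also have "\<dots> = (\<integral>\<^sup>+x. r x * indicator A x \<partial>distr M M T)"
    by (rule nn_integral_distr[symmetric]) auto
  also have "\<dots> = emeasure (density M r) A"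
    unfolding distr by (subst emeasure_density) auto
  finally show "emeasure (distr (density M r) M T) A = emeasure (density M r) A" .
qed simp

lemma distr_gauss_orthogonal:
  assumes U: "orthogonal_coeffs n U"
  shows "distr (gauss n) (Rn n) (linear_map n U) = gauss n"
  unfolding gauss_def
  by (rule distr_density_invariant[OF measurable_linear_map distr_Rn_orthogonal[OF U]])
    (use orthogonal_coeffs_norm[OF U] in \<open>auto simp: gauss_density_eq L2_set_def real_sqrt_eq_iff\<close>)

lemma gauss_integral_form:
  assumes n: "n \<ge> 1"
  shows "\<exists>c. \<forall>f\<in>forms n d. (\<integral>x. f x \<partial>gauss n) = c * (\<integral>x. f x \<partial>sphere_measure n)"
proof (rule rotation_invariant_functional[OF n])
  fix U f assume U: "orthogonal_coeffs n U" and f: "f \<in> forms n d"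
  note [measurable] = measurable_form[OF f]
  have "(\<integral>x. f x \<partial>gauss n) = (\<integral>x. f x \<partial>distr (gauss n) (Rn n) (linear_map n U))"
    by (simp add: distr_gauss_orthogonal[OF U])
  also have "\<dots> = (\<integral>x. f (linear_map n U x) \<partial>gauss n)"
    by (rule integral_distr) auto
  finally show "(\<integral>x. f (linear_map n U x) \<partial>gauss n) = (\<integral>x. f x \<partial>gauss n)" ..
qed (auto simp: integrable_gauss_form)

text \<open>The Gaussian integral is an invariant functional on forms. Its factor against the
  spherical mean is found by testing on \<open>radial_form\<close>, which is 1 on the
  sphere.\<close>

lemma gauss_integral_form_radial:
  assumes n: "n \<ge> 1" and f: "f \<in> forms n (2 * k)"
  shows "(\<integral>x. f x \<partial>gauss n) = (\<integral>x. radial_form n k x \<partial>gauss n) * (\<integral>x. f x \<partial>sphere_measure n)"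
proof -
  interpret S: prob_space "sphere_measure n" by (rule prob_space_sphere_measure)
  obtain c where c: "\<And>f. f \<in> forms n (2 * k) \<Longrightarrow> (\<integral>x. f x \<partial>gauss n) = c * (\<integral>x. f x \<partial>sphere_measure n)"
    using gauss_integral_form[OF n] by blast
  note [measurable] = measurable_form[OF radial_form_in_forms[of n k]]
  have "(\<integral>x. radial_form n k x \<partial>sphere_measure n) = (\<integral>x. 1 \<partial>sphere_measure n)"
  proof (rule integral_cong_AE)
    show "AE x in sphere_measure n. radial_form n k x = 1"
      using AE_sphere_measure[OF n] by eventually_elim (simp add: radial_form_eq)
  qed auto
  moreover have "S.prob (space (Rn n)) = 1" using S.prob_space by simp
  ultimately show ?thesis using c[OF f] c[OF radial_form_in_forms] by simp
qed

lemma gauss_integral_square_coord: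
  assumes "i < n"
  shows "(\<integral>x. (x i)\<^sup>2 \<partial>gauss n) = 1"
proof -
  have "(\<integral>\<^sup>+x. ennreal ((x i)\<^sup>2) \<partial>gauss n) = (\<integral>\<^sup>+x. (\<Prod>j<n. if j = i then ennreal ((x j)\<^sup>2) else 1) \<partial>gauss n)"
    using assms by (intro nn_integral_cong) simp
  also have "\<dots> = (\<Prod>j<n. \<integral>\<^sup>+t. ennreal (std_normal_density t) * (if j = i then ennreal (t\<^sup>2) else 1) \<partial>lborel)"
    by (rule nn_integral_gauss_prod) auto
  also have "\<dots> = (\<Prod>j<n. 1)"
  proof (rule prod.cong[OF refl])
    fix j assume "j \<in> {..<n}"
    have "(\<integral>\<^sup>+t. ennreal (std_normal_density t * t\<^sup>2) \<partial>lborel) = ennreal 1"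
      using std_normal_moment_even[of 1]
      by (subst nn_integral_eq_integral) (auto simp: has_bochner_integral_iff)
    then show "(\<integral>\<^sup>+t. ennreal (std_normal_density t) * (if j = i then ennreal (t\<^sup>2) else 1) \<partial>lborel) = 1"
      by (cases "j = i") (simp_all add: ennreal_mult nn_integral_normal_density)
  qed
  finally have "(\<integral>\<^sup>+x. ennreal ((x i)\<^sup>2) \<partial>gauss n) = ennreal 1" by simp
  then show ?thesis
    using assms by (subst integral_eq_nn_integral) auto
qed

text \<open>Jensen's inequality in concrete form: t^k lies above its tangent at t = n, and n is the
  Gaussian mean of the squared norm, so the linear term integrates to 0.\<close>

lemma gauss_integral_radial_ge:
  "real n ^ k \<le> (\<integral>x. radial_form n k x \<partial>gauss n)"
proof (cases "n = 0 \<or> k = 0")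
  case True
  moreover have "gauss.prob n (space (Rn n)) = 1" using gauss.prob_space[of n] by simp
  ultimately show ?thesis by (auto simp: radial_form_def power_0_left)
next
  case False
  define r where "r = (\<lambda>x::nat\<Rightarrow>real. \<Sum>i<n. (x i)\<^sup>2)"
  have sq: "(\<lambda>x. (x i)\<^sup>2) \<in> forms n 2" if "i < n" for i
    using forms_power[OF forms_coord[OF that], of 2] by simp
  have ri: "integrable (gauss n) r"
    unfolding r_def by (intro integrable_gauss_form[where d = 2] forms_sum sq) auto
  have "(\<integral>x. r x \<partial>gauss n) = (\<Sum>i<n. \<integral>x. (x i)\<^sup>2 \<partial>gauss n)"
    unfolding r_def by (rule Bochner_Integration.integral_sum) (auto intro: integrable_gauss_form sq)
  then have r1: "(\<integral>x. r x \<partial>gauss n) = real n" by (simp add: gauss_integral_square_coord)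
  \<comment> \<open>The tangent bound is Bernoulli's inequality for u, the relative deviation of r x
    from n, which is at least -1.\<close>
  have pt: "real n ^ k + real k * real n ^ (k - 1) * (r x - real n) \<le> radial_form n k x" for x
  proof -
    have r0: "r x \<ge> 0" by (simp add: r_def sum_nonneg)
    define u where "u = r x / real n - 1"
    have u: "r x = real n * (1 + u)" "u \<ge> -1" using False r0 by (auto simp: u_def field_simps)
    have "real n ^ k * (1 + real k * u) \<le> real n ^ k * (1 + u) ^ k"
      using Bernoulli_inequality[OF u(2), of k] by (intro mult_left_mono) auto
    also have "\<dots> = radial_form n k x"
      using u(1) by (simp add: radial_form_def r_def power_mult_distrib)
    also have "real n ^ k * (1 + real k * u) = real n ^ k + real k * real n ^ (k - 1) * (r x - real n)"
      using False unfolding u(1) by (cases k) (auto simp: algebra_simps)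
    finally show ?thesis .
  qed
  have "(\<integral>x. real n ^ k + real k * real n ^ (k - 1) * (r x - real n) \<partial>gauss n) \<le> (\<integral>x. radial_form n k x \<partial>gauss n)"
    by (intro integral_mono integrable_gauss_form[OF radial_form_in_forms] pt Bochner_Integration.integrable_add
        integrable_mult_right Bochner_Integration.integrable_diff ri) auto
  moreover have "(\<integral>x. real n ^ k + real k * real n ^ (k - 1) * (r x - real n) \<partial>gauss n) = real n ^ k"
  proof -
    have "gauss.prob n (space (Rn n)) = 1" using gauss.prob_space[of n] by simp
    then show ?thesis using ri r1 by simp
  qed
  ultimately show ?thesis by simp
qed


section \<open>Gradients of forms\<close>

text \<open>The chain rule along every curve differentiable in the coordinates below n is taken as
  the definition. It works directly on functions of an index set and is all that lines and circular
  arcs need.\<close>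

definition is_gradient :: "nat \<Rightarrow> form \<Rightarrow> (nat \<Rightarrow> form) \<Rightarrow> bool" where
  "is_gradient n f G \<longleftrightarrow> (\<forall>x x' t. (\<forall>i<n. ((\<lambda>t. x t i) has_real_derivative x' i) (at t)) \<longrightarrow>
    ((\<lambda>t. f (x t)) has_real_derivative (\<Sum>i<n. G i (x t) * x' i)) (at t))"

lemma is_gradientD:
  assumes "is_gradient n f G" "\<And>i. i < n \<Longrightarrow> ((\<lambda>t. x t i) has_real_derivative x' i) (at t)"
  shows "((\<lambda>t. f (x t)) has_real_derivative (\<Sum>i<n. G i (x t) * x' i)) (at t)"
  using assms by (auto simp: is_gradient_def)

lemma form_gradient_exists:
  assumes "f \<in> forms n d"
  shows "\<exists>G. (\<forall>i<n. G i \<in> forms n (d - 1)) \<and> is_gradient n f G"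
  using assms
proof (induction rule: forms_induct)
  case zero
  show ?case by (intro exI[of _ "\<lambda>_ _. 0"]) (simp add: forms_zero is_gradient_def)
next
  case (step c a h)
  obtain H where H: "\<forall>i<n. H i \<in> forms n (d - 1)" "is_gradient n h H"
    using step(3) by blast
  define P where "P i x = real (a i) * x i ^ (a i - 1) * (\<Prod>j\<in>{..<n} - {i}. x j ^ a j)" for i and x :: "nat \<Rightarrow> real"
  have PF: "P i \<in> forms n (d - 1)" if i: "i < n" for i
  proof (cases "a i = 0")
    case True
    then have "P i = (\<lambda>x. 0)" by (simp add: P_def fun_eq_iff)
    then show ?thesis by (simp add: forms_zero)
  next
    case False
    define b where "b = a(i := a i - 1)"
    have "(\<Sum>j<n. a j) = a i + (\<Sum>j\<in>{..<n} - {i}. a j)" using i by (simp add: sum.remove)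
    moreover have "(\<Sum>j<n. b j) = b i + (\<Sum>j\<in>{..<n} - {i}. b j)" using i by (simp add: sum.remove)
    moreover have "(\<Sum>j\<in>{..<n} - {i}. b j) = (\<Sum>j\<in>{..<n} - {i}. a j)"
      by (intro sum.cong) (auto simp: b_def)
    ultimately have "(\<Sum>j<n. b j) = d - 1" using step(1) False by (simp add: b_def)
    from forms_cmult[OF forms_monomial[OF this], of "real (a i)"] show ?thesis
    proof (rule back_subst[of "\<lambda>f. f \<in> forms n (d - 1)"], intro ext)
      fix x :: "nat \<Rightarrow> real"
      have "(\<Prod>j<n. x j ^ b j) = x i ^ b i * (\<Prod>j\<in>{..<n} - {i}. x j ^ b j)"
        using i by (simp add: prod.remove)
      also have "(\<Prod>j\<in>{..<n} - {i}. x j ^ b j) = (\<Prod>j\<in>{..<n} - {i}. x j ^ a j)"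
        by (intro prod.cong) (auto simp: b_def)
      finally show "real (a i) * (\<Prod>j<n. x j ^ b j) = P i x" by (simp add: P_def b_def)
    qed
  qed
  show ?case
    unfolding is_gradient_def
  proof (intro exI[of _ "\<lambda>i x. c * P i x + H i x"] conjI allI impI)
    fix i assume "i < n"
    then show "(\<lambda>x. c * P i x + H i x) \<in> forms n (d - 1)"
      by (intro forms_add forms_cmult PF) (use H in auto)
  next
    fix x x' and t :: real
    assume x: "\<forall>i<n. ((\<lambda>t. x t i) has_real_derivative x' i) (at t)"
    have "((\<lambda>t. \<Prod>i<n. x t i ^ a i) has_real_derivative
        (\<Sum>i<n. (real (a i) * (x' i * x t i ^ (a i - Suc 0))) * (\<Prod>j\<in>{..<n} - {i}. x t j ^ a j))) (at t)"
      by (rule has_field_derivative_prod) (use x in \<open>auto intro!: DERIV_power\<close>)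
    then have "((\<lambda>t. c * (\<Prod>i<n. x t i ^ a i) + h (x t)) has_real_derivative
        (c * (\<Sum>i<n. (real (a i) * (x' i * x t i ^ (a i - Suc 0))) * (\<Prod>j\<in>{..<n} - {i}. x t j ^ a j))
          + (\<Sum>i<n. H i (x t) * x' i))) (at t)"
      by (intro DERIV_add DERIV_cmult is_gradientD[OF H(2)]) (use x in auto)
    moreover have "c * (\<Sum>i<n. (real (a i) * (x' i * x t i ^ (a i - Suc 0))) * (\<Prod>j\<in>{..<n} - {i}. x t j ^ a j))
          + (\<Sum>i<n. H i (x t) * x' i) = (\<Sum>i<n. (c * P i (x t) + H i (x t)) * x' i)"
      by (simp add: P_def sum.distrib sum_distrib_left algebra_simps)
    ultimately show "((\<lambda>t. c * (\<Prod>i<n. x t i ^ a i) + h (x t)) has_real_derivative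
        (\<Sum>i<n. (c * P i (x t) + H i (x t)) * x' i)) (at t)" by simp
  qed
qed

section \<open>A dimension-free gradient bound\<close>

lemma form_on_line_poly:
  assumes "f \<in> forms n d"
  shows "\<exists>p. degree p \<le> d \<and> (\<forall>t. poly p t = f (\<lambda>i. x i + t * y i))"
  using assms
proof (induction rule: forms_induct)
  case zero
  show ?case by (intro exI[of _ 0]) simp
next
  case (step c a h)
  obtain p where p: "degree p \<le> d" "\<forall>t. poly p t = h (\<lambda>i. x i + t * y i)" using step by blast
  define q where "q = smult c (\<Prod>i<n. [:x i, y i:] ^ a i) + p"
  have "degree (\<Prod>i<n. [:x i, y i:] ^ a i) \<le> (\<Sum>i<n. degree ([:x i, y i:] ^ a i))"
    using degree_prod_sum_le[of "{..<n}" "\<lambda>i. [:x i, y i:] ^ a i"] by (simp add: comp_def)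
  also have "\<dots> \<le> (\<Sum>i<n. a i)"
    by (intro sum_mono order_trans[OF degree_power_le]) auto
  finally have "degree q \<le> d"
    unfolding q_def using p step(1) by (intro degree_add_le order_trans[OF degree_smult_le]) auto
  moreover have "poly q t = c * (\<Prod>i<n. (x i + t * y i) ^ a i) + h (\<lambda>i. x i + t * y i)" for t
    using p by (simp add: q_def poly_prod)
  ultimately show ?case by blast
qed

text \<open>Passing from \<open>p\<close> to \<open>2\<^sup>i p(t/2) - p(t)\<close> kills the coefficient of \<open>t\<^sup>i\<close>.\<close>

lemma linear_coeff_bound_support:
  assumes "finite I" "1 \<notin> I"
  shows "\<exists>C::real. \<forall>a M. (\<forall>t. \<bar>t\<bar> \<le> 1 \<longrightarrow> \<bar>\<Sum>i\<in>insert 1 I. a i * t ^ i\<bar> \<le> M) \<longrightarrow> \<bar>a 1\<bar> \<le> C * M"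
  using assms
proof (induction I)
  case empty
  show ?case
  proof (intro exI[of _ 1] allI impI)
    fix a :: "nat \<Rightarrow> real" and M
    assume "\<forall>t. \<bar>t\<bar> \<le> 1 \<longrightarrow> \<bar>\<Sum>i\<in>{1}. a i * t ^ i\<bar> \<le> M"
    from this[rule_format, of 1] show "\<bar>a 1\<bar> \<le> 1 * M" by simp
  qed
next
  case (insert m I)
  have "1 \<notin> I" using insert by auto
  from insert.IH[OF this] obtain C where
    C: "\<And>a (M::real). (\<forall>t. \<bar>t\<bar> \<le> 1 \<longrightarrow> \<bar>\<Sum>i\<in>insert 1 I. a i * t ^ i\<bar> \<le> M) \<Longrightarrow> \<bar>a 1\<bar> \<le> C * M"
    by blast
  have m: "m \<noteq> 1" using insert by auto
  \<comment> \<open>The factor acquired by the linear coefficient when the coefficient of index m is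
    removed; it is nonzero exactly because m \<noteq> 1.\<close>
  define e where "e = (2::real) ^ m / 2 - 1"
  have e: "e \<noteq> 0"
  proof
    assume "e = 0"
    then have "(2::real) ^ m = 2 ^ 1" by (simp add: e_def)
    then show False using m power_inject_exp[of "2::real" m 1] by simp
  qed
  show ?case
  proof (intro exI[of _ "C * (2 ^ m + 1) / \<bar>e\<bar>"] allI impI)
    fix a :: "nat \<Rightarrow> real" and M
    assume M: "\<forall>t. \<bar>t\<bar> \<le> 1 \<longrightarrow> \<bar>\<Sum>i\<in>insert 1 (insert m I). a i * t ^ i\<bar> \<le> M"
    let ?p = "\<lambda>t. \<Sum>i\<in>insert 1 (insert m I). a i * t ^ i"
    define b where "b i = (2 ^ m / 2 ^ i - 1) * a i" for i
    have bp: "(\<Sum>i\<in>insert 1 I. b i * t ^ i) = 2 ^ m * ?p (t / 2) - ?p t" for t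
    proof -
      have "2 ^ m * ?p (t / 2) - ?p t = (\<Sum>i\<in>insert 1 (insert m I). b i * t ^ i)"
        unfolding sum_distrib_left sum_subtractf[symmetric]
        by (intro sum.cong) (auto simp: b_def field_simps power_divide)
      also have "\<dots> = (\<Sum>i\<in>insert m (insert 1 I). b i * t ^ i)" by (simp add: insert_commute)
      also have "\<dots> = b m * t ^ m + (\<Sum>i\<in>insert 1 I. b i * t ^ i)"
        using insert m by (subst sum.insert) auto
      finally show ?thesis by (simp add: b_def)
    qed
    have "\<bar>\<Sum>i\<in>insert 1 I. b i * t ^ i\<bar> \<le> (2 ^ m + 1) * M" if t: "\<bar>t\<bar> \<le> 1" for t
    proof -
      have "\<bar>2 ^ m * ?p (t / 2) - ?p t\<bar> \<le> 2 ^ m * \<bar>?p (t / 2)\<bar> + \<bar>?p t\<bar>"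
        using abs_triangle_ineq4[of "2 ^ m * ?p (t / 2)" "?p t"] by (simp add: abs_mult)
      also have "\<dots> \<le> 2 ^ m * M + M"
        by (intro add_mono mult_left_mono M[rule_format]) (use t in auto)
      finally show ?thesis unfolding bp by (simp add: algebra_simps)
    qed
    then have "\<bar>b 1\<bar> \<le> C * ((2 ^ m + 1) * M)" using C[of b] by blast
    moreover have "b 1 = e * a 1" by (simp add: b_def e_def)
    ultimately show "\<bar>a 1\<bar> \<le> C * (2 ^ m + 1) / \<bar>e\<bar> * M"
      using e by (simp add: abs_mult field_simps)
  qed
qed

lemma poly_linear_coeff_bound:
  "\<exists>C>0. \<forall>p M. degree p \<le> d \<longrightarrow> (\<forall>t. \<bar>t\<bar> \<le> 1 \<longrightarrow> \<bar>poly p t\<bar> \<le> M) \<longrightarrow> \<bar>coeff p 1\<bar> \<le> C * (M::real)"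
proof -
  obtain C where C: "\<And>a M. (\<forall>t. \<bar>t\<bar> \<le> 1 \<longrightarrow> \<bar>\<Sum>i\<in>insert 1 ({..d} - {1}). a i * t ^ i\<bar> \<le> M) \<Longrightarrow> \<bar>a 1\<bar> \<le> C * (M::real)"
    using linear_coeff_bound_support[of "{..d} - {1}"] by auto
  \<comment> \<open>The sign of C is unknown. Since the bound at t = 0 makes M nonnegative, C may be
    enlarged to a positive constant.\<close>
  have "\<bar>coeff p 1\<bar> \<le> (\<bar>C\<bar> + 1) * M"
    if p: "degree p \<le> d" and M: "\<And>t. \<bar>t\<bar> \<le> 1 \<Longrightarrow> \<bar>poly p t\<bar> \<le> M" for p M
  proof -
    have "poly p t = (\<Sum>i\<in>insert 1 ({..d} - {1}). coeff p i * t ^ i)" for t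
      unfolding poly_altdef using p by (intro sum.mono_neutral_left) (auto simp: coeff_eq_0 not_le)
    then have "\<bar>coeff p 1\<bar> \<le> C * M" using C[of "coeff p" M] M by simp
    also have "\<dots> \<le> (\<bar>C\<bar> + 1) * M"
      using M[of 0] by (intro mult_right_mono) auto
    finally show ?thesis .
  qed
  then show ?thesis by (intro exI[of _ "\<bar>C\<bar> + 1"]) auto
qed

text \<open>On the segment of half-length s through x along the gradient, f is a polynomial of
  degree at most d in one variable, bounded by (|x| + s)^d, with linear coefficient s times the
  length of the gradient. The constant therefore depends on d only, and s stays free to be adapted
  to the size of x.\<close>

lemma form_gradient_bound:
  assumes "d \<ge> 1"
  shows "\<exists>C>0. \<forall>n f G x s. f \<in> forms n d \<longrightarrow>
    (\<forall>v. L2_set v {..<n} = 1 \<longrightarrow> \<bar>f v\<bar> \<le> 1) \<longrightarrow>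
    is_gradient n f G \<longrightarrow> s > 0 \<longrightarrow> s * L2_set (\<lambda>i. G i x) {..<n} \<le> C * (L2_set x {..<n} + s) ^ d"
proof -
  obtain C where C: "C > 0" "\<And>p M. degree p \<le> d \<Longrightarrow> (\<And>t. \<bar>t\<bar> \<le> 1 \<Longrightarrow> \<bar>poly p t\<bar> \<le> M) \<Longrightarrow> \<bar>coeff p 1\<bar> \<le> C * (M::real)"
    using poly_linear_coeff_bound[of d] by blast
  have "s * L2_set (\<lambda>i. G i x) {..<n} \<le> C * (L2_set x {..<n} + s) ^ d"
    if f: "f \<in> forms n d" and b: "\<And>v. L2_set v {..<n} = 1 \<Longrightarrow> \<bar>f v\<bar> \<le> 1"
    and G: "is_gradient n f G" and s: "s > 0"
    for n f G s and x :: "nat \<Rightarrow> real"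
  proof (cases "L2_set (\<lambda>i. G i x) {..<n} = 0")
    case True
    then show ?thesis using C s by (simp add: L2_set_nonneg)
  next
    case False
    define g where "g = L2_set (\<lambda>i. G i x) {..<n}"
    have g: "g > 0" using False L2_set_nonneg[of "\<lambda>i. G i x" "{..<n}"] by (simp add: g_def less_le)
    define y where "y i = s / g * G i x" for i
    have ny: "L2_set y {..<n} = s"
    proof -
      have "L2_set y {..<n} = s / g * L2_set (\<lambda>i. G i x) {..<n}"
        unfolding y_def using s g by (intro L2_set_right_distrib[symmetric]) auto
      then show ?thesis using g by (simp add: g_def[symmetric])
    qed
    obtain p where p: "degree p \<le> d" "\<And>t. poly p t = f (\<lambda>i. x i + t * y i)"
      using form_on_line_poly[OF f] by blast
    have "\<bar>poly p t\<bar> \<le> (L2_set x {..<n} + s) ^ d" if t: "\<bar>t\<bar> \<le> 1" for t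
    proof -
      have "\<bar>poly p t\<bar> \<le> 1 * L2_set (\<lambda>i. x i + t * y i) {..<n} ^ d"
        unfolding p by (rule form_bound_abs[OF f b assms])
      moreover have "L2_set (\<lambda>i. x i + t * y i) {..<n} \<le> L2_set x {..<n} + L2_set (\<lambda>i. t * y i) {..<n}"
        by (rule L2_set_triangle_ineq)
      moreover have "L2_set (\<lambda>i. t * y i) {..<n} = \<bar>t\<bar> * s"
        by (simp add: L2_set_def power_mult_distrib sum_distrib_left[symmetric] real_sqrt_mult ny[unfolded L2_set_def])
      moreover have "\<bar>t\<bar> * s \<le> s" using t s by (simp add: mult_le_cancel_right1)
      ultimately show ?thesis
        using power_mono[of "L2_set (\<lambda>i. x i + t * y i) {..<n}" "L2_set x {..<n} + s" d] by (simp add: L2_set_nonneg)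
    qed
    then have c: "\<bar>coeff p 1\<bar> \<le> C * (L2_set x {..<n} + s) ^ d" by (rule C(2)[OF p(1)])
    have "((\<lambda>t. f (\<lambda>i. x i + t * y i)) has_real_derivative (\<Sum>i<n. G i (\<lambda>i. x i + 0 * y i) * y i)) (at 0)"
      by (rule is_gradientD[OF G]) (auto intro!: derivative_eq_intros)
    moreover have "((\<lambda>t. f (\<lambda>i. x i + t * y i)) has_real_derivative coeff p 1) (at 0)"
      using poly_DERIV[of p 0] by (simp add: p poly_0_coeff_0 coeff_pderiv)
    ultimately have "coeff p 1 = (\<Sum>i<n. G i x * y i)" by (auto dest: DERIV_unique)
    also have "\<dots> = s / g * (\<Sum>i<n. (G i x)\<^sup>2)"
      by (simp add: y_def sum_distrib_left power2_eq_square mult_ac)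
    also have "(\<Sum>i<n. (G i x)\<^sup>2) = g\<^sup>2" by (simp add: g_def L2_set_def sum_nonneg)
    also have "s / g * g\<^sup>2 = s * g" using g by (simp add: power2_eq_square)
    finally show ?thesis using c s g by (simp add: g_def[symmetric])
  qed
  then show ?thesis using C(1) by blast
qed


section \<open>The Gaussian Poincare inequality\<close>

definition lin_comb :: "nat \<Rightarrow> real \<Rightarrow> (nat \<Rightarrow> real) \<Rightarrow> real \<Rightarrow> (nat \<Rightarrow> real) \<Rightarrow> nat \<Rightarrow> real" where
  "lin_comb n a x b y = (\<lambda>i\<in>{..<n}. a * x i + b * y i)"

lemma measurable_lin_comb[measurable]:
  assumes [measurable]: "f \<in> measurable M (Rn n)" "g \<in> measurable M (Rn n)"
    "a \<in> borel_measurable M" "b \<in> borel_measurable M"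
  shows "(\<lambda>z. lin_comb n (a z) (f z) (b z) (g z)) \<in> measurable M (Rn n)"
  unfolding lin_comb_def
proof (intro measurable_into_Rn)
  fix i assume "i < n"
  then have [measurable]: "(\<lambda>z. f z i) \<in> borel_measurable M" "(\<lambda>z. g z i) \<in> borel_measurable M"
    by (auto intro: measurable_compose[OF _ measurable_Rn_component])
  show "(\<lambda>z. a z * f z i + b z * g z i) \<in> borel_measurable M" by measurable
qed

section \<open>Rotations of pairs of vectors\<close>

abbreviation "Rn2 n \<equiv> Rn n \<Otimes>\<^sub>M Rn n"

interpretation Rn_pair: pair_sigma_finite "Rn n" "Rn n" for n ..

text \<open>For a fixed second component the shear is a translation of the first, so Fubini and
  translation invariance suffice.\<close>

lemma distr_shear_fst:
  "distr (Rn2 n) (Rn2 n) (\<lambda>z. (lin_comb n 1 (fst z) t (snd z), snd z)) = Rn2 n"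
proof (rule measure_eqI)
  let ?S = "\<lambda>z. (lin_comb n 1 (fst z) t (snd z), snd z)"
  fix A assume "A \<in> sets (distr (Rn2 n) (Rn2 n) ?S)"
  then have A[measurable]: "A \<in> sets (Rn2 n)" by simp
  have "emeasure (distr (Rn2 n) (Rn2 n) ?S) A
      = (\<integral>\<^sup>+z. indicator A z \<partial>distr (Rn2 n) (Rn2 n) ?S)" by simp
  also have "\<dots> = (\<integral>\<^sup>+z. indicator A (?S z) \<partial>(Rn2 n))"
    by (rule nn_integral_distr) auto
  also have "\<dots> = (\<integral>\<^sup>+y. \<integral>\<^sup>+x. indicator A (?S (x, y)) \<partial>Rn n \<partial>Rn n)"
    by (rule Rn_pair.nn_integral_snd[symmetric]) measurable
  also have "\<dots> = (\<integral>\<^sup>+y. \<integral>\<^sup>+x. indicator A (x, y) \<partial>Rn n \<partial>Rn n)"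
  proof (rule nn_integral_cong)
    fix y assume [measurable]: "y \<in> space (Rn n)"
    have "lin_comb n 1 x t y = (\<lambda>i\<in>{..<n}. t * y i + 1 * x i)" for x
      by (auto simp: lin_comb_def)
    then show "(\<integral>\<^sup>+x. indicator A (?S (x, y)) \<partial>Rn n) = (\<integral>\<^sup>+x. indicator A (x, y) \<partial>Rn n)"
      using nn_integral_Rn_affine[of 1 "\<lambda>x. indicator A (x, y)" n "\<lambda>i. t * y i"] by simp
  qed
  also have "\<dots> = (\<integral>\<^sup>+z. indicator A z \<partial>(Rn2 n))"
    by (rule Rn_pair.nn_integral_snd) measurable
  finally show "emeasure (distr (Rn2 n) (Rn2 n) ?S) A = emeasure (Rn2 n) A"
    by simp
qed simp

lemma distr_shear_snd:
  "distr (Rn2 n) (Rn2 n) (\<lambda>z. (fst z, lin_comb n t (fst z) 1 (snd z))) = Rn2 n"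
proof -
  let ?P = "Rn2 n" and ?S = "\<lambda>z. (lin_comb n 1 (fst z) t (snd z), snd z)"
  let ?w = "\<lambda>(x, y). (y, x) :: (nat \<Rightarrow> real) \<times> (nat \<Rightarrow> real)"
  have w: "distr ?P ?P ?w = ?P" by (rule Rn_pair.distr_pair_swap[symmetric])
  have "(\<lambda>z. (fst z, lin_comb n t (fst z) 1 (snd z))) = ?w \<circ> (?S \<circ> ?w)"
    by (auto simp: lin_comb_def fun_eq_iff)
  then have "distr ?P ?P (\<lambda>z. (fst z, lin_comb n t (fst z) 1 (snd z))) = distr ?P ?P (?w \<circ> (?S \<circ> ?w))" by simp
  also have "\<dots> = distr (distr ?P ?P (?S \<circ> ?w)) ?P ?w"
    by (rule distr_distr[symmetric]) measurable
  also have "distr ?P ?P (?S \<circ> ?w) = distr (distr ?P ?P ?w) ?P ?S"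
    by (rule distr_distr[symmetric]) measurable
  finally show ?thesis unfolding w distr_shear_fst .
qed

definition pair_rotation :: "nat \<Rightarrow> real \<Rightarrow> real \<Rightarrow> (nat \<Rightarrow> real) \<times> (nat \<Rightarrow> real) \<Rightarrow> (nat \<Rightarrow> real) \<times> (nat \<Rightarrow> real)" where
  "pair_rotation n c s z = (lin_comb n c (fst z) s (snd z), lin_comb n (- s) (fst z) c (snd z))"

lemma measurable_pair_rotation[measurable]:
  "pair_rotation n c s \<in> measurable (Rn2 n) (Rn2 n)"
  unfolding pair_rotation_def[abs_def] by measurable

text \<open>A rotation in the plane is a product of three shears.\<close>

lemma distr_Rn_pair_rotation:
  assumes cs: "c\<^sup>2 + s\<^sup>2 = 1" and c: "c \<ge> 0"
  shows "distr (Rn2 n) (Rn2 n) (pair_rotation n c s) = Rn2 n"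
proof -
  \<comment> \<open>For c = cos \<theta> and s = sin \<theta> this is tan (\<theta>/2), the
    parameter of the outer shears; c \<ge> 0 keeps the denominator positive.\<close>
  define t where "t = s / (1 + c)"
  let ?P = "Rn2 n"
  let ?S1 = "\<lambda>z. (lin_comb n 1 (fst z) t (snd z), snd z)"
  let ?S2 = "\<lambda>z. (fst z, lin_comb n (- s) (fst z) 1 (snd z))"
  have st: "1 - s * t = c"
  proof -
    have "s * s = (1 - c) * (1 + c)" using cs by (simp add: power2_eq_square algebra_simps)
    then show ?thesis using c by (simp add: t_def field_simps)
  qed
  have "t * (1 + c) = s" using c by (simp add: t_def)
  then have tc: "t + t * c = s" by (simp add: algebra_simps)
  have "pair_rotation n c s z = ?S1 (?S2 (?S1 z))" for z
  proof -
    have 1: "- s * (fst z i + t * snd z i) + snd z i = - s * fst z i + c * snd z i" for i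
    proof -
      have "- s * (fst z i + t * snd z i) + snd z i = - s * fst z i + (1 - s * t) * snd z i"
        by (simp add: algebra_simps)
      then show ?thesis by (simp add: st)
    qed
    have 2: "fst z i + t * snd z i + t * (- s * fst z i + c * snd z i) = c * fst z i + s * snd z i" for i
    proof -
      have "fst z i + t * snd z i + t * (- s * fst z i + c * snd z i) = (1 - s * t) * fst z i + (t + t * c) * snd z i"
        by (simp add: algebra_simps)
      then show ?thesis by (simp add: st tc)
    qed
    show ?thesis
      using 1 2 by (auto simp: pair_rotation_def lin_comb_def fun_eq_iff)
  qed
  then have "pair_rotation n c s = ?S1 \<circ> (?S2 \<circ> ?S1)" by (auto simp: fun_eq_iff)
  then have "distr ?P ?P (pair_rotation n c s) = distr ?P ?P (?S1 \<circ> (?S2 \<circ> ?S1))" by simp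
  also have "\<dots> = distr (distr ?P ?P (?S2 \<circ> ?S1)) ?P ?S1"
    by (rule distr_distr[symmetric]) measurable
  also have "distr ?P ?P (?S2 \<circ> ?S1) = distr (distr ?P ?P ?S1) ?P ?S2"
    by (rule distr_distr[symmetric]) measurable
  finally show ?thesis unfolding distr_shear_fst distr_shear_snd .
qed

interpretation gauss_pair: pair_prob_space "gauss n" "gauss n" for n ..

lemma gauss_pair_eq_density:
  "gauss n \<Otimes>\<^sub>M gauss n = density (Rn2 n)
    (\<lambda>(x, y). ennreal (\<Prod>i<n. std_normal_density (x i)) * ennreal (\<Prod>i<n. std_normal_density (y i)))"
  unfolding gauss_def
  by (rule pair_measure_density) (auto simp: Rn_sigma.sigma_finite_measure_axioms
      gauss.sigma_finite_measure_axioms[unfolded gauss_def])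

lemma distr_gauss_pair_rotation:
  assumes cs: "c\<^sup>2 + s\<^sup>2 = 1" and c: "c \<ge> 0"
  shows "distr (gauss n \<Otimes>\<^sub>M gauss n) (Rn2 n) (pair_rotation n c s) = gauss n \<Otimes>\<^sub>M gauss n"
  unfolding gauss_pair_eq_density
proof (rule distr_density_invariant[OF measurable_pair_rotation distr_Rn_pair_rotation[OF assms]])
  fix z :: "(nat \<Rightarrow> real) \<times> (nat \<Rightarrow> real)"
  obtain x y where z: "z = (x, y)" by force
  have "(\<Sum>i<n. (c * x i + s * y i)\<^sup>2) + (\<Sum>i<n. (- s * x i + c * y i)\<^sup>2)
      = (\<Sum>i<n. (c\<^sup>2 + s\<^sup>2) * ((x i)\<^sup>2 + (y i)\<^sup>2))"
    unfolding sum.distrib[symmetric] by (intro sum.cong refl) (simp add: power2_eq_square algebra_simps)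
  then have eq: "(\<Sum>i<n. (c * x i + s * y i)\<^sup>2) + (\<Sum>i<n. (- s * x i + c * y i)\<^sup>2) = (\<Sum>i<n. (x i)\<^sup>2) + (\<Sum>i<n. (y i)\<^sup>2)"
    by (simp add: cs sum.distrib)
  have prod: "ennreal (\<Prod>i<n. std_normal_density (x i)) * ennreal (\<Prod>i<n. std_normal_density (y i))
      = ennreal ((1 / sqrt (2 * pi)) ^ n * (1 / sqrt (2 * pi)) ^ n * exp (- ((\<Sum>i<n. (x i)\<^sup>2) + (\<Sum>i<n. (y i)\<^sup>2)) / 2))"
    for x y :: "nat \<Rightarrow> real"
    unfolding gauss_density_eq by (subst ennreal_mult[symmetric]) (auto simp: exp_add[symmetric] add_divide_distrib algebra_simps)
  show "(case pair_rotation n c s z of (x, y) \<Rightarrow> ennreal (\<Prod>i<n. std_normal_density (x i)) * ennreal (\<Prod>i<n. std_normal_density (y i)))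
    = (case z of (x, y) \<Rightarrow> ennreal (\<Prod>i<n. std_normal_density (x i)) * ennreal (\<Prod>i<n. std_normal_density (y i)))"
    unfolding z pair_rotation_def split prod fst_conv snd_conv
    using eq by (simp add: lin_comb_def)
qed measurable

text \<open>Cauchy-Schwarz for the derivative, obtained by integrating the square of q' minus the
  mean slope m. The right side is an \<open>ennreal\<close> integral, ready for Fubini.\<close>

lemma square_increment_le_integral:
  fixes q q' :: "real \<Rightarrow> real"
  assumes ab: "a < b" and q: "\<And>t. (q has_real_derivative q' t) (at t)" and c: "continuous_on UNIV q'"
  shows "ennreal ((q b - q a)\<^sup>2) \<le> ennreal (b - a) * (\<integral>\<^sup>+t. ennreal ((q' t)\<^sup>2) * indicator {a..b} t \<partial>lborel)"
proof -
  define m where "m = (q b - q a) / (b - a)"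
  have c': "continuous_on {a..b} q'" using c by (rule continuous_on_subset) simp
  have i1: "set_integrable lborel {a..b} q'" "set_integrable lborel {a..b} (\<lambda>t. (q' t)\<^sup>2)"
    by (intro borel_integrable_atLeastAtMost' continuous_intros c')+
  then have i: "integrable lborel (\<lambda>t. indicator {a..b} t * q' t)" "integrable lborel (\<lambda>t. indicator {a..b} t * (q' t)\<^sup>2)"
    by (auto simp: set_integrable_def)
  have ftc: "(\<integral>t. indicator {a..b} t * q' t \<partial>lborel) = q b - q a"
    using integral_FTC_atLeastAtMost[of a b q q'] ab q c'
    by (auto simp: has_real_derivative_iff_has_vector_derivative[symmetric] intro: has_field_derivative_at_within)
  define J where "J = (\<integral>t. indicator {a..b} t * (q' t)\<^sup>2 \<partial>lborel)"
  have "0 \<le> (\<integral>t. indicator {a..b} t * (q' t - m)\<^sup>2 \<partial>lborel)" by simp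
  also have "\<dots> = (\<integral>t. indicator {a..b} t * (q' t)\<^sup>2 - 2 * m * (indicator {a..b} t * q' t) + m\<^sup>2 * indicator {a..b} t \<partial>lborel)"
    by (intro Bochner_Integration.integral_cong) (auto simp: power2_diff algebra_simps)
  also have "\<dots> = J - 2 * m * (q b - q a) + m\<^sup>2 * (b - a)"
    using ab i by (simp add: J_def ftc)
  also have "\<dots> = J - (q b - q a)\<^sup>2 / (b - a)"
  proof -
    have "J - 2 * (w / u) * w + (w / u)\<^sup>2 * u = J - w\<^sup>2 / u" if "u \<noteq> 0" for w u
      using that by (simp add: power2_eq_square field_simps)
    from this[of "b - a" "q b - q a"] show ?thesis using ab by (simp add: m_def)
  qed
  finally have "(q b - q a)\<^sup>2 \<le> (b - a) * J" using ab by (simp add: field_simps)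
  then have "ennreal ((q b - q a)\<^sup>2) \<le> ennreal ((b - a) * J)" by (rule ennreal_leI)
  also have "\<dots> = ennreal (b - a) * ennreal J" using ab by (intro ennreal_mult') auto
  also have "ennreal J = (\<integral>\<^sup>+t. ennreal (indicator {a..b} t * (q' t)\<^sup>2) \<partial>lborel)"
    unfolding J_def by (rule nn_integral_eq_integral[symmetric]) (use i in auto)
  also have "\<dots> = (\<integral>\<^sup>+t. ennreal ((q' t)\<^sup>2) * indicator {a..b} t \<partial>lborel)"
    by (intro nn_integral_cong) (auto simp: indicator_def)
  finally show ?thesis .
qed

text \<open>The Maurey-Pisier argument: \<open>X \<theta> = cos \<theta> X + sin \<theta> Y\<close> interpolates between independent Gaussians,
  and \<open>(X \<theta>, X' \<theta>)\<close> has the law of \<open>(X, Y)\<close> for every \<open>\<theta>\<close>.\<close>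

lemma gauss_poincare:
  assumes f: "f \<in> forms n d" and G: "\<And>i. i < n \<Longrightarrow> G i \<in> forms n e"
    and D: "is_gradient n f G" and mean: "(\<integral>x. f x \<partial>gauss n) = 0"
  shows "(\<integral>x. (f x)\<^sup>2 \<partial>gauss n) \<le> pi\<^sup>2 * exp 1 / 4 * (\<integral>x. (\<Sum>i<n. (G i x)\<^sup>2) \<partial>gauss n)"
proof -
  let ?P = "gauss n \<Otimes>\<^sub>M gauss n"
  \<comment> \<open>The square of the gradient at the first component applied to the second; at a
    rotated pair it is the squared speed of f along the arc.\<close>
  define H where "H z = ennreal ((\<Sum>i<n. G i (fst z) * snd z i)\<^sup>2)" for z
  note fm[measurable] = measurable_form[OF f]
  have Gm[measurable]: "i < n \<Longrightarrow> G i \<in> borel_measurable (Rn n)" for i using measurable_form[OF G] .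
  have HG: "(\<lambda>z. \<Sum>i<n. G i (g z) * h z i) \<in> borel_measurable M"
    if g: "g \<in> measurable M (Rn n)" and h: "h \<in> measurable M (Rn n)" for g h and M :: "'z measure"
    by (intro borel_measurable_sum borel_measurable_times measurable_compose[OF g] measurable_compose[OF h]) auto
  have [measurable]: "H \<in> borel_measurable (Rn2 n)"
    unfolding H_def[abs_def] using HG[of fst "Rn2 n" snd] by measurable
  have f2: "integrable (gauss n) f" "integrable (gauss n) (\<lambda>x. (f x)\<^sup>2)"
    using integrable_gauss_form[OF f] integrable_gauss_form[OF forms_power[OF f]] by auto
  have pr: "gauss.prob n (space (Rn n)) = 1" using gauss.prob_space[of n] by simp
  have path: "ennreal ((f y - f x)\<^sup>2) \<le> ennreal (pi / 2) *
      (\<integral>\<^sup>+t. H (pair_rotation n (cos t) (sin t) (x, y)) * indicator {0..pi/2} t \<partial>lborel)" for x y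
  proof -
    define X where "X t = lin_comb n (cos t) x (sin t) y" for t
    define X' where "X' t = lin_comb n (- sin t) x (cos t) y" for t
    define q where "q t = f (X t)" for t
    define q' where "q' t = (\<Sum>i<n. G i (X t) * X' t i)" for t
    have "(q has_real_derivative q' t) (at t)" for t
      unfolding q_def q'_def
      by (rule is_gradientD[OF D]) (auto simp: X_def X'_def lin_comb_def intro!: derivative_eq_intros)
    moreover have "continuous_on UNIV q'"
    proof -
      have Xc: "continuous_on UNIV X"
        unfolding X_def lin_comb_def restrict_def
      proof (rule continuous_on_coordinatewise_then_product)
        fix i
        show "continuous_on UNIV (\<lambda>t. if i \<in> {..<n} then cos t * x i + sin t * y i else undefined)"
          by (cases "i < n") (auto intro!: continuous_intros)
      qed
      have "continuous_on UNIV (\<lambda>t. G i (X t))" if "i < n" for i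
        by (rule continuous_on_compose2[OF forms_continuous[OF G[OF that]] Xc]) auto
      moreover have "continuous_on UNIV (\<lambda>t. X' t i)" if "i < n" for i
        using that by (auto simp: X'_def lin_comb_def intro!: continuous_intros)
      ultimately show ?thesis unfolding q'_def by (intro continuous_on_sum continuous_on_mult) auto
    qed
    ultimately have "ennreal ((q (pi/2) - q 0)\<^sup>2) \<le> ennreal (pi/2 - 0) * (\<integral>\<^sup>+t. ennreal ((q' t)\<^sup>2) * indicator {0..pi/2} t \<partial>lborel)"
      by (intro square_increment_le_integral) auto
    moreover have "q (pi/2) = f y" "q 0 = f x"
      unfolding q_def by (auto intro!: forms_cong[OF f] simp: X_def lin_comb_def)
    ultimately show ?thesis
      by (simp add: q'_def X_def X'_def H_def pair_rotation_def)
  qed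
  have rot: "(\<lambda>w. pair_rotation n (cos (snd w)) (sin (snd w)) (fst w)) \<in> measurable (?P \<Otimes>\<^sub>M lborel) (Rn2 n)"
    unfolding pair_rotation_def by measurable
  interpret PL: pair_sigma_finite ?P "lborel :: real measure" ..
  have "(\<integral>\<^sup>+z. ennreal ((f (snd z) - f (fst z))\<^sup>2) \<partial>?P)
      \<le> (\<integral>\<^sup>+z. ennreal (pi / 2) * (\<integral>\<^sup>+t. H (pair_rotation n (cos t) (sin t) z) * indicator {0..pi/2} t \<partial>lborel) \<partial>?P)"
    by (intro nn_integral_mono) (use path in auto)
  also have "\<dots> = ennreal (pi / 2) * (\<integral>\<^sup>+z. (\<integral>\<^sup>+t. H (pair_rotation n (cos t) (sin t) z) * indicator {0..pi/2} t \<partial>lborel) \<partial>?P)"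
    using rot by (intro nn_integral_cmult lborel.borel_measurable_nn_integral) (simp add: case_prod_beta)
  also have "(\<integral>\<^sup>+z. (\<integral>\<^sup>+t. H (pair_rotation n (cos t) (sin t) z) * indicator {0..pi/2} t \<partial>lborel) \<partial>?P)
      = (\<integral>\<^sup>+t. (\<integral>\<^sup>+z. H (pair_rotation n (cos t) (sin t) z) * indicator {0..pi/2} t \<partial>?P) \<partial>lborel)"
    using rot by (intro PL.Fubini'[symmetric]) (simp add: case_prod_beta)
  also have "\<dots> = (\<integral>\<^sup>+t. (\<integral>\<^sup>+z. H z \<partial>?P) * indicator {0..pi/2} t \<partial>lborel)"
  proof (rule nn_integral_cong)
    fix t :: real
    show "(\<integral>\<^sup>+z. H (pair_rotation n (cos t) (sin t) z) * indicator {0..pi/2} t \<partial>?P) = (\<integral>\<^sup>+z. H z \<partial>?P) * indicator {0..pi/2} t"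
    proof (cases "t \<in> {0..pi/2}")
      case True
      then have "cos t \<ge> 0" by (intro cos_ge_zero) auto
      have "(\<integral>\<^sup>+z. H z \<partial>?P) = (\<integral>\<^sup>+z. H z \<partial>distr ?P (Rn2 n) (pair_rotation n (cos t) (sin t)))"
        using distr_gauss_pair_rotation[of "cos t" "sin t" n] \<open>cos t \<ge> 0\<close> by simp
      also have "\<dots> = (\<integral>\<^sup>+z. H (pair_rotation n (cos t) (sin t) z) \<partial>?P)"
        by (rule nn_integral_distr) measurable
      finally show ?thesis using True by simp
    qed simp
  qed
  also have "\<dots> = (\<integral>\<^sup>+z. H z \<partial>?P) * ennreal (pi / 2)"
    by (subst nn_integral_cmult_indicator) auto
  finally have upper: "(\<integral>\<^sup>+z. ennreal ((f (snd z) - f (fst z))\<^sup>2) \<partial>?P) \<le> ennreal (pi / 2) * ((\<integral>\<^sup>+z. H z \<partial>?P) * ennreal (pi / 2))" .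
  have "(\<integral>\<^sup>+z. H z \<partial>?P) = (\<integral>\<^sup>+x. \<integral>\<^sup>+y. H (x, y) \<partial>gauss n \<partial>gauss n)"
    by (rule gauss.nn_integral_fst[symmetric]) simp
  \<comment> \<open>For fixed x the integrand is the square of a linear form in y. The moment bound
    with p = 1 gives the factor 2e; the exact factor is 1, and the difference goes into the
    constant.\<close>
  also have "\<dots> \<le> (\<integral>\<^sup>+x. ennreal (2 * exp 1 * (\<Sum>i<n. (G i x)\<^sup>2)) \<partial>gauss n)"
  proof (rule nn_integral_mono)
    fix x
    show "(\<integral>\<^sup>+y. H (x, y) \<partial>gauss n) \<le> ennreal (2 * exp 1 * (\<Sum>i<n. (G i x)\<^sup>2))"
      using gauss_even_moment_le[of 1 n "\<lambda>i. G i x"] by (simp add: H_def fact_2 del: One_nat_def)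
  qed
  also have "\<dots> = ennreal (2 * exp 1 * (\<integral>x. (\<Sum>i<n. (G i x)\<^sup>2) \<partial>gauss n))"
  proof -
    have "integrable (gauss n) (\<lambda>x. \<Sum>i<n. (G i x)\<^sup>2)"
      by (intro integrable_gauss_form[where d = "e * 2"] forms_sum forms_power G) auto
    then show ?thesis
      by (subst nn_integral_eq_integral) (auto simp: sum_nonneg)
  qed
  finally have Hle: "(\<integral>\<^sup>+z. H z \<partial>?P) \<le> ennreal (2 * exp 1 * (\<integral>x. (\<Sum>i<n. (G i x)\<^sup>2) \<partial>gauss n))" .
  \<comment> \<open>By independence and mean zero the squared difference integrates to twice the
    second moment, so the final constant is (1/2) (pi/2)^2 2e.\<close>
  have "(\<integral>\<^sup>+z. ennreal ((f (snd z) - f (fst z))\<^sup>2) \<partial>?P) = (\<integral>\<^sup>+x. \<integral>\<^sup>+y. ennreal ((f y - f x)\<^sup>2) \<partial>gauss n \<partial>gauss n)"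
    by (subst gauss.nn_integral_fst[symmetric]) auto
  also have "\<dots> = (\<integral>\<^sup>+x. ennreal ((\<integral>y. (f y)\<^sup>2 \<partial>gauss n) + (f x)\<^sup>2) \<partial>gauss n)"
  proof (rule nn_integral_cong)
    fix x
    have "(\<integral>\<^sup>+y. ennreal ((f y - f x)\<^sup>2) \<partial>gauss n) = ennreal (\<integral>y. (f y - f x)\<^sup>2 \<partial>gauss n)"
    proof (rule nn_integral_eq_integral)
      show "integrable (gauss n) (\<lambda>y. (f y - f x)\<^sup>2)" using f2 by (simp add: power2_diff)
    qed simp
    also have "(\<integral>y. (f y - f x)\<^sup>2 \<partial>gauss n) = (\<integral>y. (f y)\<^sup>2 \<partial>gauss n) + (f x)\<^sup>2"
      using f2 mean pr by (simp add: power2_diff)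
    finally show "(\<integral>\<^sup>+y. ennreal ((f y - f x)\<^sup>2) \<partial>gauss n) = ennreal ((\<integral>y. (f y)\<^sup>2 \<partial>gauss n) + (f x)\<^sup>2)" .
  qed
  also have "\<dots> = ennreal (\<integral>x. ((\<integral>y. (f y)\<^sup>2 \<partial>gauss n) + (f x)\<^sup>2) \<partial>gauss n)"
    using f2 by (intro nn_integral_eq_integral) (auto intro!: add_nonneg_nonneg)
  also have "(\<integral>x. ((\<integral>y. (f y)\<^sup>2 \<partial>gauss n) + (f x)\<^sup>2) \<partial>gauss n) = 2 * (\<integral>y. (f y)\<^sup>2 \<partial>gauss n)"
    using f2 pr by simp
  finally have lower: "(\<integral>\<^sup>+z. ennreal ((f (snd z) - f (fst z))\<^sup>2) \<partial>?P) = ennreal (2 * (\<integral>y. (f y)\<^sup>2 \<partial>gauss n))" .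
  define Q where "Q = (\<integral>x. (\<Sum>i<n. (G i x)\<^sup>2) \<partial>gauss n)"
  have Q: "Q \<ge> 0" unfolding Q_def by (intro integral_nonneg_AE) (simp add: sum_nonneg)
  have "ennreal (2 * (\<integral>y. (f y)\<^sup>2 \<partial>gauss n)) \<le> ennreal (pi / 2) * (ennreal (2 * exp 1 * Q) * ennreal (pi / 2))"
    unfolding lower[symmetric] Q_def
    by (rule order_trans[OF upper]) (intro mult_left_mono mult_right_mono Hle, auto)
  also have "\<dots> = ennreal (pi / 2 * ((2 * exp 1 * Q) * (pi / 2)))"
  proof -
    have "ennreal a * (ennreal q * ennreal a) = ennreal (a * (q * a))" if "0 \<le> a" "0 \<le> q" for a q
      using that by (simp add: ennreal_mult)
    then show ?thesis using Q by simp
  qed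
  finally have "2 * (\<integral>y. (f y)\<^sup>2 \<partial>gauss n) \<le> pi / 2 * ((2 * exp 1 * Q) * (pi / 2))"
    using Q by (subst (asm) ennreal_le_iff) auto
  then have "(\<integral>y. (f y)\<^sup>2 \<partial>gauss n) \<le> pi\<^sup>2 * exp 1 / 4 * Q"
    by (simp add: power2_eq_square[of pi] mult_ac)
  then show ?thesis unfolding Q_def .
qed


section \<open>Forms of mean zero\<close>

lemma mean_zero_forms_subspace:
  assumes n: "n \<ge> 1"
  shows "form.subspace (mean_zero_forms n d)"
proof (rule form.subspaceI)
  show "0 \<in> mean_zero_forms n d"
    by (simp add: mean_zero_forms_def form.subspace_0[OF forms_subspace]) (simp add: zero_fun_def)
  fix f g assume "f \<in> mean_zero_forms n d" "g \<in> mean_zero_forms n d"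
  then show "f + g \<in> mean_zero_forms n d"
    using integrable_form[OF n, of f d] integrable_form[OF n, of g d] form.subspace_add[OF forms_subspace, of f n d g]
    by (auto simp: mean_zero_forms_def plus_fun_def)
next
  fix c f assume "f \<in> mean_zero_forms n d"
  then show "scale_form c f \<in> mean_zero_forms n d"
    by (auto simp: mean_zero_forms_def form.subspace_scale[OF forms_subspace]) (simp add: scale_form_def)
qed

lemma mean_zero_forms_subset: "mean_zero_forms n d \<subseteq> forms n d"
  by (auto simp: mean_zero_forms_def)

lemma mean_zero_forms_rotate:
  assumes "orthogonal_coeffs n U" "f \<in> mean_zero_forms n d"
  shows "(\<lambda>x. f (linear_map n U x)) \<in> mean_zero_forms n d"
  using assms integral_form_rotate[OF assms(1), of f d] forms_linear_map[of f n d U]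
  by (auto simp: mean_zero_forms_def)

text \<open>The difference of a coordinate power and its image under a reflection exchanging two
  basis vectors has mean zero but takes the value -1. Positive dimension gives the exponent 1/D its
  meaning.\<close>

lemma dim_mean_zero_forms_pos:
  assumes n: "n \<ge> 2" and k: "k \<ge> 1"
  shows "form.dim (mean_zero_forms n (2 * k)) \<ge> 1"
proof (rule ccontr)
  let ?M = "mean_zero_forms n (2 * k)"
  assume "\<not> form.dim ?M \<ge> 1"
  then have D: "form.dim ?M = 0" by simp
  obtain b where b: "orthonormal_basis n ?M b"
    using orthonormal_basis_exists[OF _ mean_zero_forms_subspace mean_zero_forms_subset] n by fastforce
  have zero: "f = 0" if "f \<in> ?M" for f
    using orthonormal_basis_expand[OF _ mean_zero_forms_subset b that] n D by simp
  define e where "e = (\<lambda>i j :: nat. if j = i then 1 else 0 :: real)"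
  define p where "p i = (\<lambda>x :: nat \<Rightarrow> real. x i ^ (2 * k))" for i
  have pF: "p i \<in> forms n (2 * k)" if "i < n" for i
    using forms_power[OF forms_coord[OF that], of "2 * k"] by (simp add: p_def)
  have e1: "L2_set (e i) {..<n} = 1" if "i < n" for i
    using that by (simp add: e_def L2_set_def if_distrib[of "\<lambda>x. x\<^sup>2"] cong: if_cong)
  obtain U where U: "orthogonal_coeffs n U" "\<forall>i<n. linear_map n U (e 0) i = e 1 i"
    using reflection_exists[OF e1 e1, of 0 1] n by auto
  define f where "f = (\<lambda>x. p 1 x + (-1) * p 1 (linear_map n U x))"
  have "f \<in> forms n (2 * k)"
    unfolding f_def using n by (intro forms_add forms_cmult forms_linear_map pF) auto
  moreover have "(\<integral>x. f x \<partial>sphere_measure n) = 0"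
    unfolding f_def using n integral_form_rotate[OF U(1) pF, of 1]
      integrable_form[OF _ pF, of 1] integrable_form[OF _ forms_linear_map[OF pF], of 1 U] by simp
  ultimately have "f = 0" by (intro zero) (simp add: mean_zero_forms_def)
  then have "f (e 0) = 0" by simp
  moreover have "f (e 0) = -1"
    using U(2) n k by (simp add: f_def p_def e_def power_0_left)
  ultimately show False by simp
qed

text \<open>Let R be the Gaussian mean of |x|^(4k). By homogeneity the Gaussian second moment of f
  is R times its squared L2 norm on the sphere, while the gradient bound and the Poincare inequality
  bound it by a constant times R/n; R cancels. Neither estimate loses a factor depending on
  n.\<close>

lemma sup_bounded_form_inner_le:
  assumes k: "k \<ge> 1"
  shows "\<exists>C>0. \<forall>n\<ge>1. \<forall>f\<in>mean_zero_forms n (2 * k).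
    (\<forall>v. L2_set v {..<n} = 1 \<longrightarrow> \<bar>f v\<bar> \<le> 1) \<longrightarrow> form_inner n f f \<le> C / real n"
proof -
  obtain A where A: "A > 0" "\<And>n f G x s. f \<in> forms n (2 * k) \<Longrightarrow>
    (\<And>v. L2_set v {..<n} = 1 \<Longrightarrow> \<bar>f v\<bar> \<le> 1) \<Longrightarrow>
    is_gradient n f G \<Longrightarrow> s > 0 \<Longrightarrow> s * L2_set (\<lambda>i. G i x) {..<n} \<le> A * (L2_set x {..<n} + s) ^ (2 * k)"
    using form_gradient_bound[of "2 * k"] k by auto
  define C where "C = pi\<^sup>2 * exp 1 / 4 * (A\<^sup>2 * 2 ^ (4 * k) * 2)"
  have "form_inner n f f \<le> C / real n"
    if n: "n \<ge> 1" and f: "f \<in> mean_zero_forms n (2 * k)" and bd: "\<And>v. L2_set v {..<n} = 1 \<Longrightarrow> \<bar>f v\<bar> \<le> 1"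
    for n f
  proof -
    have fF: "f \<in> forms n (2 * k)" and f0: "(\<integral>x. f x \<partial>sphere_measure n) = 0"
      using f by (auto simp: mean_zero_forms_def)
    obtain G where G: "\<And>i. i < n \<Longrightarrow> G i \<in> forms n (2 * k - 1)" and D: "is_gradient n f G"
      using form_gradient_exists[OF fF] by blast
    define R where "R = (\<integral>x. radial_form n (2 * k) x \<partial>gauss n)"
    have R: "real n ^ (2 * k) \<le> R" unfolding R_def by (rule gauss_integral_radial_ge)
    have Rpos: "R > 0" using R n by (smt (verit) of_nat_0_less_iff zero_less_power less_le_trans zero_less_one order_less_le_trans)
    have g2: "integrable (gauss n) (\<lambda>x. \<Sum>i<n. (G i x)\<^sup>2)"
      by (intro integrable_gauss_form[where d = "(2 * k - 1) * 2"] forms_sum forms_power G) auto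
    have pt: "real n * (\<Sum>i<n. (G i x)\<^sup>2) \<le> A\<^sup>2 * 2 ^ (4 * k) * (radial_form n (2 * k) x + real n ^ (2 * k))" for x
    proof -
      define r where "r = L2_set x {..<n}"
      \<comment> \<open>The order of the typical Gaussian radius: the mean of (r + s)^(4k) is then
        still of order R, while s^2 on the left supplies the gain n.\<close>
      define s where "s = sqrt (real n)"
      have rs: "r \<ge> 0" "s > 0" using n by (auto simp: r_def s_def L2_set_nonneg)
      have "s * L2_set (\<lambda>i. G i x) {..<n} \<le> A * (r + s) ^ (2 * k)"
        unfolding r_def by (rule A(2)[OF fF bd D rs(2)])
      then have "(s * L2_set (\<lambda>i. G i x) {..<n})\<^sup>2 \<le> (A * (r + s) ^ (2 * k))\<^sup>2"
        using rs by (intro power_mono) (auto simp: L2_set_nonneg)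
      moreover have "(s * L2_set (\<lambda>i. G i x) {..<n})\<^sup>2 = real n * (\<Sum>i<n. (G i x)\<^sup>2)"
        by (simp add: s_def L2_set_def power_mult_distrib sum_nonneg)
      moreover have "(A * (r + s) ^ (2 * k))\<^sup>2 = A\<^sup>2 * (r + s) ^ (4 * k)"
        by (simp add: power_mult_distrib flip: power_mult)
      moreover have "(r + s) ^ (4 * k) \<le> 2 ^ (4 * k) * (r ^ (4 * k) + s ^ (4 * k))"
      proof -
        have "(r + s) ^ (4 * k) \<le> (2 * max r s) ^ (4 * k)" using rs by (intro power_mono) auto
        also have "\<dots> = 2 ^ (4 * k) * max r s ^ (4 * k)" by (simp add: power_mult_distrib)
        also have "max r s ^ (4 * k) \<le> r ^ (4 * k) + s ^ (4 * k)" using rs by (simp add: max_def)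
        finally show ?thesis by simp
      qed
      moreover have "r ^ (4 * k) = radial_form n (2 * k) x"
        by (simp add: r_def radial_form_eq)
      moreover have "s ^ (4 * k) = real n ^ (2 * k)"
      proof -
        have "s ^ (4 * k) = (s\<^sup>2) ^ (2 * k)" by (simp flip: power_mult)
        then show ?thesis by (simp add: s_def)
      qed
      ultimately show ?thesis
        using mult_left_mono[of "(r + s) ^ (4 * k)" "2 ^ (4 * k) * (r ^ (4 * k) + s ^ (4 * k))" "A\<^sup>2"]
        by (simp add: mult.assoc)
    qed
    have "real n * (\<integral>x. (\<Sum>i<n. (G i x)\<^sup>2) \<partial>gauss n) = (\<integral>x. real n * (\<Sum>i<n. (G i x)\<^sup>2) \<partial>gauss n)"
      by simp
    also have "\<dots> \<le> (\<integral>x. A\<^sup>2 * 2 ^ (4 * k) * (radial_form n (2 * k) x + real n ^ (2 * k)) \<partial>gauss n)"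
      by (intro integral_mono pt integrable_mult_right g2 Bochner_Integration.integrable_add
          integrable_gauss_form[OF radial_form_in_forms]) auto
    also have "\<dots> = A\<^sup>2 * 2 ^ (4 * k) * (R + real n ^ (2 * k))"
    proof -
      have "gauss.prob n (space (Rn n)) = 1" using gauss.prob_space[of n] by simp
      then show ?thesis using integrable_gauss_form[OF radial_form_in_forms[of n "2 * k"]] by (simp add: R_def)
    qed
    also have "\<dots> \<le> A\<^sup>2 * 2 ^ (4 * k) * (2 * R)" using R by (intro mult_left_mono) auto
    finally have grad: "(\<integral>x. (\<Sum>i<n. (G i x)\<^sup>2) \<partial>gauss n) \<le> A\<^sup>2 * 2 ^ (4 * k) * (2 * R) / real n"
      using n by (simp add: field_simps)
    have "(\<integral>x. f x \<partial>gauss n) = 0"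
      using gauss_integral_form_radial[OF n fF] f0 by simp
    then have "(\<integral>x. (f x)\<^sup>2 \<partial>gauss n) \<le> pi\<^sup>2 * exp 1 / 4 * (\<integral>x. (\<Sum>i<n. (G i x)\<^sup>2) \<partial>gauss n)"
      by (intro gauss_poincare[OF fF G D])
    also have "\<dots> \<le> pi\<^sup>2 * exp 1 / 4 * (A\<^sup>2 * 2 ^ (4 * k) * (2 * R) / real n)"
      by (intro mult_left_mono grad) auto
    finally have "(\<integral>x. (f x)\<^sup>2 \<partial>gauss n) \<le> R * (C / real n)" by (simp add: C_def mult_ac)
    moreover have "(\<integral>x. (f x)\<^sup>2 \<partial>gauss n) = R * form_inner n f f"
      using gauss_integral_form_radial[OF n, of "\<lambda>x. (f x)\<^sup>2" "2 * k"] forms_power[OF fF, of 2]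
      by (simp add: R_def form_inner_def power2_eq_square mult.commute)
    ultimately have "R * form_inner n f f \<le> R * (C / real n)" by simp
    then show ?thesis using mult_le_cancel_left_pos[OF Rpos] by blast
  qed
  moreover have "C > 0" using A by (simp add: C_def)
  ultimately show ?thesis by blast
qed


section \<open>Symmetric sections of convex sets\<close>

lemma nn_integral_Rn_scale:
  assumes "t > 0" "f \<in> borel_measurable (Rn n)"
  shows "(\<integral>\<^sup>+x. f x \<partial>Rn n) = ennreal (t ^ n) * (\<integral>\<^sup>+x. f (\<lambda>i\<in>{..<n}. t * x i) \<partial>Rn n)"
  using assms(2)
proof (induction n arbitrary: f)
  case 0
  have R: "(\<lambda>i\<in>{..<0::nat}. t * undefined) = (\<lambda>_. undefined)"
    by (simp add: fun_eq_iff)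
  show ?case by (simp only: nn_integral_Rn_0 R power_0 ennreal_1 mult_1)
next
  case (Suc n)
  let ?S = "\<lambda>m x. \<lambda>i\<in>{..<m}. t * x i :: real"
  have S: "?S m \<in> measurable (Rn m) (Rn m)" for m
    by (intro measurable_into_Rn) measurable
  have comp: "?S (Suc n) (x(n := s)) = (?S n x)(n := t * s)" for x s
    by (auto simp: fun_eq_iff)
  have "(\<integral>\<^sup>+x. f x \<partial>Rn (Suc n)) = (\<integral>\<^sup>+s. (\<integral>\<^sup>+x. f (x(n := s)) \<partial>Rn n) \<partial>lborel)"
    by (rule nn_integral_Rn_Suc[OF Suc.prems])
  also have "\<dots> = ennreal t * (\<integral>\<^sup>+s. (\<integral>\<^sup>+x. f (x(n := t * s)) \<partial>Rn n) \<partial>lborel)"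
    using nn_integral_real_affine[OF measurable_Rn_Suc_integral[OF Suc.prems], of t 0] assms(1)
    by (simp del: fun_upd_apply)
  also have "(\<integral>\<^sup>+s. (\<integral>\<^sup>+x. f (x(n := t * s)) \<partial>Rn n) \<partial>lborel)
      = (\<integral>\<^sup>+s. ennreal (t ^ n) * (\<integral>\<^sup>+x. f (?S (Suc n) (x(n := s))) \<partial>Rn n) \<partial>lborel)"
    unfolding comp by (intro nn_integral_cong Suc.IH measurable_Rn_Suc_section Suc.prems)
  also have "\<dots> = ennreal (t ^ n) * (\<integral>\<^sup>+s. (\<integral>\<^sup>+x. f (?S (Suc n) (x(n := s))) \<partial>Rn n) \<partial>lborel)"
    using measurable_Rn_Suc_integral[OF measurable_compose[OF S Suc.prems]]
    by (intro nn_integral_cmult) (subst measurable_cong_sets[OF sets_lborel refl])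
  also have "(\<integral>\<^sup>+s. (\<integral>\<^sup>+x. f (?S (Suc n) (x(n := s))) \<partial>Rn n) \<partial>lborel) = (\<integral>\<^sup>+x. f (?S (Suc n) x) \<partial>Rn (Suc n))"
    by (rule nn_integral_Rn_Suc[symmetric]) (rule measurable_compose[OF S Suc.prems])
  moreover have "ennreal (t ^ Suc n) = ennreal t * ennreal (t ^ n)"
    using assms(1) by (simp add: ennreal_mult)
  ultimately show ?case by (simp only: mult.assoc)
qed

lemma emeasure_Rn_scale:
  assumes t: "t > 0" and A[measurable]: "A \<in> sets (Rn n)"
  shows "emeasure (Rn n) {x \<in> space (Rn n). (\<lambda>i\<in>{..<n}. x i / t) \<in> A} = ennreal (t ^ n) * emeasure (Rn n) A"
proof -
  let ?S = "\<lambda>x. \<lambda>i\<in>{..<n}. x i / t :: real"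
  have S[measurable]: "?S \<in> measurable (Rn n) (Rn n)" by (intro measurable_into_Rn) measurable
  have "emeasure (Rn n) {x \<in> space (Rn n). ?S x \<in> A} = (\<integral>\<^sup>+x. indicator {x \<in> space (Rn n). ?S x \<in> A} x \<partial>Rn n)"
    by (rule nn_integral_indicator[symmetric]) measurable
  also have "\<dots> = (\<integral>\<^sup>+x. indicator A (?S x) \<partial>Rn n)"
    by (intro nn_integral_cong) (auto simp: indicator_def)
  also have "\<dots> = ennreal (t ^ n) * (\<integral>\<^sup>+x. indicator A (?S (\<lambda>i\<in>{..<n}. t * x i)) \<partial>Rn n)"
    by (rule nn_integral_Rn_scale[OF t]) measurable
  also have "(\<integral>\<^sup>+x. indicator A (?S (\<lambda>i\<in>{..<n}. t * x i)) \<partial>Rn n) = (\<integral>\<^sup>+x. indicator A x \<partial>Rn n)"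
  proof (intro nn_integral_cong)
    fix x assume "x \<in> space (Rn n)"
    then have "?S (\<lambda>i\<in>{..<n}. t * x i) = x"
      using t by (auto simp: space_Rn PiE_iff extensional_def fun_eq_iff)
    then show "indicator A (?S (\<lambda>i\<in>{..<n}. t * x i)) = (indicator A x :: ennreal)" by simp
  qed
  finally show ?thesis unfolding nn_integral_indicator[OF A] .
qed

lemma L2_set_divide:
  assumes "t > 0"
  shows "L2_set (\<lambda>i\<in>{..<n}. x i / t) {..<n} = L2_set x {..<n} / t"
proof -
  have "L2_set (\<lambda>i\<in>{..<n}. x i / t) {..<n} = L2_set (\<lambda>i. inverse t * x i) {..<n}"
    by (intro L2_set_cong) (auto simp: field_simps)
  also have "\<dots> = inverse t * L2_set x {..<n}"
    using assms by (intro L2_set_right_distrib[symmetric]) simp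
  finally show ?thesis by (simp add: field_simps)
qed

lemma emeasure_Rn_ball:
  assumes t: "t > 0"
  shows "emeasure (Rn n) {x \<in> space (Rn n). L2_set x {..<n} \<le> t} = ennreal (t ^ n) * emeasure (Rn n) (unit_ball n)"
proof -
  have "{x \<in> space (Rn n). L2_set x {..<n} \<le> t} = {x \<in> space (Rn n). (\<lambda>i\<in>{..<n}. x i / t) \<in> unit_ball n}"
    using t by (auto simp: unit_ball_def L2_set_divide space_Rn)
  then show ?thesis using emeasure_Rn_scale[OF t unit_ball_sets] by simp
qed

lemma emeasure_Rn_ball_finite:
  assumes "t > 0"
  shows "emeasure (Rn n) {x \<in> space (Rn n). L2_set x {..<n} \<le> t} < \<infinity>"
  unfolding emeasure_Rn_ball[OF assms] using unit_ball_finite[of n] by (simp add: ennreal_mult_less_top)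

text \<open>This is (K - u) \<inter> (u - K): the largest subset of K symmetric about u, translated
  to the origin.\<close>

definition fibre :: "nat \<Rightarrow> (nat \<Rightarrow> real) set \<Rightarrow> (nat \<Rightarrow> real) \<Rightarrow> (nat \<Rightarrow> real) set" where
  "fibre n K u = {w \<in> space (Rn n). lin_comb n 1 u 1 w \<in> K \<and> lin_comb n 1 u (-1) w \<in> K}"

text \<open>Change of variables \<open>(x, y) = (u + w, u - w)\<close>.\<close>

lemma emeasure_square_eq_midpoint_integral:
  assumes K[measurable]: "K \<in> sets (Rn n)"
  shows "emeasure (Rn n) K * emeasure (Rn n) K = ennreal (2 ^ n) *
    (\<integral>\<^sup>+u. emeasure (Rn n) (fibre n K u) \<partial>Rn n)"
proof -
  let ?I = "indicator K :: _ \<Rightarrow> ennreal"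
  have m: "(\<lambda>(x, u). ?I x * ?I (lin_comb n 2 u (-1) x)) \<in> borel_measurable (Rn2 n)" by measurable
  have "emeasure (Rn n) K * emeasure (Rn n) K = (\<integral>\<^sup>+x. ?I x * (\<integral>\<^sup>+y. ?I y \<partial>Rn n) \<partial>Rn n)"
    by (simp add: nn_integral_multc)
  \<comment> \<open>For fixed x substitute y = 2u - x: a translation followed by a dilation by 2,
    whence the Jacobian. Setting x = u + w afterwards costs nothing.\<close>
  also have "\<dots> = (\<integral>\<^sup>+x. ennreal (2 ^ n) * (\<integral>\<^sup>+u. ?I x * ?I (lin_comb n 2 u (-1) x) \<partial>Rn n) \<partial>Rn n)"
  proof (rule nn_integral_cong)
    fix x assume [measurable]: "x \<in> space (Rn n)"
    let ?f = "\<lambda>y. ?I (\<lambda>i\<in>{..<n}. - x i + 1 * y i)"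
    have f[measurable]: "?f \<in> borel_measurable (Rn n)"
      by (intro measurable_compose[OF measurable_into_Rn]) measurable
    have "(\<integral>\<^sup>+y. ?I y \<partial>Rn n) = (\<integral>\<^sup>+y. ?f y \<partial>Rn n)"
      by (rule nn_integral_Rn_affine[symmetric]) auto
    also have "\<dots> = ennreal (2 ^ n) * (\<integral>\<^sup>+u. ?f (\<lambda>i\<in>{..<n}. 2 * u i) \<partial>Rn n)"
      by (rule nn_integral_Rn_scale) auto
    also have "(\<lambda>u. ?f (\<lambda>i\<in>{..<n}. 2 * u i)) = (\<lambda>u. ?I (lin_comb n 2 u (-1) x))"
      by (intro ext arg_cong[of _ _ ?I]) (auto simp: lin_comb_def)
    finally show "?I x * (\<integral>\<^sup>+y. ?I y \<partial>Rn n) = ennreal (2 ^ n) * (\<integral>\<^sup>+u. ?I x * ?I (lin_comb n 2 u (-1) x) \<partial>Rn n)"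
      by (simp add: nn_integral_cmult mult_ac)
  qed
  also have "\<dots> = ennreal (2 ^ n) * (\<integral>\<^sup>+x. (\<integral>\<^sup>+u. ?I x * ?I (lin_comb n 2 u (-1) x) \<partial>Rn n) \<partial>Rn n)"
    using m by (intro nn_integral_cmult Rn_sigma.borel_measurable_nn_integral) simp
  also have "(\<integral>\<^sup>+x. (\<integral>\<^sup>+u. ?I x * ?I (lin_comb n 2 u (-1) x) \<partial>Rn n) \<partial>Rn n)
      = (\<integral>\<^sup>+u. (\<integral>\<^sup>+x. ?I x * ?I (lin_comb n 2 u (-1) x) \<partial>Rn n) \<partial>Rn n)"
    using m by (intro Rn_pair.Fubini'[symmetric]) simp
  also have "\<dots> = (\<integral>\<^sup>+u. emeasure (Rn n) (fibre n K u) \<partial>Rn n)"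
  proof (rule nn_integral_cong)
    fix u assume [measurable]: "u \<in> space (Rn n)"
    let ?f = "\<lambda>x. ?I x * ?I (lin_comb n 2 u (-1) x)"
    have "(\<integral>\<^sup>+x. ?f x \<partial>Rn n) = (\<integral>\<^sup>+w. ?f (\<lambda>i\<in>{..<n}. u i + 1 * w i) \<partial>Rn n)"
      by (rule nn_integral_Rn_affine[symmetric]) auto
    also have "\<dots> = (\<integral>\<^sup>+w. indicator (fibre n K u) w \<partial>Rn n)"
    proof (rule nn_integral_cong)
      fix w assume w: "w \<in> space (Rn n)"
      have "(\<lambda>i\<in>{..<n}. u i + 1 * w i) = lin_comb n 1 u 1 w" by (auto simp: lin_comb_def)
      moreover have "lin_comb n 2 u (-1) (lin_comb n 1 u 1 w) = lin_comb n 1 u (-1) w" by (auto simp: lin_comb_def)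
      ultimately show "?f (\<lambda>i\<in>{..<n}. u i + 1 * w i)
        = indicator (fibre n K u) w"
        using w by (auto simp: indicator_def fibre_def)
    qed
    also have "\<dots> = emeasure (Rn n) (fibre n K u)"
      unfolding fibre_def by (rule nn_integral_indicator) measurable
    finally show "(\<integral>\<^sup>+x. ?f x \<partial>Rn n) = emeasure (Rn n) (fibre n K u)" .
  qed
  finally show ?thesis .
qed

text \<open>If all fibres over K were too small, integrating them over K would give |K|^2 \<le> 2^n
  4^(-n) |K|^2, impossible for positive finite measure and n \<ge> 1. Asking for 4^(-n) instead of
  the average 2^(-n) leaves a strict gap, so no extremal fibre has to be found.\<close>

lemma symmetric_section_large:
  assumes n: "n \<ge> 1" and K[measurable]: "K \<in> sets (Rn n)"
    and fin: "emeasure (Rn n) K < \<infinity>" and pos: "emeasure (Rn n) K > 0"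
    and mid: "\<And>x y. x \<in> K \<Longrightarrow> y \<in> K \<Longrightarrow> midpoint_fun n x y \<in> K"
  shows "\<exists>u\<in>K. emeasure (Rn n) K \<le> ennreal (4 ^ n) *
    emeasure (Rn n) (fibre n K u)"
proof (rule ccontr)
  let ?V = "emeasure (Rn n) K"
  define g where "g u = emeasure (Rn n) (fibre n K u)" for u
  assume "\<not> ?thesis"
  then have small: "ennreal (4 ^ n) * g u \<le> ?V" if "u \<in> K" for u
    using that by (auto simp: g_def not_le intro: less_imp_le)
  \<comment> \<open>By midpoint convexity a nonempty fibre puts u into K, so the integral over all u
    is one over K.\<close>
  have out: "g u = 0" if u: "u \<in> space (Rn n)" "u \<notin> K" for u
  proof -
    have "midpoint_fun n (lin_comb n 1 u 1 w) (lin_comb n 1 u (-1) w) = u" for w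
      using u(1) by (auto simp: midpoint_fun_def lin_comb_def space_Rn PiE_iff extensional_def fun_eq_iff)
    then have "fibre n K u = {}"
      using mid u(2) unfolding fibre_def by (metis (mono_tags, lifting) Collect_empty_eq)
    then show ?thesis unfolding g_def by (simp only: emeasure_empty)
  qed
  have gm: "g \<in> borel_measurable (Rn n)"
  proof -
    have "g u = (\<integral>\<^sup>+w. indicator K (lin_comb n 1 u 1 w) * indicator K (lin_comb n 1 u (-1) w) \<partial>Rn n)"
      if [measurable]: "u \<in> space (Rn n)" for u
    proof -
      have "g u = (\<integral>\<^sup>+w. indicator (fibre n K u) w \<partial>Rn n)"
        unfolding g_def fibre_def by (rule nn_integral_indicator[symmetric]) measurable
      also have "\<dots> = (\<integral>\<^sup>+w. indicator K (lin_comb n 1 u 1 w) * indicator K (lin_comb n 1 u (-1) w) \<partial>Rn n)"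
        by (intro nn_integral_cong) (auto simp: indicator_def fibre_def)
      finally show ?thesis .
    qed
    moreover have "(\<lambda>u. \<integral>\<^sup>+w. indicator K (lin_comb n 1 u 1 w) * indicator K (lin_comb n 1 u (-1) w) \<partial>Rn n) \<in> borel_measurable (Rn n)"
      by (rule Rn_sigma.borel_measurable_nn_integral) measurable
    ultimately show ?thesis by (subst measurable_cong) auto
  qed
  have "ennreal (4 ^ n) * (?V * ?V) = ennreal (2 ^ n) * (\<integral>\<^sup>+u. ennreal (4 ^ n) * g u \<partial>Rn n)"
    unfolding emeasure_square_eq_midpoint_integral[OF K] g_def[symmetric]
    by (subst nn_integral_cmult[OF gm]) (simp add: mult_ac)
  also have "(\<integral>\<^sup>+u. ennreal (4 ^ n) * g u \<partial>Rn n) \<le> (\<integral>\<^sup>+u. ?V * indicator K u \<partial>Rn n)"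
    by (intro nn_integral_mono) (use small out in \<open>auto simp: indicator_def\<close>)
  also have "\<dots> = ?V * ?V" by (simp add: nn_integral_cmult_indicator)
  finally have "ennreal (4 ^ n) * (?V * ?V) \<le> ennreal (2 ^ n) * (?V * ?V)" by (simp add: mult_left_mono)
  moreover obtain v where v: "?V = ennreal v" "v > 0"
    using fin pos by (cases ?V) auto
  ultimately have "ennreal (4 ^ n * (v * v)) \<le> ennreal (2 ^ n * (v * v))"
    by (simp add: ennreal_mult)
  then have "(4::real) ^ n * (v * v) \<le> 2 ^ n * (v * v)"
    using v by (subst (asm) ennreal_le_iff) auto
  then have "(4::real) ^ n \<le> 2 ^ n" using v by simp
  moreover have "(2::real) ^ n < 4 ^ n" using n by (intro power_strict_mono) auto
  ultimately show False by simp
qed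


section \<open>The section in coordinates\<close>

text \<open>Homogeneity moves the condition to the sphere, where \<open>radial_form\<close> is 1.
  The points v there may be arbitrary from n on, since forms ignore those values.\<close>

lemma nonneg_section_iff:
  assumes k: "k \<ge> 1"
  shows "f \<in> nonneg_section n k \<longleftrightarrow>
    f \<in> mean_zero_forms n (2 * k) \<and> (\<forall>v. L2_set v {..<n} = 1 \<longrightarrow> f v \<ge> -1)"
proof (intro iffI conjI allI impI)
  assume f: "f \<in> nonneg_section n k"
  then show fM: "f \<in> mean_zero_forms n (2 * k)" by (simp add: nonneg_section_def)
  fix v assume v: "L2_set v {..<n} = 1"
  let ?r = "restrict v {..<n}"
  have fF: "f + radial_form n k \<in> forms n (2 * k)"
    using f by (auto simp: nonneg_section_def nonneg_forms_def)
  have "0 \<le> (f + radial_form n k) ?r"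
    using f by (auto simp: nonneg_section_def nonneg_forms_def space_Rn)
  also have "(f + radial_form n k) ?r = (f + radial_form n k) v"
    by (rule forms_cong[OF fF]) auto
  also have "\<dots> = f v + 1" using v by (simp add: radial_form_eq)
  finally show "f v \<ge> -1" by simp
next
  assume "f \<in> mean_zero_forms n (2 * k) \<and> (\<forall>v. L2_set v {..<n} = 1 \<longrightarrow> f v \<ge> -1)"
  then have fM: "f \<in> mean_zero_forms n (2 * k)" and ge: "\<And>v. L2_set v {..<n} = 1 \<Longrightarrow> f v \<ge> -1" by auto
  have fF: "f \<in> forms n (2 * k)" using fM mean_zero_forms_subset by blast
  have "0 \<le> (f + radial_form n k) x" for x
    using form_bound[OF forms_cmult[OF fF, of "-1"], of 1 x] ge k
    by (fastforce simp: radial_form_eq)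
  then show "f \<in> nonneg_section n k"
    using fM form.subspace_add[OF forms_subspace fF radial_form_in_forms]
    by (simp add: nonneg_section_def nonneg_forms_def)
qed

text \<open>From f \<ge> -1 comes |f| \<le> f + 2, and f + 2 has mean 2. With the kernel bound s =
  sqrt (D N) on the sup norm this gives N \<le> 2 s, hence N \<le> 4 D. The crude bound serves to
  make volumes finite.\<close>

lemma nonneg_section_inner_le:
  assumes n: "n \<ge> 1" and k: "k \<ge> 1" and f: "f \<in> nonneg_section n k"
  shows "form_inner n f f \<le> 4 * real (form.dim (mean_zero_forms n (2 * k)))"
proof -
  let ?D = "real (form.dim (mean_zero_forms n (2 * k)))"
  have fM: "f \<in> mean_zero_forms n (2 * k)" and ge: "\<And>v. L2_set v {..<n} = 1 \<Longrightarrow> f v \<ge> -1"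
    using f nonneg_section_iff[OF k] by auto
  have fF: "f \<in> forms n (2 * k)" and f0: "(\<integral>x. f x \<partial>sphere_measure n) = 0"
    using fM by (auto simp: mean_zero_forms_def)
  interpret prob_space "sphere_measure n" by (rule prob_space_sphere_measure)
  have pr: "prob (space (Rn n)) = 1" using prob_space by simp
  define N where "N = form_inner n f f"
  define s where "s = sqrt (?D * N)"
  have N: "N \<ge> 0" unfolding N_def by (rule form_inner_nonneg)
  have s: "s \<ge> 0" using N by (simp add: s_def)
  have sup: "\<bar>f v\<bar> \<le> s" if "L2_set v {..<n} = 1" for v
    using form_square_le_dim[OF n mean_zero_forms_subspace[OF n] mean_zero_forms_subset mean_zero_forms_rotate that fM]
    unfolding s_def N_def by (simp add: real_le_rsqrt)
  have fi: "integrable (sphere_measure n) f" by (rule integrable_form[OF n fF])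
  note [measurable] = measurable_form[OF fF]
  have "N \<le> (\<integral>x. (f x + 2) * s \<partial>sphere_measure n)"
    unfolding N_def form_inner_def
  proof (rule integral_mono_AE)
    show "AE x in sphere_measure n. f x * f x \<le> (f x + 2) * s"
      using AE_sphere_measure[OF n]
    proof eventually_elim
      case (elim x)
      have "f x * f x = \<bar>f x\<bar> * \<bar>f x\<bar>" by simp
      also have "\<dots> \<le> (f x + 2) * s"
        using ge[OF elim] sup[OF elim] by (intro mult_mono) auto
      finally show ?case .
    qed
  qed (use fi integrable_form_product[OF n fF fF] in auto)
  also have "\<dots> = 2 * s" using fi f0 pr by simp
  finally have "N \<le> 2 * s" .
  then have "N * N \<le> (2 * s) * (2 * s)" using N by (intro mult_mono) auto
  also have "\<dots> = 4 * ?D * N" using N by (simp add: s_def)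
  finally show ?thesis unfolding N_def[symmetric]
    using N by (cases "N = 0") auto
qed

text \<open>Continuity reduces nonnegativity at all points to the countably many rational ones, so
  the set is a countable intersection of measurable ones.\<close>

lemma sets_nonneg_form_coords:
  assumes b: "\<And>i. i < D \<Longrightarrow> b i \<in> forms n d" and g: "g \<in> forms n d"
  shows "{c \<in> space (Rn D). \<forall>x\<in>space (Rn n). 0 \<le> (\<Sum>i<D. c i * b i x) + g x} \<in> sets (Rn D)"
proof -
  let ?Q = "PiE {..<n} (\<lambda>_. \<rat>) :: (nat \<Rightarrow> real) set"
  have Q: "countable ?Q" by (intro countable_PiE) (auto simp: countable_rat)
  have dense: "(\<forall>x\<in>space (Rn n). 0 \<le> h x) \<longleftrightarrow> (\<forall>x\<in>?Q. 0 \<le> h x)" if h: "h \<in> forms n d" for h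
  proof
    assume Qh: "\<forall>x\<in>?Q. 0 \<le> h x"
    show "\<forall>x\<in>space (Rn n). 0 \<le> h x"
    proof (rule ccontr)
      assume "\<not> ?thesis"
      then obtain x where "h x < 0" by (auto simp: not_le)
      then have "x \<in> h -` {..<0}" by simp
      moreover have "open (h -` {..<0})"
        using forms_continuous[OF h] by (intro open_vimage) auto
      ultimately obtain X where X: "x \<in> PiE UNIV X" "\<And>i. open (X i)" "PiE UNIV X \<subseteq> h -` {..<0}"
        using open_fun_contains_PiE by metis
      have "\<exists>q. q \<in> X i \<and> q \<in> \<rat>" for i
      proof -
        have "X i \<inter> closure \<rat> \<noteq> {}" using X(1) by (auto simp: Rats_closure_real)
        then show ?thesis using open_Int_closure_eq_empty[OF X(2)[of i], of \<rat>] by auto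
      qed
      then obtain q where q: "\<And>i. q i \<in> X i" "\<And>i. q i \<in> \<rat>" by metis
      have "h (restrict q {..<n}) = h q" by (rule forms_cong[OF h]) auto
      also have "q \<in> PiE UNIV X" using q by auto
      then have "h q < 0" using X(3) by auto
      finally have "h (restrict q {..<n}) < 0" .
      moreover have "restrict q {..<n} \<in> ?Q" using q by auto
      ultimately show False using Qh by (meson not_le)
    qed
  qed (auto simp: space_Rn PiE_iff)
  have "(\<lambda>x. (\<Sum>i<D. c i * b i x) + g x) \<in> forms n d" for c
    by (intro forms_add forms_sum forms_cmult b g) auto
  from dense[OF this] have "{c \<in> space (Rn D). \<forall>x\<in>space (Rn n). 0 \<le> (\<Sum>i<D. c i * b i x) + g x}
      = {c \<in> space (Rn D). \<forall>x\<in>?Q. 0 \<le> (\<Sum>i<D. c i * b i x) + g x}" by simp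
  also have "\<dots> \<in> sets (Rn D)"
    by (rule sets.sets_Collect_countable_All'[OF _ Q]) measurable
  finally show ?thesis .
qed

text \<open>A fixed orthonormal basis identifies M with \<open>Rn D\<close>, where measures and
  convexity arguments live, while rotations act on the forms themselves; \<open>F\<close> passes
  between the two.\<close>

locale form_coordinates =
  fixes n k :: nat and b :: "nat \<Rightarrow> form"
  assumes n: "n \<ge> 2" and k: "k \<ge> 1"
    and basis: "orthonormal_basis n (mean_zero_forms n (2 * k)) b"
begin

abbreviation "M \<equiv> mean_zero_forms n (2 * k)"
abbreviation "D \<equiv> form.dim M"

definition F :: "(nat \<Rightarrow> real) \<Rightarrow> form" where
  "F c = (\<Sum>i<D. scale_form (c i) (b i))"

definition K :: "(nat \<Rightarrow> real) set" where
  "K = {c \<in> space (Rn D). F c \<in> nonneg_section n k}"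

lemma n1: "n \<ge> 1" using n by simp

lemma D_pos: "D \<ge> 1" by (rule dim_mean_zero_forms_pos[OF n k])

lemma b_M: "i < D \<Longrightarrow> b i \<in> M" by (rule orthonormal_basis_mem[OF basis])

lemma b_forms: "i < D \<Longrightarrow> b i \<in> forms n (2 * k)"
  using b_M mean_zero_forms_subset by blast

lemma F_apply: "F c x = (\<Sum>i<D. c i * b i x)"
  by (simp add: F_def sum_form_apply)

lemma F_M: "F c \<in> M"
  unfolding F_def
  by (intro form.subspace_sum[OF mean_zero_forms_subspace[OF n1]] form.subspace_scale[OF mean_zero_forms_subspace[OF n1]] b_M) auto

lemma F_forms: "F c \<in> forms n (2 * k)"
  using F_M mean_zero_forms_subset by blast

lemma F_inner: "form_inner n (F c) (F c) = (L2_set c {..<D})\<^sup>2"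
  unfolding F_def
  by (subst form_inner_sum_sum[OF n1 b_forms orthonormal_basis_family[OF basis]])
    (auto simp: L2_set_def sum_nonneg power2_eq_square)

lemma F_lin_comb: "F (lin_comb D s x t y) v = s * F x v + t * F y v"
  by (simp add: F_apply lin_comb_def sum_distrib_left sum.distrib algebra_simps)

lemma F_surj:
  assumes "f \<in> M" shows "\<exists>c\<in>space (Rn D). F c = f"
proof -
  define c where "c = (\<lambda>i\<in>{..<D}. form_inner n f (b i))"
  have "f = (\<Sum>i<D. scale_form (form_inner n f (b i)) (b i))"
    by (rule orthonormal_basis_expand[OF n1 mean_zero_forms_subset basis assms])
  also have "\<dots> = F c" unfolding F_def by (intro sum.cong) (auto simp: c_def)
  finally show ?thesis by (intro bexI[of _ c]) (auto simp: c_def space_Rn)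
qed

lemma K_iff: "c \<in> K \<longleftrightarrow> c \<in> space (Rn D) \<and> (\<forall>v. L2_set v {..<n} = 1 \<longrightarrow> F c v \<ge> -1)"
  by (auto simp: K_def nonneg_section_iff[OF k] F_M)

lemma K_sets[measurable]: "K \<in> sets (Rn D)"
proof -
  have "K = {c \<in> space (Rn D). \<forall>x\<in>space (Rn n). 0 \<le> (\<Sum>i<D. c i * b i x) + radial_form n k x}"
    using form.subspace_add[OF forms_subspace F_forms radial_form_in_forms]
    by (auto simp: K_def nonneg_section_def nonneg_forms_def F_M F_apply)
  also have "\<dots> \<in> sets (Rn D)"
    by (rule sets_nonneg_form_coords[OF b_forms radial_form_in_forms])
  finally show ?thesis .
qed

lemma K_bound:
  assumes "c \<in> K" shows "L2_set c {..<D} \<le> sqrt (4 * D)"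
proof -
  have "form_inner n (F c) (F c) \<le> 4 * real D"
    by (rule nonneg_section_inner_le[OF n1 k]) (use assms in \<open>simp add: K_def\<close>)
  then show ?thesis unfolding F_inner by (intro real_le_rsqrt) simp
qed

lemma K_finite: "emeasure (Rn D) K < \<infinity>"
proof -
  have "K \<subseteq> {c \<in> space (Rn D). L2_set c {..<D} \<le> sqrt (4 * D)}"
    using K_bound by (auto simp: K_def)
  then have "emeasure (Rn D) K \<le> emeasure (Rn D) {c \<in> space (Rn D). L2_set c {..<D} \<le> sqrt (4 * D)}"
    by (intro emeasure_mono) measurable
  also have "\<dots> < \<infinity>" using D_pos by (intro emeasure_Rn_ball_finite) auto
  finally show ?thesis .
qed

lemma volume_eq: "form_volume n M A = measure (Rn D) {c \<in> space (Rn D). F c \<in> A}"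
  using form_volume_eq[OF n1 mean_zero_forms_subset basis]
  by (simp add: coordinate_volume_def F_def)

lemma volume_section: "form_volume n M (nonneg_section n k) = measure (Rn D) K"
  by (simp add: volume_eq K_def)

lemma volume_ball: "form_volume n M (form_ball n M) = measure (Rn D) (unit_ball D)"
proof -
  have "{c \<in> space (Rn D). F c \<in> form_ball n M} = unit_ball D"
    by (auto simp: form_ball_def F_M F_inner unit_ball_def L2_set_nonneg power_le_one_iff)
  then show ?thesis by (simp add: volume_eq)
qed

section \<open>Symmetric parts of the section and their volumes\<close>

definition sym_part :: "form \<Rightarrow> form set" where
  "sym_part f = {w. f + w \<in> nonneg_section n k \<and> f - w \<in> nonneg_section n k}"

abbreviation "sym_coords f \<equiv> {w \<in> space (Rn D). F w \<in> sym_part f}"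

lemma sym_part_coords:
  "sym_coords (F u) = fibre D K u"
proof -
  have "F (lin_comb D 1 u 1 w) = F u + F w" "F (lin_comb D 1 u (-1) w) = F u - F w" for w
    using F_lin_comb[of 1 u 1 w] F_lin_comb[of 1 u "-1" w] by (auto simp: fun_eq_iff)
  moreover have "lin_comb D s x t y \<in> space (Rn D)" for s t x y by (auto simp: lin_comb_def space_Rn)
  ultimately show ?thesis by (auto simp: sym_part_def K_def fibre_def)
qed

lemma sym_part_sets: "u \<in> space (Rn D) \<Longrightarrow> sym_coords (F u) \<in> sets (Rn D)"
  unfolding sym_part_coords fibre_def by measurable

lemma sym_part_finite: "emeasure (Rn D) (sym_coords (F u)) < \<infinity>"
proof -
  have bound: "L2_set w {..<D} \<le> 2 * sqrt (4 * D)"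
    if "w \<in> space (Rn D)" "lin_comb D 1 u 1 w \<in> K" "lin_comb D 1 u (-1) w \<in> K" for w
  proof -
    let ?p = "lin_comb D 1 u 1 w" and ?m = "lin_comb D 1 u (-1) w"
    \<comment> \<open>Below D, w is half the difference of the two points u + w and u - w of
      K.\<close>
    have "L2_set w {..<D} = L2_set (\<lambda>i. ?p i / 2 + - ?m i / 2) {..<D}"
      by (intro L2_set_cong) (auto simp: lin_comb_def field_simps)
    also have "\<dots> \<le> L2_set (\<lambda>i. ?p i / 2) {..<D} + L2_set (\<lambda>i. - ?m i / 2) {..<D}"
      by (rule L2_set_triangle_ineq)
    also have "L2_set (\<lambda>i. ?p i / 2) {..<D} = L2_set (\<lambda>i. (1/2) * ?p i) {..<D}"
      by (intro L2_set_cong) auto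
    also have "\<dots> = L2_set ?p {..<D} / 2" by (subst L2_set_right_distrib[symmetric]) auto
    also have "L2_set (\<lambda>i. - ?m i / 2) {..<D} = L2_set (\<lambda>i. (1/2) * ?m i) {..<D}"
      by (auto simp: L2_set_def power_divide)
    also have "\<dots> = L2_set ?m {..<D} / 2" by (subst L2_set_right_distrib[symmetric]) auto
    finally have "L2_set w {..<D} \<le> L2_set ?p {..<D} / 2 + L2_set ?m {..<D} / 2" .
    moreover have "sqrt (4 * D) \<ge> 0" by simp
    ultimately show ?thesis using K_bound[OF that(2)] K_bound[OF that(3)] by linarith
  qed
  have "emeasure (Rn D) (sym_coords (F u))
      \<le> emeasure (Rn D) {c \<in> space (Rn D). L2_set c {..<D} \<le> 2 * sqrt (4 * D)}"
    unfolding sym_part_coords fibre_def using bound by (intro emeasure_mono) auto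
  also have "\<dots> < \<infinity>" using D_pos by (intro emeasure_Rn_ball_finite) auto
  finally show ?thesis .
qed

text \<open>A function of the form, not of its coordinates, so that invariance under rotations can
  be stated without computing how they act on coordinates.\<close>

definition sym_volume :: "form \<Rightarrow> real" where
  "sym_volume f = measure (Rn D) (sym_coords f)"

text \<open>Rotate the basis together with f: a rotated form has the same coordinates in the rotated
  basis as before in the old one. As the volume does not depend on the orthonormal basis, nothing
  changes.\<close>

lemma sym_volume_rotate:
  assumes U: "orthogonal_coeffs n U" and f: "f \<in> M"
  shows "sym_volume (\<lambda>x. f (linear_map n U x)) = sym_volume f"
proof -
  let ?R = "\<lambda>f x. f (linear_map n U x) :: real" and ?T = "\<lambda>f x. f (linear_map n (\<lambda>i j. U j i) x) :: real"
  have Ut: "orthogonal_coeffs n (\<lambda>i j. U j i)" by (rule orthogonal_coeffs_transpose[OF U])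
  have cancel: "g (linear_map n V (linear_map n (\<lambda>i j. V j i) x)) = g x"
    if V: "orthogonal_coeffs n V" and g: "g \<in> forms n (2 * k)" for g V x
  proof -
    have "linear_map n (\<lambda>i j. V j i) (restrict x {..<n}) = linear_map n (\<lambda>i j. V j i) x"
      by (auto simp: linear_map_def)
    moreover have "linear_map n V (linear_map n (\<lambda>i j. V j i) (restrict x {..<n})) = restrict x {..<n}"
      by (rule orthogonal_coeffs_inverse[OF V]) (auto simp: space_Rn)
    ultimately show ?thesis using forms_cong[OF g, of "restrict x {..<n}" x] by simp
  qed
  define b' where "b' i = ?R (b i)" for i
  have R_F: "?R (F c) = (\<Sum>i<D. scale_form (c i) (b' i))" for c
    by (auto simp: F_apply sum_form_apply b'_def)
  have b'M: "b' i \<in> M" if "i < D" for i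
    unfolding b'_def by (rule mean_zero_forms_rotate[OF U b_M[OF that]])
  have "orthonormal_basis n M b'"
    unfolding orthonormal_basis_def
  proof (intro conjI allI impI equalityI)
    show "form.span (b' ` {..<D}) \<subseteq> M"
      using b'M by (intro form.span_minimal mean_zero_forms_subspace[OF n1]) auto
    show "M \<subseteq> form.span (b' ` {..<D})"
    proof
      fix g assume g: "g \<in> M"
      then obtain c where "F c = ?T g" using F_surj[OF mean_zero_forms_rotate[OF Ut g]] by blast
      moreover have "g \<in> forms n (2 * k)" using g mean_zero_forms_subset by blast
      ultimately have "?R (F c) = g" using cancel[OF Ut, of g] by (auto simp: fun_eq_iff)
      then have g: "g = (\<Sum>i<D. scale_form (c i) (b' i))" using R_F by simp
      show "g \<in> form.span (b' ` {..<D})"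
        unfolding g by (intro form.span_sum form.span_scale form.span_base) auto
    qed
    fix i j assume "i < D" "j < D"
    then show "form_inner n (b' i) (b' j) = (if i = j then 1 else 0)"
      unfolding b'_def using form_inner_rotate[OF U b_forms b_forms] basis by (simp add: orthonormal_basis_def)
  qed
  then have "coordinate_volume M b (sym_part (?R f)) = coordinate_volume M b' (sym_part (?R f))"
    by (rule coordinate_volume_independent[OF n1 mean_zero_forms_subset basis])
  moreover have "?R (F c) \<in> sym_part (?R f) \<longleftrightarrow> F c \<in> sym_part f" for c
  proof -
    have rot: "?R g \<in> nonneg_section n k \<longleftrightarrow> g \<in> nonneg_section n k" if g: "g \<in> M" for g
    proof -
      have gF: "g \<in> forms n (2 * k)" using g mean_zero_forms_subset by blast
      have "(\<forall>v. L2_set v {..<n} = 1 \<longrightarrow> ?R g v \<ge> -1) \<longleftrightarrow> (\<forall>v. L2_set v {..<n} = 1 \<longrightarrow> g v \<ge> -1)"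
      proof (intro iffI allI impI)
        fix v assume R: "\<forall>v. L2_set v {..<n} = 1 \<longrightarrow> ?R g v \<ge> -1" and v: "L2_set v {..<n} = 1"
        show "g v \<ge> -1"
          using R[rule_format, of "linear_map n (\<lambda>i j. U j i) v"] v orthogonal_coeffs_norm[OF Ut, of v]
            cancel[OF U gF, of v] by auto
      next
        fix v assume "\<forall>v. L2_set v {..<n} = 1 \<longrightarrow> g v \<ge> -1" and v: "L2_set v {..<n} = 1"
        then show "?R g v \<ge> -1" using orthogonal_coeffs_norm[OF U, of v] by simp
      qed
      then show ?thesis
        using g mean_zero_forms_rotate[OF U g] by (simp add: nonneg_section_iff[OF k])
    qed
    have "f + F c \<in> M" "f - F c \<in> M"
      using f F_M form.subspace_add form.subspace_diff mean_zero_forms_subspace[OF n1] by blast+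
    from this[THEN rot] show ?thesis by (simp add: sym_part_def plus_fun_def fun_diff_def)
  qed
  ultimately show ?thesis
    unfolding coordinate_volume_def sym_volume_def F_def[symmetric] R_F[symmetric] by simp
qed

lemma nonneg_section_midpoint:
  assumes f: "f \<in> nonneg_section n k" and g: "g \<in> nonneg_section n k"
  shows "(\<lambda>v. (f v + g v) / 2) \<in> nonneg_section n k"
proof -
  have fM: "f \<in> M" "g \<in> M" using f g nonneg_section_iff[OF k] by auto
  have "scale_form (1/2) (f + g) \<in> M"
    by (intro form.subspace_scale form.subspace_add mean_zero_forms_subspace[OF n1] fM)
  moreover have "scale_form (1/2) (f + g) = (\<lambda>v. (f v + g v) / 2)" by (simp add: scale_form_def fun_eq_iff)
  ultimately show ?thesis using f g by (fastforce simp: nonneg_section_iff[OF k])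
qed

lemma F_midpoint: "F (midpoint_fun D x y) = (\<lambda>v. (F x v + F y v) / 2)"
proof
  fix v
  have "F (midpoint_fun D x y) v = (\<Sum>i<D. x i * b i v / 2 + y i * b i v / 2)"
    unfolding F_apply by (intro sum.cong) (auto simp: midpoint_fun_def field_simps)
  then show "F (midpoint_fun D x y) v = (F x v + F y v) / 2"
    by (simp add: F_apply sum.distrib sum_divide_distrib add_divide_distrib)
qed

lemma K_midpoint:
  assumes "x \<in> K" "y \<in> K" shows "midpoint_fun D x y \<in> K"
proof -
  have "F (midpoint_fun D x y) \<in> nonneg_section n k"
    unfolding F_midpoint by (rule nonneg_section_midpoint) (use assms in \<open>auto simp: K_def\<close>)
  then show ?thesis by (auto simp: K_def midpoint_fun_def space_Rn)
qed

text \<open>Midpoints of points in the symmetric parts at u and u' lie in the one at the midpoint,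
  so multiplicative Brunn-Minkowski makes the superlevel sets of \<open>sym_volume\<close> midpoint
  convex.\<close>

lemma sym_volume_midpoint:
  assumes u: "u \<in> space (Rn D)" and u': "u' \<in> space (Rn D)" and t: "t \<ge> 0"
    and "sym_volume (F u) \<ge> t" "sym_volume (F u') \<ge> t"
  shows "sym_volume (F (midpoint_fun D u u')) \<ge> t"
proof -
  let ?S = "\<lambda>u. sym_coords (F u)"
  let ?m = "midpoint_fun D u u'"
  have m: "?m \<in> space (Rn D)" by (auto simp: midpoint_fun_def space_Rn)
  have "emeasure (Rn D) (?S u) * emeasure (Rn D) (?S u') \<le> (emeasure (Rn D) (?S ?m))\<^sup>2"
  proof (rule brunn_minkowski_mult)
    show "?S u \<in> sets (Rn D)" "?S u' \<in> sets (Rn D)" "?S ?m \<in> sets (Rn D)" using sym_part_sets u u' m by auto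
    fix x y assume x: "x \<in> ?S u" and y: "y \<in> ?S u'"
    have "F ?m + F (midpoint_fun D x y) = (\<lambda>v. ((F u + F x) v + (F u' + F y) v) / 2)"
      by (simp add: fun_eq_iff F_midpoint add_divide_distrib diff_divide_distrib)
    moreover have "F ?m - F (midpoint_fun D x y) = (\<lambda>v. ((F u - F x) v + (F u' - F y) v) / 2)"
      by (simp add: fun_eq_iff F_midpoint add_divide_distrib diff_divide_distrib)
    ultimately have "F (midpoint_fun D x y) \<in> sym_part (F ?m)"
      using x y nonneg_section_midpoint unfolding sym_part_def by (simp del: plus_fun_apply minus_apply)
    then show "midpoint_fun D x y \<in> ?S ?m" by (auto simp: midpoint_fun_def space_Rn)
  qed
  moreover have "emeasure (Rn D) (?S u) = ennreal (sym_volume (F u))" for u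
    unfolding sym_volume_def using sym_part_finite[of u] by (intro emeasure_eq_ennreal_measure) (auto simp: less_top)
  ultimately have "ennreal (sym_volume (F u) * sym_volume (F u')) \<le> ennreal ((sym_volume (F ?m))\<^sup>2)"
    by (simp add: ennreal_mult ennreal_power sym_volume_def)
  then have "sym_volume (F u) * sym_volume (F u') \<le> (sym_volume (F ?m))\<^sup>2"
    by (subst (asm) ennreal_le_iff) auto
  moreover have "t * t \<le> sym_volume (F u) * sym_volume (F u')" using assms by (intro mult_mono) auto
  ultimately have "t\<^sup>2 \<le> (sym_volume (F ?m))\<^sup>2" by (simp add: power2_eq_square)
  then show ?thesis by (rule power2_le_imp_le) (simp add: sym_volume_def)
qed

end


section \<open>The upper bound\<close>

lemma form_inner_combination:
  assumes n: "n \<ge> 1" and f: "f \<in> forms n d" and g: "g \<in> forms n d"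
  shows "form_inner n (\<lambda>x. a * f x + b * g x) (\<lambda>x. a * f x + b * g x)
    = a\<^sup>2 * form_inner n f f + 2 * a * b * form_inner n f g + b\<^sup>2 * form_inner n g g"
proof -
  have "(\<lambda>x. (a * f x + b * g x) * (a * f x + b * g x))
      = (\<lambda>x. a\<^sup>2 * (f x * f x) + 2 * a * b * (f x * g x) + b\<^sup>2 * (g x * g x))"
    by (simp add: fun_eq_iff power2_eq_square algebra_simps)
  then show ?thesis
    unfolding form_inner_def
    using integrable_form_product[OF n f f] integrable_form_product[OF n f g] integrable_form_product[OF n g g]
    by simp
qed

context form_coordinates
begin

text \<open>An almost norm-minimal element of a superlevel set of \<open>sym_volume\<close> is close to all its rotations,
  by the parallelogram law, hence nearly constant on the sphere.\<close>

lemma bounded_section_large: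
  assumes t: "t > 0" and ex: "\<exists>f\<in>nonneg_section n k. sym_volume f \<ge> t"
  shows "\<exists>f\<in>nonneg_section n k. sym_volume f \<ge> t \<and> (\<forall>v. L2_set v {..<n} = 1 \<longrightarrow> f v \<le> 1)"
proof -
  define S where "S = {f \<in> nonneg_section n k. sym_volume f \<ge> t}"
  define N where "N f = form_inner n f f" for f
  define I where "I = Inf (N ` S)"
  have SM: "f \<in> M" if "f \<in> S" for f using that nonneg_section_iff[OF k] by (auto simp: S_def)
  then have SF: "f \<in> forms n (2 * k)" if "f \<in> S" for f using that mean_zero_forms_subset by blast
  have bdd: "bdd_below (N ` S)"
    unfolding N_def by (intro bdd_belowI[of _ 0]) (auto simp: form_inner_nonneg)
  have ne: "N ` S \<noteq> {}" using ex by (auto simp: S_def)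
  have I: "I \<le> N f" if "f \<in> S" for f unfolding I_def using that bdd by (intro cInf_lower) auto
  \<comment> \<open>The parallelogram law will bound the squared norm of f minus a rotated copy by 4
    e = 1/D, and the kernel bound multiplies this by D, leaving sup norm at most 1.\<close>
  define e where "e = 1 / (4 * real D)"
  have e: "e > 0" using D_pos by (simp add: e_def)
  obtain f where f: "f \<in> S" "N f < I + e"
    using cInf_lessD[OF ne, of "I + e"] e by (auto simp: I_def)
  note fM = SM[OF f(1)] and fF = SF[OF f(1)]
  have mid: "(\<lambda>v. (g v + h v) / 2) \<in> S" if g: "g \<in> S" and h: "h \<in> S" for g h
  proof -
    obtain u u' where u: "u \<in> space (Rn D)" "F u = g" "u' \<in> space (Rn D)" "F u' = h"
      using F_surj[OF SM[OF g]] F_surj[OF SM[OF h]] by blast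
    have "sym_volume (F (midpoint_fun D u u')) \<ge> t"
      by (rule sym_volume_midpoint) (use u g h t in \<open>auto simp: S_def\<close>)
    then show ?thesis
      using nonneg_section_midpoint[of g h] g h by (simp add: F_midpoint u S_def)
  qed
  have rot: "f v \<le> f w + 1" if v: "L2_set v {..<n} = 1" and w: "L2_set w {..<n} = 1" for v w
  proof -
    obtain U where U: "orthogonal_coeffs n U" "\<forall>i<n. linear_map n U v i = w i"
      using reflection_exists[OF v w] by blast
    define g where "g = (\<lambda>x. f (linear_map n U x))"
    have gM: "g \<in> M" unfolding g_def by (rule mean_zero_forms_rotate[OF U(1) fM])
    have gF: "g \<in> forms n (2 * k)" using gM mean_zero_forms_subset by blast
    have "g x \<ge> -1" if "L2_set x {..<n} = 1" for x
      using f(1) that orthogonal_coeffs_norm[OF U(1), of x] by (simp add: g_def S_def nonneg_section_iff[OF k])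
    then have gS: "g \<in> S"
      using gM f(1) sym_volume_rotate[OF U(1) fM] by (simp add: S_def nonneg_section_iff[OF k] g_def)
    have Ng: "N g = N f" unfolding N_def g_def by (rule form_inner_rotate[OF U(1) fF fF])
    have "I \<le> N (\<lambda>v. (f v + g v) / 2)" by (intro I mid f(1) gS)
    moreover have "(\<lambda>v. (f v + g v) / 2) = (\<lambda>x. (1/2) * f x + (1/2) * g x)" by (simp add: fun_eq_iff)
    ultimately have "I \<le> (1/4) * N f + (1/2) * form_inner n f g + (1/4) * N g"
      using form_inner_combination[OF n1 fF gF, of "1/2" "1/2"] by (simp add: N_def power2_eq_square)
    moreover define d where "d = (\<lambda>x. 1 * f x + (-1) * g x)"
    moreover have "N d = N f - 2 * form_inner n f g + N g"
      unfolding N_def d_def form_inner_combination[OF n1 fF gF] by simp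
    ultimately have Nd: "N d \<le> 4 * e" using f(2) Ng by linarith
    have dM: "d \<in> M"
    proof -
      have "d = f - g" by (simp add: d_def fun_eq_iff)
      then show ?thesis using fM gM form.subspace_diff[OF mean_zero_forms_subspace[OF n1]] by blast
    qed
    have "(d v)\<^sup>2 \<le> D * N d"
      unfolding N_def
      by (rule form_square_le_dim[OF n1 mean_zero_forms_subspace[OF n1] mean_zero_forms_subset mean_zero_forms_rotate v dM])
    also have "\<dots> \<le> D * (4 * e)" by (intro mult_left_mono Nd) auto
    also have "\<dots> = 1" using D_pos by (simp add: e_def)
    finally have "\<bar>d v\<bar> \<le> 1" by (simp add: abs_square_le_1)
    moreover have "g v = f w" unfolding g_def by (rule forms_cong[OF fF]) (use U in auto)
    ultimately show ?thesis by (simp add: d_def)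
  qed
  have "f v \<le> 1" if v: "L2_set v {..<n} = 1" for v
  proof -
    interpret prob_space "sphere_measure n" by (rule prob_space_sphere_measure)
    have pr: "prob (space (Rn n)) = 1" using prob_space by simp
    \<comment> \<open>Averaging f v - 1 \<le> f x over x turns the bound on the oscillation into f v
      \<le> 1, because the mean of f is 0.\<close>
    have "(\<integral>x. f v - 1 \<partial>sphere_measure n) \<le> (\<integral>x. f x \<partial>sphere_measure n)"
    proof (rule integral_mono_AE)
      show "AE x in sphere_measure n. f v - 1 \<le> f x"
        using AE_sphere_measure[OF n1] by eventually_elim (use rot[OF v] in \<open>simp add: algebra_simps\<close>)
    qed (use integrable_form[OF n1 fF] in auto)
    then show ?thesis using fM pr by (simp add: mean_zero_forms_def)
  qed
  then show ?thesis using f(1) by (auto simp: S_def)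
qed

text \<open>If f \<le> 1 and both f + w and f - w are at least -1 on the sphere, then |w| \<le> 2
  there, so w/2 falls under the hypothesis and w has norm at most 2 sqrt (C/n). The factor 4 per
  dimension from the choice of the fibre makes this 8.\<close>

lemma section_volume_le:
  assumes C: "C > 0" and small: "\<And>f. f \<in> M \<Longrightarrow> (\<And>v. L2_set v {..<n} = 1 \<Longrightarrow> \<bar>f v\<bar> \<le> 1) \<Longrightarrow> form_inner n f f \<le> C / real n"
  shows "measure (Rn D) K \<le> (8 * sqrt (C / n)) ^ D * measure (Rn D) (unit_ball D)"
proof (cases "measure (Rn D) K = 0")
  case True
  have "sqrt (C / n) \<ge> 0" using C by simp
  then show ?thesis unfolding True by (intro mult_nonneg_nonneg zero_le_power measure_nonneg) auto
next
  case False
  define t where "t = measure (Rn D) K / 4 ^ D"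
  have pos: "measure (Rn D) K > 0" using False measure_nonneg[of "Rn D" K] by linarith
  then have t: "t > 0" by (simp add: t_def)
  have eK: "emeasure (Rn D) K = ennreal (measure (Rn D) K)"
    using K_finite by (intro emeasure_eq_ennreal_measure) auto
  have "\<exists>u\<in>K. emeasure (Rn D) K \<le> ennreal (4 ^ D) *
    emeasure (Rn D) (fibre D K u)"
    by (rule symmetric_section_large[OF D_pos K_sets K_finite _ K_midpoint])
      (use pos in \<open>auto simp: eK\<close>)
  then obtain u where u: "u \<in> K" "emeasure (Rn D) K \<le> ennreal (4 ^ D) * emeasure (Rn D) (sym_coords (F u))"
    unfolding sym_part_coords by blast
  have "emeasure (Rn D) (sym_coords (F u)) = ennreal (sym_volume (F u))"
    unfolding sym_volume_def using sym_part_finite[of u] by (intro emeasure_eq_ennreal_measure) auto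
  then have "ennreal (measure (Rn D) K) \<le> ennreal (4 ^ D * sym_volume (F u))"
    using u(2) by (simp add: eK ennreal_mult sym_volume_def)
  then have "measure (Rn D) K \<le> 4 ^ D * sym_volume (F u)"
    by (subst (asm) ennreal_le_iff) (auto simp: sym_volume_def)
  then have "sym_volume (F u) \<ge> t" by (simp add: t_def field_simps)
  then obtain f where f: "f \<in> nonneg_section n k" "sym_volume f \<ge> t" "\<And>v. L2_set v {..<n} = 1 \<Longrightarrow> f v \<le> 1"
    using bounded_section_large[OF t] u(1) by (auto simp: K_def)
  define r where "r = 2 * sqrt (C / n)"
  have r: "r > 0" using C n by (simp add: r_def)
  have sub: "L2_set w {..<D} \<le> r" if w: "F w \<in> sym_part f" for w
  proof -
    \<comment> \<open>Half of w, written as a combination of two forms so that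
      \<open>form_inner_combination\<close> computes its norm.\<close>
    define h where "h = (\<lambda>x. (1/2) * F w x + 0 * F w x)"
    have "scale_form (1/2) (F w) \<in> M" by (intro form.subspace_scale mean_zero_forms_subspace[OF n1] F_M)
    then have hM: "h \<in> M" by (simp add: h_def scale_form_def)
    have "\<bar>h v\<bar> \<le> 1" if v: "L2_set v {..<n} = 1" for v
    proof -
      have "f v + F w v \<ge> -1" "f v - F w v \<ge> -1"
        using w v by (simp_all add: sym_part_def nonneg_section_iff[OF k])
      then show ?thesis using f(3)[OF v] by (simp add: h_def)
    qed
    then have "form_inner n h h \<le> C / n" by (intro small hM)
    moreover have "form_inner n h h = (1/4) * (L2_set w {..<D})\<^sup>2"
      unfolding h_def form_inner_combination[OF n1 F_forms F_forms] by (simp add: F_inner power2_eq_square)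
    ultimately have "(L2_set w {..<D})\<^sup>2 \<le> 4 * (C / n)" by linarith
    also have "\<dots> = r\<^sup>2" using C by (simp add: r_def power_mult_distrib)
    finally show ?thesis by (rule power2_le_imp_le) (use r in simp)
  qed
  have ball: "measure (Rn D) {c \<in> space (Rn D). L2_set c {..<D} \<le> r} = r ^ D * measure (Rn D) (unit_ball D)"
    using emeasure_Rn_ball[OF r, of D] r by (simp add: measure_def enn2real_mult)
  have "t \<le> sym_volume f" by (rule f(2))
  also have "\<dots> \<le> measure (Rn D) {c \<in> space (Rn D). L2_set c {..<D} \<le> r}"
    unfolding sym_volume_def
  proof (rule measure_mono_fmeasurable)
    obtain c where "c \<in> space (Rn D)" "F c = f" using F_surj f(1) nonneg_section_iff[OF k] by blast
    then show "sym_coords f \<in> sets (Rn D)" using sym_part_sets by blast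
    show "{c \<in> space (Rn D). L2_set c {..<D} \<le> r} \<in> fmeasurable (Rn D)"
      using emeasure_Rn_ball_finite[OF r] by (intro fmeasurableI) auto
  qed (use sub in auto)
  finally have "4 ^ D * t \<le> 4 ^ D * (r ^ D * measure (Rn D) (unit_ball D))"
    unfolding ball by (intro mult_left_mono) auto
  also have "\<dots> = (4 * r) ^ D * measure (Rn D) (unit_ball D)"
    by (simp only: power_mult_distrib mult.assoc)
  also have "4 * r = 8 * sqrt (C / n)" by (simp add: r_def)
  finally show ?thesis by (simp add: t_def)
qed

end


section \<open>The lower bound\<close>

lemma emeasure_gauss_le:
  assumes [measurable]: "A \<in> sets (Rn m)"
  shows "emeasure (gauss m) A \<le> ennreal ((1 / sqrt (2 * pi)) ^ m) * emeasure (Rn m) A"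
proof -
  have "emeasure (gauss m) A = (\<integral>\<^sup>+x. ennreal (\<Prod>i<m. std_normal_density (x i)) * indicator A x \<partial>Rn m)"
    unfolding gauss_def by (subst emeasure_density) auto
  also have "\<dots> \<le> (\<integral>\<^sup>+x. ennreal ((1 / sqrt (2 * pi)) ^ m) * indicator A x \<partial>Rn m)"
  proof (intro nn_integral_mono mult_right_mono ennreal_leI)
    fix x
    show "(\<Prod>i<m. std_normal_density (x i)) \<le> (1 / sqrt (2 * pi)) ^ m"
      unfolding gauss_density_eq by (intro mult_left_le) (auto simp: sum_nonneg)
  qed auto
  also have "\<dots> = ennreal ((1 / sqrt (2 * pi)) ^ m) * emeasure (Rn m) A"
    by (rule nn_integral_cmult_indicator) simp
  finally show ?thesis .
qed

text \<open>On the ball of radius sqrt m the Gaussian density is at least (2 pi e)^(-m/2), and its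
  integral there is at most 1; rescaling gives the bound.\<close>

lemma measure_unit_ball_le:
  assumes m: "m \<ge> 1"
  shows "measure (Rn m) (unit_ball m) \<le> sqrt (2 * pi * exp 1 / m) ^ m"
proof -
  let ?B = "{x \<in> space (Rn m). L2_set x {..<m} \<le> sqrt m}"
  define a where "a = (exp (-1/2) / sqrt (2 * pi)) ^ m"
  have a: "a > 0" by (simp add: a_def)
  have "ennreal a * emeasure (Rn m) ?B = (\<integral>\<^sup>+x. ennreal a * indicator ?B x \<partial>Rn m)"
    by (rule nn_integral_cmult_indicator[symmetric]) measurable
  also have "\<dots> \<le> (\<integral>\<^sup>+x. ennreal (\<Prod>i<m. std_normal_density (x i)) * indicator ?B x \<partial>Rn m)"
  proof (intro nn_integral_mono)
    fix x
    show "ennreal a * indicator ?B x \<le> ennreal (\<Prod>i<m. std_normal_density (x i)) * indicator ?B x"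
    proof (cases "x \<in> ?B")
      case True
      then have "(L2_set x {..<m})\<^sup>2 \<le> (sqrt m)\<^sup>2" by (intro power_mono) (auto simp: L2_set_nonneg)
      then have "(\<Sum>i<m. (x i)\<^sup>2) \<le> m" by (simp add: L2_set_def sum_nonneg)
      then have "exp (- real m / 2) \<le> exp (- (\<Sum>i<m. (x i)\<^sup>2) / 2)" by simp
      moreover have "a = (1 / sqrt (2 * pi)) ^ m * exp (- real m / 2)"
      proof -
        have "exp (- real m / 2) = exp (-1/2) ^ m" by (simp add: exp_of_nat_mult[symmetric])
        then show ?thesis by (simp add: a_def power_divide)
      qed
      ultimately have "a \<le> (\<Prod>i<m. std_normal_density (x i))"
        unfolding gauss_density_eq by (simp add: mult_left_mono)
      then show ?thesis by (simp add: ennreal_leI mult_right_mono)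
    qed simp
  qed
  also have "\<dots> = emeasure (gauss m) ?B"
    unfolding gauss_def by (subst emeasure_density) auto
  also have "\<dots> \<le> 1" by (rule gauss.emeasure_le_1)
  also have "emeasure (Rn m) ?B = ennreal (sqrt m ^ m) * emeasure (Rn m) (unit_ball m)"
    using m by (intro emeasure_Rn_ball) auto
  also have "emeasure (Rn m) (unit_ball m) = ennreal (measure (Rn m) (unit_ball m))"
    using unit_ball_finite[of m] by (intro emeasure_eq_ennreal_measure) auto
  finally have "ennreal (a * (sqrt m ^ m * measure (Rn m) (unit_ball m))) \<le> ennreal 1"
    using a by (simp add: ennreal_mult)
  then have "a * sqrt m ^ m * measure (Rn m) (unit_ball m) \<le> 1"
    by (subst (asm) ennreal_le_iff) (auto simp: mult.assoc)
  moreover have "a * sqrt m ^ m * sqrt (2 * pi * exp 1 / m) ^ m = 1"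
  proof -
    have "exp (-1/2) * sqrt (exp 1) = (1::real)"
    proof -
      have "sqrt (exp 1) = exp (1/2 :: real)"
        by (rule real_sqrt_unique) (simp_all add: power2_eq_square exp_add[symmetric])
      then show ?thesis by (simp add: exp_add[symmetric])
    qed
    then have "exp (-1/2) / sqrt (2 * pi) * sqrt m * sqrt (2 * pi * exp 1 / m) = 1"
      using m by (simp add: real_sqrt_mult real_sqrt_divide)
    then show ?thesis unfolding a_def power_mult_distrib[symmetric] by simp
  qed
  ultimately have "a * sqrt m ^ m * measure (Rn m) (unit_ball m) \<le> a * sqrt m ^ m * sqrt (2 * pi * exp 1 / m) ^ m"
    by (simp only:)
  moreover have "a * sqrt m ^ m > 0" using a m by simp
  ultimately show ?thesis by (rule mult_left_le_imp_le)
qed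

section \<open>Gaussian measure of the dilated section\<close>

context form_coordinates
begin

text \<open>Stated for every measure with the sets of \<open>Rn D\<close>, since it is applied to
  Lebesgue measure and to \<open>gauss D\<close>.\<close>

lemma measurable_F:
  assumes A: "sets A = sets (Rn D)"
  shows "(\<lambda>z. F (fst z) (snd z)) \<in> borel_measurable (A \<Otimes>\<^sub>M sphere_measure n)"
  unfolding F_apply
proof (intro borel_measurable_sum borel_measurable_times)
  fix i assume i: "i \<in> {..<D}"
  have "(\<lambda>c. c i) \<in> borel_measurable A" unfolding measurable_cong_sets[OF A refl] using i by simp
  from measurable_compose[OF measurable_fst this]
  show "(\<lambda>z. fst z i) \<in> borel_measurable (A \<Otimes>\<^sub>M sphere_measure n)" .
  have "b i \<in> borel_measurable (sphere_measure n)" using i measurable_form[OF b_forms] by simp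
  from measurable_compose[OF measurable_snd this]
  show "(\<lambda>z. b i (snd z)) \<in> borel_measurable (A \<Otimes>\<^sub>M sphere_measure n)" .
qed

text \<open>After Fubini, for fixed x on the sphere F c x is linear in c with squared coefficients
  summing to D, so the moment bound with p = n is uniform in x. The factorial is replaced by
  (2n)^(2n).\<close>

lemma gauss_power_integral_le:
  "(\<integral>\<^sup>+c. (\<integral>\<^sup>+x. ennreal (F c x ^ (2 * n)) \<partial>sphere_measure n) \<partial>gauss D) \<le> ennreal (2 * (2 * real n * exp 1 * real D) ^ n)"
proof -
  interpret S: prob_space "sphere_measure n" by (rule prob_space_sphere_measure)
  interpret P: pair_sigma_finite "gauss D" "sphere_measure n" ..
  have m: "(\<lambda>z. F (fst z) (snd z)) \<in> borel_measurable (gauss D \<Otimes>\<^sub>M sphere_measure n)"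
    by (rule measurable_F) simp
  have "(\<integral>\<^sup>+c. (\<integral>\<^sup>+x. ennreal (F c x ^ (2 * n)) \<partial>sphere_measure n) \<partial>gauss D)
      = (\<integral>\<^sup>+x. (\<integral>\<^sup>+c. ennreal (F c x ^ (2 * n)) \<partial>gauss D) \<partial>sphere_measure n)"
    using m by (intro P.Fubini'[symmetric]) (simp add: split_beta')
  also have "\<dots> \<le> (\<integral>\<^sup>+x. ennreal (2 * (2 * real n * exp 1 * real D) ^ n) \<partial>sphere_measure n)"
  proof (rule nn_integral_mono_AE)
    show "AE x in sphere_measure n. (\<integral>\<^sup>+c. ennreal (F c x ^ (2 * n)) \<partial>gauss D) \<le> ennreal (2 * (2 * real n * exp 1 * real D) ^ n)"
      using AE_sphere_measure[OF n1]
    proof eventually_elim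
      case (elim x)
      have sq: "(\<Sum>i<D. (b i x)\<^sup>2) = D"
        by (rule sum_squares_basis_eq_dim[OF n1 mean_zero_forms_subset basis mean_zero_forms_rotate elim])
      have "(\<integral>\<^sup>+c. ennreal (F c x ^ (2 * n)) \<partial>gauss D) = (\<integral>\<^sup>+c. ennreal ((\<Sum>i<D. b i x * c i) ^ (2 * n)) \<partial>gauss D)"
        by (simp add: F_apply mult.commute)
      also have "\<dots> \<le> ennreal (2 * fact (2 * n) * (exp 1 / (2 * real n)) ^ n * real D ^ n)"
        using gauss_even_moment_le[OF n1, of D "\<lambda>i. b i x"] by (simp only: sq)
      also have "\<dots> \<le> ennreal (2 * (2 * real n * exp 1 * real D) ^ n)"
      proof (rule ennreal_leI)
        have "(fact (2 * n) :: real) \<le> real ((2 * n) ^ (2 * n))"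
          using fact_le_power[of "2 * n", where 'a = real] by simp
        also have "\<dots> = (2 * real n) ^ n * (2 * real n) ^ n"
          by (simp only: power_add[symmetric] mult_2[symmetric] of_nat_power of_nat_mult of_nat_numeral)
        finally have "2 * fact (2 * n) * (exp 1 / (2 * real n)) ^ n * real D ^ n
          \<le> 2 * ((2 * real n) ^ n * (2 * real n) ^ n) * (exp 1 / (2 * real n)) ^ n * real D ^ n"
          by (intro mult_left_mono mult_right_mono) auto
        also have "\<dots> = 2 * (2 * real n * exp 1 * real D) ^ n"
          using n1 by (simp add: power_mult_distrib power_divide)
        finally show "2 * fact (2 * n) * (exp 1 / (2 * real n)) ^ n * real D ^ n \<le> 2 * (2 * real n * exp 1 * real D) ^ n" .
      qed
      finally show ?case .
    qed
  qed
  also have "\<dots> = ennreal (2 * (2 * real n * exp 1 * real D) ^ n)"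
    using S.emeasure_space_1 by simp
  finally show ?thesis .
qed

text \<open>Barvinok's comparison of the sup norm with the \<open>L\<^sup>2\<^sup>n\<close> norm: apply the kernel bound to \<open>f\<^sup>n\<close>.\<close>

lemma sup_le_power_integral:
  assumes f: "f \<in> forms n (2 * k)" and v: "L2_set v {..<n} = 1" and r: "r \<ge> 0"
    and int: "(\<integral>\<^sup>+x. ennreal (f x ^ (2 * n)) \<partial>sphere_measure n) \<le> ennreal (r ^ n)"
  shows "(f v)\<^sup>2 \<le> 2 ^ (2 * k + 1) * r"
proof -
  let ?h = "\<lambda>x. f x ^ n"
  have h: "?h \<in> forms n (2 * k * n)" by (rule forms_power[OF f])
  have "form_inner n ?h ?h = (\<integral>x. f x ^ (2 * n) \<partial>sphere_measure n)"
    by (simp add: form_inner_def mult_2 power_add)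
  also have "\<dots> \<le> r ^ n"
  proof -
    have "ennreal (\<integral>x. f x ^ (2 * n) \<partial>sphere_measure n) = (\<integral>\<^sup>+x. ennreal (f x ^ (2 * n)) \<partial>sphere_measure n)"
      by (rule nn_integral_eq_integral[symmetric]) (auto intro: integrable_form[OF n1 forms_power[OF f]])
    then have "ennreal (\<integral>x. f x ^ (2 * n) \<partial>sphere_measure n) \<le> ennreal (r ^ n)" using int by simp
    then show ?thesis using r by (subst (asm) ennreal_le_iff) auto
  qed
  finally have inner: "form_inner n ?h ?h \<le> r ^ n" .
  have "(?h v)\<^sup>2 \<le> form.dim (forms n (2 * k * n)) * form_inner n ?h ?h"
    by (rule form_square_le_dim[OF n1 forms_subspace order_refl forms_linear_map v h])
  also have "\<dots> \<le> 2 ^ (n + 2 * k * n) * r ^ n"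
  proof (intro mult_mono inner)
    show "real (form.dim (forms n (2 * k * n))) \<le> 2 ^ (n + 2 * k * n)"
      using of_nat_mono[OF dim_forms_le[OF order_refl, of n "2 * k * n"], where 'a = real] by simp
  qed (auto simp: form_inner_nonneg)
  also have "(2::real) ^ (n + 2 * k * n) = (2 ^ (2 * k + 1)) ^ n"
  proof -
    have "n + 2 * k * n = (2 * k + 1) * n" by (simp add: algebra_simps)
    then show ?thesis by (simp only: power_mult)
  qed
  finally have "((f v)\<^sup>2) ^ n \<le> (2 ^ (2 * k + 1) * r) ^ n"
    by (simp add: power_mult_distrib power_mult[symmetric] mult.commute)
  then show ?thesis using r n1 by (subst (asm) power_mono_iff) auto
qed

text \<open>By Markov, with Gaussian probability at least 1/2 the mean 2n-th power of F c is at most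
  twice its expected bound, so at most (8 n e D)^n. The comparison with the sup norm multiplies the
  base 8 n e D by 2^(2k+1), which gives \<rho>^2. So at least half of the Gaussian mass lies in
  \<rho> K.\<close>

lemma section_volume_ge:
  defines "\<rho> \<equiv> sqrt (2 ^ (2 * k + 4) * exp 1 * real D * real n)"
  shows "1 / 2 * (sqrt (2 * pi) / \<rho>) ^ D \<le> measure (Rn D) K"
proof -
  have \<rho>: "\<rho> > 0" using D_pos n1 unfolding \<rho>_def by simp
  interpret S: prob_space "sphere_measure n" by (rule prob_space_sphere_measure)
  define T where "T = 2 * (2 * real n * exp 1 * real D) ^ n"
  define N where "N c = (\<integral>\<^sup>+x. ennreal (F c x ^ (2 * n)) \<partial>sphere_measure n)" for c
  have T: "T > 0" using D_pos n1 by (simp add: T_def)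
  have Nm[measurable]: "N \<in> borel_measurable (Rn D)"
  proof -
    have "(\<lambda>z. F (fst z) (snd z)) \<in> borel_measurable (Rn D \<Otimes>\<^sub>M sphere_measure n)"
      by (rule measurable_F) simp
    then show ?thesis unfolding N_def[abs_def]
      by (intro S.borel_measurable_nn_integral) (simp add: split_beta')
  qed
  define A where "A = {c \<in> space (Rn D). N c \<le> ennreal (2 * T)}"
  have [measurable]: "A \<in> sets (Rn D)" unfolding A_def by measurable
  let ?E = "{c \<in> space (gauss D). 1 \<le> ennreal (1 / (2 * T)) * N c}"
  have "emeasure (gauss D) ?E \<le> ennreal (1 / (2 * T)) * (\<integral>\<^sup>+c. N c * indicator (space (gauss D)) c \<partial>gauss D)"
    by (rule nn_integral_Markov_inequality) auto
  also have "(\<integral>\<^sup>+c. N c * indicator (space (gauss D)) c \<partial>gauss D) = (\<integral>\<^sup>+c. N c \<partial>gauss D)"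
    by (rule nn_integral_cong) auto
  also have "ennreal (1 / (2 * T)) * (\<integral>\<^sup>+c. N c \<partial>gauss D) \<le> ennreal (1 / (2 * T)) * ennreal T"
    unfolding N_def T_def by (intro mult_left_mono gauss_power_integral_le) auto
  also have "\<dots> = ennreal (1 / 2)" using T by (simp add: ennreal_mult[symmetric])
  finally have "ennreal (gauss.prob D ?E) \<le> ennreal (1 / 2)"
    by (simp only: gauss.emeasure_eq_measure)
  then have E: "gauss.prob D ?E \<le> 1 / 2" by (subst (asm) ennreal_le_iff) auto
  have "space (gauss D) - ?E \<subseteq> A"
  proof
    fix c assume c: "c \<in> space (gauss D) - ?E"
    then have lt: "ennreal (1 / (2 * T)) * N c < 1" by auto
    then have "N c \<noteq> top" using T by (auto simp: ennreal_mult_top)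
    then obtain s where s: "N c = ennreal s" "s \<ge> 0" by (cases "N c") auto
    then have "ennreal (1 / (2 * T) * s) < ennreal 1" using lt T by (subst ennreal_mult) auto
    then have "1 / (2 * T) * s < 1" using s T by (subst (asm) ennreal_less_iff) auto
    then have "s \<le> 2 * T" using T by (simp add: field_simps)
    then show "c \<in> A" using c s by (simp add: A_def ennreal_leI)
  qed
  then have "gauss.prob D (space (gauss D) - ?E) \<le> gauss.prob D A"
    by (intro gauss.finite_measure_mono) auto
  moreover have "gauss.prob D (space (gauss D) - ?E) = 1 - gauss.prob D ?E"
    by (rule gauss.prob_compl) measurable
  ultimately have A: "1 / 2 \<le> gauss.prob D A" using E by simp
  let ?S = "{c \<in> space (Rn D). (\<lambda>i\<in>{..<D}. c i / \<rho>) \<in> K}"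
  have "A \<subseteq> ?S"
  proof
    fix c assume c: "c \<in> A"
    have "F (\<lambda>i\<in>{..<D}. c i / \<rho>) v \<ge> -1" if v: "L2_set v {..<n} = 1" for v
    proof -
      \<comment> \<open>Both factors 2, from the moment bound and from Markov, are absorbed into the
        n-th power because n \<ge> 1.\<close>
      have "2 * T \<le> (4 * (2 * real n * exp 1 * real D)) ^ n"
      proof -
        have "(4::real) ^ 1 \<le> 4 ^ n" using n1 by (intro power_increasing) auto
        then have "4 * X ^ n \<le> (4 * X) ^ n" if "X \<ge> 0" for X :: real
          using that by (simp add: power_mult_distrib mult_right_mono)
        from this[of "2 * real n * exp 1 * real D"] show ?thesis by (simp only: T_def) simp
      qed
      then have "N c \<le> ennreal ((4 * (2 * real n * exp 1 * real D)) ^ n)"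
        using c by (auto simp: A_def intro: order_trans ennreal_leI)
      then have "(F c v)\<^sup>2 \<le> 2 ^ (2 * k + 1) * (4 * (2 * real n * exp 1 * real D))"
        unfolding N_def by (intro sup_le_power_integral[OF F_forms v]) auto
      also have "\<dots> = \<rho>\<^sup>2" using D_pos n1 by (simp add: \<rho>_def power_add mult_ac)
      finally have "\<bar>F c v\<bar> \<le> \<rho>" using \<rho> by (simp add: abs_le_square_iff[symmetric])
      then have "- \<rho> / \<rho> \<le> F c v / \<rho>" using \<rho> by (intro divide_right_mono) auto
      also have "F c v / \<rho> = F (\<lambda>i\<in>{..<D}. c i / \<rho>) v"
        by (simp add: F_apply sum_divide_distrib)
      finally show ?thesis using \<rho> by simp
    qed
    then show "c \<in> ?S" using c by (auto simp: K_iff A_def space_Rn)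
  qed
  then have "emeasure (Rn D) A \<le> emeasure (Rn D) ?S"
    by (intro emeasure_mono) (auto intro!: measurable_sets_Collect simp: measurable_into_Rn)
  also have "\<dots> = ennreal (\<rho> ^ D) * emeasure (Rn D) K" by (rule emeasure_Rn_scale[OF \<rho> K_sets])
  also have "emeasure (Rn D) K = ennreal (measure (Rn D) K)"
    using K_finite by (intro emeasure_eq_ennreal_measure) auto
  finally have "ennreal ((1 / sqrt (2 * pi)) ^ D) * emeasure (Rn D) A
      \<le> ennreal ((1 / sqrt (2 * pi)) ^ D) * (ennreal (\<rho> ^ D) * ennreal (measure (Rn D) K))"
    by (intro mult_left_mono) auto
  with emeasure_gauss_le[of A D]
  have "emeasure (gauss D) A \<le> ennreal ((1 / sqrt (2 * pi)) ^ D) * (ennreal (\<rho> ^ D) * ennreal (measure (Rn D) K))"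
    by (meson \<open>A \<in> sets (Rn D)\<close> order_trans)
  also have "\<dots> = ennreal ((\<rho> / sqrt (2 * pi)) ^ D * measure (Rn D) K)"
    using \<rho> by (simp add: ennreal_mult[symmetric] power_divide)
  finally have "gauss.prob D A \<le> (\<rho> / sqrt (2 * pi)) ^ D * measure (Rn D) K"
    using \<rho> by (simp add: gauss.emeasure_eq_measure)
  with A have "1 / 2 \<le> (\<rho> / sqrt (2 * pi)) ^ D * measure (Rn D) K" by simp
  then have "(sqrt (2 * pi) / \<rho>) ^ D * (1 / 2) \<le> (sqrt (2 * pi) / \<rho>) ^ D * ((\<rho> / sqrt (2 * pi)) ^ D * measure (Rn D) K)"
    using \<rho> by (intro mult_left_mono) auto
  also have "\<dots> = measure (Rn D) K"
    using \<rho> by (simp add: power_divide)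
  finally show ?thesis by (simp add: mult.commute)
qed

end

theorem theorem2p1:
  fixes k :: nat
  assumes "k \<ge> 1"
  shows "\<exists>\<alpha>\<^sub>1 \<beta>\<^sub>1 :: real. \<alpha>\<^sub>1 > 0 \<and> \<beta>\<^sub>1 > 0 \<and>
    (\<forall>n::nat. n \<ge> 2 \<longrightarrow>
      (let M = mean_zero_forms n (2 * k);
           D = form.dim M;
           q = (form_volume n M (nonneg_section n k) / form_volume n M (form_ball n M)) powr (1 / real D)
       in \<beta>\<^sub>1 * real n powr (-1/2) \<le> q \<and> q \<le> \<alpha>\<^sub>1 * real n powr (-1/2)))"
proof -
  obtain C where C: "C > 0" "\<And>n f. n \<ge> 1 \<Longrightarrow> f \<in> mean_zero_forms n (2 * k) \<Longrightarrow>
    (\<And>v. L2_set v {..<n} = 1 \<Longrightarrow> \<bar>f v\<bar> \<le> 1) \<Longrightarrow> form_inner n f f \<le> C / real n"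
    using sup_bounded_form_inner_le[OF assms] by blast
  \<comment> \<open>The ratio of the radii sqrt (D/e) and \<rho> is 1/(2^(k+2) e sqrt n), free of D;
    the additional 1/2 pays for the Gaussian mass 1/2.\<close>
  define \<beta> where "\<beta> = (1 / (2 * (2 ^ (k + 2) * exp 1)) :: real)"
  have "\<beta> * real n powr (-1/2) \<le> q \<and> q \<le> 8 * sqrt C * real n powr (-1/2)"
    if n: "n \<ge> 2" and q: "q = (form_volume n M (nonneg_section n k) / form_volume n M (form_ball n M)) powr (1 / real D)"
      and M: "M = mean_zero_forms n (2 * k)" and D: "D = form.dim M" for n M D q
  proof -
    obtain b where b: "orthonormal_basis n (mean_zero_forms n (2 * k)) b"
      using orthonormal_basis_exists[OF _ mean_zero_forms_subspace mean_zero_forms_subset] n by fastforce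
    interpret fc: form_coordinates n k b by unfold_locales (use n assms b in auto)
    define V where "V = measure (Rn D) fc.K"
    define B where "B = measure (Rn D) (unit_ball D)"
    have q: "q = (V / B) powr (1 / real D)"
      unfolding q M V_def B_def D fc.volume_section fc.volume_ball ..
    have D1: "D \<ge> 1" unfolding D M by (rule fc.D_pos)
    have B: "B > 0"
      unfolding B_def using unit_ball_nonnull[of D] unit_ball_finite[of D]
      by (simp add: measure_def enn2real_positive_iff)
    have root: "(x ^ D) powr (1 / real D) = x" if "x > 0" for x :: real
      using that D1 by (simp add: powr_realpow[symmetric] powr_powr)
    have npowr: "real n powr (-1/2) = 1 / sqrt (real n)"
      using n powr_minus_divide[of "real n" "1/2"] by (simp add: powr_half_sqrt)
    have "V \<le> (8 * sqrt (C / n)) ^ D * B"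
      unfolding V_def B_def D M by (rule fc.section_volume_le[OF C(1) C(2)]) (use n in auto)
    then have "V / B \<le> (8 * sqrt (C / n)) ^ D" using B by (simp add: pos_divide_le_eq)
    then have "q \<le> ((8 * sqrt (C / n)) ^ D) powr (1 / real D)"
      unfolding q using B by (intro powr_mono2) (auto simp: V_def)
    also have "\<dots> = 8 * sqrt (C / n)" using C n by (intro root) auto
    finally have upper: "q \<le> 8 * sqrt C * real n powr (-1/2)"
      unfolding npowr by (simp add: real_sqrt_divide)
    define \<rho> where "\<rho> = sqrt (2 ^ (2 * k + 4) * exp 1 * real D * real n)"
    have \<rho>: "\<rho> > 0" using D1 n by (simp add: \<rho>_def)
    have "1 / 2 * (sqrt (2 * pi) / \<rho>) ^ D \<le> V"
      using fc.section_volume_ge unfolding V_def \<rho>_def D M .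
    \<comment> \<open>Lowering 1/2 to (1/2)^D, possible as D \<ge> 1, makes the whole lower bound a
      D-th power.\<close>
    moreover have "(1 / 2) ^ D \<le> (1 / 2 :: real)" using power_decreasing[of 1 D "1/2 :: real"] D1 by simp
    ultimately have V: "(1 / 2) ^ D * (sqrt (2 * pi) / \<rho>) ^ D \<le> V"
      using \<rho> by (meson dual_order.trans mult_right_mono zero_le_power divide_nonneg_pos real_sqrt_ge_zero pi_ge_zero mult_nonneg_nonneg zero_le_numeral)
    have "B \<le> sqrt (2 * pi * exp 1 / D) ^ D" unfolding B_def by (rule measure_unit_ball_le[OF D1])
    moreover have "sqrt (2 * pi * exp 1 / D) = sqrt (2 * pi) / sqrt (real D / exp 1)"
      using D1 by (simp add: real_sqrt_divide[symmetric])
    ultimately have Bu: "B \<le> (sqrt (2 * pi) / sqrt (real D / exp 1)) ^ D" by simp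
    have \<beta>: "\<beta> * real n powr (-1/2) = 1 / 2 * (sqrt (real D / exp 1) / \<rho>)"
    proof -
      have "sqrt (real D / exp 1) / \<rho> = sqrt (1 / ((2 ^ (k + 2))\<^sup>2 * (exp 1)\<^sup>2 * n))"
        unfolding \<rho>_def real_sqrt_divide[symmetric] using D1 n
        by (intro arg_cong[of _ _ sqrt]) (simp add: field_simps power2_eq_square power_add power_mult)
      also have "\<dots> = 1 / (2 ^ (k + 2) * exp 1 * sqrt n)" by (simp add: real_sqrt_divide real_sqrt_mult)
      finally show ?thesis unfolding npowr by (simp add: \<beta>_def)
    qed
    have "(\<beta> * real n powr (-1/2)) ^ D * B \<le> (\<beta> * real n powr (-1/2)) ^ D * (sqrt (2 * pi) / sqrt (real D / exp 1)) ^ D"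
      by (intro mult_left_mono Bu) (simp add: \<beta>_def)
    also have "\<dots> = (1 / 2) ^ D * (sqrt (2 * pi) / \<rho>) ^ D"
      unfolding \<beta> power_mult_distrib[symmetric] using D1 by simp
    also note V
    finally have "(\<beta> * real n powr (-1/2)) ^ D \<le> V / B" using B by (simp add: pos_le_divide_eq)
    then have "((\<beta> * real n powr (-1/2)) ^ D) powr (1 / real D) \<le> q"
      unfolding q by (intro powr_mono2) (auto simp: \<beta>_def)
    moreover have "((\<beta> * real n powr (-1/2)) ^ D) powr (1 / real D) = \<beta> * real n powr (-1/2)"
      using n by (intro root) (simp add: \<beta>_def)
    ultimately show ?thesis using upper by simp
  qed
  then show ?thesis
    using C(1) by (intro exI[of _ "8 * sqrt C"] exI[of _ \<beta>]) (auto simp: Let_def \<beta>_def)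
qed

end
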